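(* Let $0<s<1$, $p>1$, and let $\Omega\subset\mathbb{R}^N$ be a smooth open bounded set with $0\in\Omega$. Let $\alpha=ps<N$, $r\in\,]p,p^*[$, $q=p^*_\alpha=p$, $\lambda,\mu>0$ and $\mu<\lambda_{1,ps}$. Then the problem \[ (-\Delta_p)^s u=\lambda|u|^{r-2}u+\mu\frac{|u|^{p-2}u}{|x|^{ps}}\ \text{ in }\Omega,\qquad u=0\ \text{ in }\mathbb{R}^N\setminus\Omega, \] has both a positive and a sign-changing solution of minimal energy.
   Context: Exponents: $p^*=\frac{Np}{N-ps}$, $p^*_\alpha=\frac{(N-\alpha)p}{N-ps}$ (so $p^*_{ps}=p$). Space: $W^{s,p}_0(\Omega)$ is the set of $u\in L^1_{\rm loc}(\mathbb{R}^N)$ with $u\equiv0$ a.e. in $\mathbb{R}^N\setminus\Omega$ and $[u]_{s,p}^p:=\int_{\mathbb{R}^{2N}}\frac{|u(x)-u(y)|^p}{|x-y|^{N+ps}}\,dx\,dy<+\infty$, a Banach space with norm $[\cdot]_{s,p}$. The operator $(-\Delta_p)^s$ is the differential of $u\mapsto\frac1p[u]_{s,p}^p$ on $W^{s,p}_0(\Omega)$. Hardy constant: $\lambda_{1,ps}:=\inf_{u\in W^{s,p}_0(\Omega)\setminus\{0\}}\frac{[u]_{s,p}^p}{\int_\Omega|u|^p|x|^{-ps}\,dx}>0$. Energy: $J(u)=\frac1p[u]_{s,p}^p-\frac{\lambda}{r}\int_\Omega|u|^r\,dx-\frac{\mu}{p}\int_\Omega\frac{|u|^p}{|x|^{ps}}\,dx$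 on $W^{s,p}_0(\Omega)$. Solutions are weak solutions, i.e. critical points $u\in W^{s,p}_0(\Omega)$ of $J$. A function is sign-changing if both $u^+=\max\{u,0\}$ and $u^-=\min\{u,0\}$ are not identically zero. A positive (resp. sign-changing) solution is "of minimal energy" if it minimizes $J$ among all positive (resp. sign-changing) solutions of the problem. *)

theory Defs
  imports "HOL-Analysis.Analysis"
begin

text \<open>
  The space \<open>\<real>\<^sup>N\<close> is a type \<open>'a::euclidean_space\<close> with \<open>N = DIM('a)\<close>. Elements of the function
  spaces are classes modulo almost everywhere equality, represented here by Lebesgue measurable
  functions; all conditions below are invariant under a.e. modification.
\<close>

primrec C_k :: "nat \<Rightarrow> ('a::euclidean_space \<Rightarrow> real) \<Rightarrow> bool" where
  "C_k 0 f \<longleftrightarrow> continuous_on UNIV f"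
| "C_k (Suc k) f \<longleftrightarrow>
     (\<forall>x. f differentiable (at x)) \<and> (\<forall>v. C_k k (\<lambda>x. frechet_derivative f (at x) v))"

text \<open>
  Smooth boundary: near each boundary point, after a rotation of the coordinates,
  \<open>\<Omega>\<close> is the region above the graph of a \<open>C\<^sup>\<infinity>\<close> function of the first \<open>N - 1\<close> coordinates.
  The unit vector \<open>\<nu>\<close> plays the role of the last coordinate axis; that \<open>\<gamma>\<close> depends on the other
  coordinates only is its invariance along \<open>\<nu>\<close>.
\<close>
definition smooth_boundary :: "'a::euclidean_space set \<Rightarrow> bool" where
  "smooth_boundary \<Omega> \<longleftrightarrow>
     (\<forall>x0 \<in> frontier \<Omega>. \<exists>\<rho> > 0. \<exists>\<nu> \<gamma>. norm \<nu> = 1 \<and> (\<forall>k. C_k k \<gamma>) \<and>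
        (\<forall>x t. \<gamma> (x + t *\<^sub>R \<nu>) = \<gamma> x) \<and>
        \<Omega> \<inter> ball x0 \<rho> = {x \<in> ball x0 \<rho>. \<gamma> x < x \<bullet> \<nu>})"

text \<open>The critical Sobolev exponent \<open>p\<^sup>*\<close>.\<close>

definition crit_exp :: "nat \<Rightarrow> real \<Rightarrow> real \<Rightarrow> real" where
  "crit_exp N s p = real N * p / (real N - p * s)"

text \<open>The \<open>p\<close>-th power of the Gagliardo seminorm, with values in \<open>[0,\<infinity>]\<close>.\<close>

definition gagliardo_pow :: "real \<Rightarrow> real \<Rightarrow> ('a::euclidean_space \<Rightarrow> real) \<Rightarrow> ennreal" where
  "gagliardo_pow s p u =
     (\<integral>\<^sup>+ z. ennreal (\<bar>u (fst z) - u (snd z)\<bar> powr p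
                    / norm (fst z - snd z) powr (real DIM('a) + p * s))
        \<partial>(lebesgue :: ('a \<times> 'a) measure))"

definition W0 :: "real \<Rightarrow> real \<Rightarrow> 'a::euclidean_space set \<Rightarrow> ('a \<Rightarrow> real) set" where
  "W0 s p \<Omega> = {u. (\<forall>K. compact K \<longrightarrow> u absolutely_integrable_on K) \<and>
                   (AE x in lebesgue. x \<notin> \<Omega> \<longrightarrow> u x = 0) \<and>
                   gagliardo_pow s p u < \<infinity>}"

definition W0_norm :: "real \<Rightarrow> real \<Rightarrow> ('a::euclidean_space \<Rightarrow> real) \<Rightarrow> real" where
  "W0_norm s p u = enn2real (gagliardo_pow s p u) powr (1 / p)"

definition hardy_const :: "real \<Rightarrow> real \<Rightarrow> 'a::euclidean_space set \<Rightarrow> ennreal" where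
  "hardy_const s p \<Omega> =
     (INF u \<in> {u \<in> W0 s p \<Omega>. \<not> (AE x in lebesgue. u x = 0)}.
        gagliardo_pow s p u
        / (\<integral>\<^sup>+ x \<in> \<Omega>. ennreal (\<bar>u x\<bar> powr p / norm x powr (p * s)) \<partial>lebesgue))"

definition energy ::
  "real \<Rightarrow> real \<Rightarrow> real \<Rightarrow> real \<Rightarrow> real \<Rightarrow> 'a::euclidean_space set \<Rightarrow> ('a \<Rightarrow> real) \<Rightarrow> real" where
  "energy s p r \<Lambda> \<mu> \<Omega> u =
     1 / p * enn2real (gagliardo_pow s p u)
     - \<Lambda> / r * (LINT x:\<Omega>|lebesgue. \<bar>u x\<bar> powr r)
     - \<mu> / p * (LINT x:\<Omega>|lebesgue. \<bar>u x\<bar> powr p / norm x powr (p * s))"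

text \<open>
  \<open>u\<close> is a critical point of \<open>J\<close> on the Banach space \<open>W\<^sub>0\<^sup>s\<^sup>,\<^sup>p(\<Omega>)\<close>: the Frechet differential of \<open>J\<close> at \<open>u\<close>
  exists and vanishes, that is \<open>J (u + v) - J u = o([v])\<close> as \<open>[v] \<rightarrow> 0\<close>.
\<close>
definition critical_point ::
  "real \<Rightarrow> real \<Rightarrow> 'a::euclidean_space set \<Rightarrow> (('a \<Rightarrow> real) \<Rightarrow> real) \<Rightarrow> ('a \<Rightarrow> real) \<Rightarrow> bool" where
  "critical_point s p \<Omega> J u \<longleftrightarrow>
     u \<in> W0 s p \<Omega> \<and>
     (\<forall>\<epsilon> > 0. \<exists>\<delta> > 0. \<forall>v \<in> W0 s p \<Omega>. W0_norm s p v < \<delta> \<longrightarrow>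
        \<bar>J (\<lambda>x. u x + v x) - J u\<bar> \<le> \<epsilon> * W0_norm s p v)"

definition weak_solution ::
  "real \<Rightarrow> real \<Rightarrow> real \<Rightarrow> real \<Rightarrow> real \<Rightarrow> 'a::euclidean_space set \<Rightarrow> ('a \<Rightarrow> real) \<Rightarrow> bool" where
  "weak_solution s p r \<Lambda> \<mu> \<Omega> u \<longleftrightarrow> critical_point s p \<Omega> (energy s p r \<Lambda> \<mu> \<Omega>) u"

definition positive_on :: "'a::euclidean_space set \<Rightarrow> ('a \<Rightarrow> real) \<Rightarrow> bool" where
  "positive_on \<Omega> u \<longleftrightarrow> (AE x in lebesgue. x \<in> \<Omega> \<longrightarrow> 0 < u x)"

definition sign_changing :: "('a::euclidean_space \<Rightarrow> real) \<Rightarrow> bool" where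
  "sign_changing u \<longleftrightarrow>
     \<not> (AE x in lebesgue. max (u x) 0 = 0) \<and> \<not> (AE x in lebesgue. min (u x) 0 = 0)"

definition minimizes_on :: "('b \<Rightarrow> real) \<Rightarrow> ('b \<Rightarrow> bool) \<Rightarrow> 'b \<Rightarrow> bool" where
  "minimizes_on J P u \<longleftrightarrow> P u \<and> (\<forall>v. P v \<longrightarrow> J u \<le> J v)"

end

theory Submission
  imports Defs "HOL-Complex_Analysis.Great_Picard"
begin

text \<open>
  Write \<open>[u]\<close> for the Gagliardo seminorm, \<open>A u = [u]\<^sup>p - \<mu> \<integral> \<bar>u\<bar>\<^sup>p / \<bar>x\<bar>\<^sup>p\<^sup>s\<close> and \<open>R u = \<integral> \<bar>u\<bar>\<^sup>r\<close>, so that the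
  energy is \<open>J = A / p - (\<Lambda> / r) R\<close>. Since \<open>\<mu>\<close> lies strictly below the Hardy constant, \<open>A\<close> is bounded
  below by a positive multiple of \<open>[u]\<^sup>p\<close>. Both solutions are found by minimizing \<open>J\<close> over a set
  that contains every competitor and on which \<open>J = (1/p - 1/r) \<Lambda> R\<close>; minimality among the solutions
  of the respective sign is then automatic, and what remains is that the minimum is attained
  and that a minimizer is a critical point.

  Attainment. A bounded sequence in \<open>W\<^sub>0\<close> has an almost everywhere convergent subsequence, because
  averages over small dyadic cells approximate all its members uniformly in mean
  (\<open>cell_avg_approximation\<close>); with the critical Sobolev inequality (\<open>sobolev\<close>) the convergence is
  strong in \<open>L\<^sup>r\<close>, as \<open>r < p\<^sup>*\<close>. The Hardy term is critical and not weakly continuous, but by the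
  Brezis-Lieb lemma \<open>A (u\<^sub>n) - A (u\<^sub>n - u) \<rightarrow> A u\<close>, and the nonnegative term \<open>A (u\<^sub>n - u)\<close> only helps:
  \<open>J\<close> is lower semicontinuous along such sequences (\<open>J_lower_semicontinuous\<close>).

  Positive solution. \<open>J\<close> is minimized over the Nehari set \<open>A u = \<Lambda> R u\<close>, \<open>u \<noteq> 0\<close>. Replacing \<open>u\<close> by \<open>\<bar>u\<bar>\<close>
  does not increase \<open>A\<close>, so the minimizer may be taken nonnegative. It minimizes the scale
  invariant quotient \<open>A\<^sup>r / R\<^sup>p\<close> and is therefore critical. Testing with \<open>(\<epsilon> \<eta> - u)\<^sup>+\<close> for a bump \<open>\<eta>\<close>
  and letting \<open>\<epsilon> \<rightarrow> 0\<close> shows that it cannot vanish on a set of positive measure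
  (\<open>strong_maximum_principle\<close>).

  Sign-changing solution. \<open>J\<close> is minimized over the nodal Nehari set, where \<open>u\<^sup>+\<close> and \<open>u\<^sup>-\<close> are nonzero
  and the differential of \<open>J\<close> at \<open>u\<close> vanishes on both of them. The nonlocal interaction of the parts
  is controlled by convexity: \<open>A (a u\<^sup>+ + b u\<^sup>-) \<le> a\<^sup>p A'(u) u\<^sup>+ / p + b\<^sup>p A'(u) u\<^sup>- / p\<close> for \<open>a, b \<ge> 0\<close>
  (\<open>A_scale_parts_le\<close>), so that \<open>u\<close> maximizes \<open>J\<close> on its own quadrant \<open>a u\<^sup>+ + b u\<^sup>-\<close>
  (\<open>nodal_fibre_le\<close>); conversely every quadrant meets the set (\<open>nodal_scaling\<close>). If the
  differential at the minimizer were negative in some direction \<open>v\<close>, then a small square of functions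
  \<open>a u\<^sup>+ + b u\<^sup>- + e v\<close> would have energy below the minimum, while Miranda's theorem finds a point
  of the nodal set in it (\<open>nodal_minimizer_descent_impossible\<close>).
\<close>

section \<open>The power function and its derivative\<close>

text \<open>
  The derivative of \<open>\<bar>t\<bar>\<^sup>p / p\<close>, that is \<open>\<bar>t\<bar>\<^sup>p\<^sup>-\<^sup>2 t\<close> written so that it makes sense at \<open>0\<close> also for \<open>p < 2\<close>.
\<close>
definition dpow :: "real \<Rightarrow> real \<Rightarrow> real" where
  "dpow p t = sgn t * \<bar>t\<bar> powr (p - 1)"

lemma dpow_0 [simp]: "dpow p 0 = 0"
  by (simp add: dpow_def)

lemma abs_powr_mult_base: "\<bar>t\<bar> powr (p - 1) * \<bar>t\<bar> = \<bar>t\<bar> powr p" for t :: real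
  by (cases "t = 0") (simp_all add: powr_diff)

lemma dpow_times_self [simp]: "dpow p t * t = \<bar>t\<bar> powr p"
proof -
  have "dpow p t * t = \<bar>t\<bar> powr (p - 1) * (sgn t * t)" by (simp add: dpow_def)
  also have "sgn t * t = \<bar>t\<bar>" by (simp add: sgn_if)
  finally show ?thesis by (simp add: abs_powr_mult_base)
qed

lemma abs_dpow [simp]: "\<bar>dpow p t\<bar> = \<bar>t\<bar> powr (p - 1)"
  by (cases "t = 0") (simp_all add: dpow_def abs_mult abs_sgn_eq)

lemma dpow_minus [simp]: "dpow p (- t) = - dpow p t"
  by (simp add: dpow_def sgn_minus)

lemma dpow_pos: "0 \<le> t \<Longrightarrow> dpow p t = t powr (p - 1)"
  by (cases "t = 0") (simp_all add: dpow_def)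

lemma dpow_nonneg: "0 \<le> t \<Longrightarrow> 0 \<le> dpow p t"
  by (simp add: dpow_pos)

lemma dpow_nonpos: "t \<le> 0 \<Longrightarrow> dpow p t \<le> 0"
  using dpow_nonneg[of "- t" p] by simp

lemma dpow_scale: "0 \<le> c \<Longrightarrow> dpow p (c * t) = c powr (p - 1) * dpow p t"
  by (cases "c = 0") (simp_all add: dpow_def sgn_mult abs_mult powr_mult)

lemma dpow_measurable [measurable]: "dpow p \<in> borel_measurable borel"
  unfolding dpow_def by measurable

lemma has_real_derivative_abs_powr:
  assumes "1 < p"
  shows "((\<lambda>t. \<bar>t\<bar> powr p) has_real_derivative p * dpow p t) (at t)"
proof -
  consider "t > 0" | "t < 0" | "t = 0" by linarith
  then show ?thesis
  proof cases
    case 1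
    have "((\<lambda>t. t powr p) has_real_derivative p * t powr (p - 1)) (at t)"
      using 1 by (rule has_real_derivative_powr)
    then have "((\<lambda>t. \<bar>t\<bar> powr p) has_real_derivative p * t powr (p - 1)) (at t)"
      by (rule DERIV_cong_ev[THEN iffD1, rotated -1])
         (use 1 in \<open>auto intro!: eventually_mono[OF eventually_nhds_in_open[of "{0<..}" t]]\<close>)
    then show ?thesis using 1 by (simp add: dpow_pos)
  next
    case 2
    have "((\<lambda>t. (- t) powr p) has_real_derivative (p * (- t) powr (p - 1)) * (- 1)) (at t)"
      by (rule DERIV_chain'[where g = "\<lambda>t. t powr p"])
         (use 2 in \<open>auto intro!: derivative_eq_intros has_real_derivative_powr simp: powr_minus\<close>)
    then have "((\<lambda>t. \<bar>t\<bar> powr p) has_real_derivative (p * (- t) powr (p - 1)) * (- 1)) (at t)"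
      by (rule DERIV_cong_ev[THEN iffD1, rotated -1])
         (use 2 in \<open>auto intro!: eventually_mono[OF eventually_nhds_in_open[of "{..<0}" t]]\<close>)
    moreover have "dpow p t = - ((- t) powr (p - 1))"
      using 2 dpow_minus[of p t] dpow_pos[of "- t" p] by simp
    ultimately show ?thesis by simp
  next
    case 3
    have "((\<lambda>h. \<bar>h\<bar> powr (p - 1)) \<longlongrightarrow> \<bar>0\<bar> powr (p - 1)) (at (0::real))"
      using assms by (intro tendsto_powr' tendsto_intros) auto
    then have "((\<lambda>h. \<bar>h\<bar> powr (p - 1)) \<longlongrightarrow> 0) (at (0::real))"
      by simp
    then have "((\<lambda>h. \<bar>h\<bar> powr p / h) \<longlongrightarrow> 0) (at (0::real))"
    proof (rule tendsto_0_le[where K = 1], intro always_eventually allI)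
      fix h :: real
      show "norm (\<bar>h\<bar> powr p / h) \<le> norm (\<bar>h\<bar> powr (p - 1)) * 1"
        by (cases "h = 0") (simp_all add: powr_diff)
    qed
    then show ?thesis using 3 assms by (simp add: has_field_derivative_iff)
  qed
qed

lemma isCont_dpow:
  assumes "1 < p"
  shows "isCont (dpow p) t"
proof (cases "t = 0")
  case False
  have "isCont (\<lambda>t. sgn t * \<bar>t\<bar> powr (p - 1)) t"
    using False by (intro continuous_intros) auto
  then show ?thesis by (simp add: dpow_def[abs_def])
next
  case True
  have "((\<lambda>h. \<bar>h\<bar> powr (p - 1)) \<longlongrightarrow> \<bar>0\<bar> powr (p - 1)) (at (0::real))"
    using assms by (intro tendsto_powr' tendsto_intros) auto
  then have "((\<lambda>h. \<bar>dpow p h\<bar>) \<longlongrightarrow> 0) (at (0::real))"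
    by simp
  then have "(dpow p \<longlongrightarrow> 0) (at (0::real))"
    by (rule tendsto_rabs_zero_cancel)
  then show ?thesis using True by (simp add: isCont_def)
qed

text \<open>
  Either \<open>\<bar>b\<bar> \<le> \<epsilon>\<bar>a\<bar>\<close>, and then the first term suffices, or \<open>\<bar>a\<bar> < \<bar>b\<bar> / \<epsilon>\<close>, and then the second does. In the
  estimates below it takes the place of the Hoelder inequality.
\<close>
lemma young_weighted:
  fixes a b :: real
  assumes "1 < p" "0 < \<epsilon>"
  shows "\<bar>a\<bar> powr (p - 1) * \<bar>b\<bar> \<le> \<epsilon> * \<bar>a\<bar> powr p + \<epsilon> powr (1 - p) * \<bar>b\<bar> powr p"
proof (cases "\<bar>b\<bar> \<le> \<epsilon> * \<bar>a\<bar>")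
  case True
  have "\<bar>a\<bar> powr (p - 1) * \<bar>b\<bar> \<le> \<bar>a\<bar> powr (p - 1) * (\<epsilon> * \<bar>a\<bar>)"
    using True by (intro mult_left_mono) auto
  also have "\<dots> = \<epsilon> * \<bar>a\<bar> powr p" using abs_powr_mult_base[of a p] by (simp add: mult_ac)
  finally show ?thesis by (smt (verit) mult_nonneg_nonneg powr_ge_zero)
next
  case False
  then have "\<bar>a\<bar> \<le> \<bar>b\<bar> / \<epsilon>" using assms by (simp add: field_simps)
  then have "\<bar>a\<bar> powr (p - 1) * \<bar>b\<bar> \<le> (\<bar>b\<bar> / \<epsilon>) powr (p - 1) * \<bar>b\<bar>"
    using assms by (intro mult_right_mono powr_mono2) auto
  also have "\<dots> = \<epsilon> powr (1 - p) * \<bar>b\<bar> powr p"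
  proof -
    have "(\<bar>b\<bar> / \<epsilon>) powr (p - 1) = \<bar>b\<bar> powr (p - 1) * \<epsilon> powr (1 - p)"
      using assms powr_minus_divide[of \<epsilon> "p - 1"] by (simp add: powr_divide)
    then show ?thesis using abs_powr_mult_base[of b p] by (simp add: mult_ac)
  qed
  finally show ?thesis using assms by (smt (verit) mult_nonneg_nonneg powr_ge_zero)
qed

lemma abs_add_powr_le:
  fixes a b :: real
  assumes "0 \<le> p"
  shows "\<bar>a + b\<bar> powr p \<le> 2 powr p * (\<bar>a\<bar> powr p + \<bar>b\<bar> powr p)"
proof -
  have "\<bar>a + b\<bar> powr p \<le> (2 * max \<bar>a\<bar> \<bar>b\<bar>) powr p"
    using assms by (intro powr_mono2) auto
  also have "\<dots> = 2 powr p * max \<bar>a\<bar> \<bar>b\<bar> powr p" by (simp add: powr_mult)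
  also have "max \<bar>a\<bar> \<bar>b\<bar> powr p \<le> \<bar>a\<bar> powr p + \<bar>b\<bar> powr p"
    by (simp add: max_def)
  finally show ?thesis by simp
qed

text \<open>
  By homogeneity it is enough to take \<open>a = 1\<close>: for small \<open>b\<close> this is differentiability of
  \<open>\<bar>t\<bar>\<^sup>p\<close> at \<open>1\<close>, and for the remaining \<open>b\<close> every term is bounded by a multiple of \<open>\<bar>b\<bar>\<^sup>p\<close>.
\<close>
lemma abs_powr_first_order:
  fixes p \<epsilon> :: real
  assumes p: "1 < p" and \<epsilon>: "0 < \<epsilon>"
  obtains C where "0 \<le> C"
    "\<And>a b. \<bar>\<bar>a + b\<bar> powr p - \<bar>a\<bar> powr p - p * dpow p a * b\<bar>
        \<le> \<epsilon> * (\<bar>a\<bar> powr (p - 1) * \<bar>b\<bar>) + C * \<bar>b\<bar> powr p"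
proof -
  have "((\<lambda>t. \<bar>t\<bar> powr p) has_real_derivative p) (at 1)"
    using has_real_derivative_abs_powr[OF p, of 1] by (simp add: dpow_def)
  then have "(\<lambda>h. (\<bar>1 + h\<bar> powr p - \<bar>1\<bar> powr p) / h) \<midarrow>0\<rightarrow> p"
    by (simp add: DERIV_def)
  then obtain \<eta> where \<eta>: "\<eta> > 0"
    and \<eta>_le: "\<And>h. h \<noteq> 0 \<Longrightarrow> \<bar>h\<bar> < \<eta> \<Longrightarrow> \<bar>(\<bar>1 + h\<bar> powr p - 1) / h - p\<bar> < \<epsilon>"
    using \<epsilon> unfolding LIM_def by (auto simp: dist_real_def)
  define C where "C = (1 / \<eta> + 1) powr p + (1 / \<eta>) powr p + p * (1 / \<eta>) powr (p - 1) + 1"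
  have C: "1 \<le> C" using p by (simp add: C_def)
  have one: "\<bar>\<bar>1 + h\<bar> powr p - 1 - p * h\<bar> \<le> \<epsilon> * \<bar>h\<bar> + C * \<bar>h\<bar> powr p" for h :: real
  proof (cases "\<bar>h\<bar> < \<eta>")
    case True
    have "\<bar>\<bar>1 + h\<bar> powr p - 1 - p * h\<bar> \<le> \<epsilon> * \<bar>h\<bar>"
    proof (cases "h = 0")
      case False
      have "\<bar>1 + h\<bar> powr p - 1 - p * h = ((\<bar>1 + h\<bar> powr p - 1) / h - p) * h"
        using False by (simp add: field_simps)
      then have "\<bar>\<bar>1 + h\<bar> powr p - 1 - p * h\<bar> = \<bar>(\<bar>1 + h\<bar> powr p - 1) / h - p\<bar> * \<bar>h\<bar>"
        by (simp only: abs_mult)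
      also have "\<dots> \<le> \<epsilon> * \<bar>h\<bar>"
        using \<eta>_le[OF False True] by (intro mult_right_mono) auto
      finally show ?thesis .
    qed simp
    moreover have "0 \<le> C * \<bar>h\<bar> powr p" using C by simp
    ultimately show ?thesis by linarith
  next
    case False
    then have h: "1 \<le> \<bar>h\<bar> / \<eta>" using \<eta> by simp
    have "\<bar>1 + h\<bar> \<le> (1 / \<eta> + 1) * \<bar>h\<bar>" using h by (simp add: algebra_simps)
    then have "\<bar>1 + h\<bar> powr p \<le> ((1 / \<eta> + 1) * \<bar>h\<bar>) powr p"
      using p by (intro powr_mono2) auto
    then have 1: "\<bar>1 + h\<bar> powr p \<le> (1 / \<eta> + 1) powr p * \<bar>h\<bar> powr p"
      using \<eta> by (simp add: powr_mult)
    have "1 \<le> (\<bar>h\<bar> / \<eta>) powr p" using h p by (intro ge_one_powr_ge_zero) auto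
    then have 2: "1 \<le> (1 / \<eta>) powr p * \<bar>h\<bar> powr p"
      using \<eta> by (simp add: powr_divide)
    have "1 \<le> (\<bar>h\<bar> / \<eta>) powr (p - 1)" using h p by (intro ge_one_powr_ge_zero) auto
    then have "\<bar>h\<bar> \<le> (1 / \<eta>) powr (p - 1) * \<bar>h\<bar> powr (p - 1) * \<bar>h\<bar>"
      using mult_right_mono[of 1 "(\<bar>h\<bar> / \<eta>) powr (p - 1)" "\<bar>h\<bar>"] \<eta> by (simp add: powr_divide)
    then have 3: "\<bar>p * h\<bar> \<le> p * (1 / \<eta>) powr (p - 1) * \<bar>h\<bar> powr p"
      using p abs_powr_mult_base[of h p] mult_left_mono[of _ _ p] by (simp add: abs_mult mult.assoc)
    have "\<bar>\<bar>1 + h\<bar> powr p - 1 - p * h\<bar> \<le> \<bar>1 + h\<bar> powr p + 1 + \<bar>p * h\<bar>"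
      using powr_ge_zero[of "\<bar>1 + h\<bar>" p] by linarith
    also have "\<dots> \<le> C * \<bar>h\<bar> powr p"
      using 1 2 3 powr_ge_zero[of "\<bar>h\<bar>" p] unfolding C_def distrib_right mult_1 by linarith
    finally show ?thesis using \<epsilon> by (smt (verit) mult_nonneg_nonneg abs_ge_zero)
  qed
  show ?thesis
  proof (rule that)
    show "0 \<le> C" using C by simp
    fix a b :: real
    show "\<bar>\<bar>a + b\<bar> powr p - \<bar>a\<bar> powr p - p * dpow p a * b\<bar>
        \<le> \<epsilon> * (\<bar>a\<bar> powr (p - 1) * \<bar>b\<bar>) + C * \<bar>b\<bar> powr p"
    proof (cases "a = 0")
      case True
      have "1 * \<bar>b\<bar> powr p \<le> C * \<bar>b\<bar> powr p" using C by (intro mult_right_mono) auto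
      then show ?thesis using True by simp
    next
      case False
      define h where "h = b / a"
      have b: "b = a * h" using False by (simp add: h_def)
      have "a + b = a * (1 + h)" by (simp add: b algebra_simps)
      then have e1: "\<bar>a + b\<bar> powr p = \<bar>a\<bar> powr p * \<bar>1 + h\<bar> powr p"
        by (simp add: abs_mult powr_mult)
      have e2: "p * dpow p a * b = \<bar>a\<bar> powr p * (p * h)"
        using dpow_times_self[of p a] unfolding b by (simp add: mult_ac)
      have "\<bar>\<bar>a + b\<bar> powr p - \<bar>a\<bar> powr p - p * dpow p a * b\<bar>
          = \<bar>\<bar>a\<bar> powr p * (\<bar>1 + h\<bar> powr p - 1 - p * h)\<bar>"
        unfolding e1 e2 by (simp add: algebra_simps)
      also have "\<dots> = \<bar>a\<bar> powr p * \<bar>\<bar>1 + h\<bar> powr p - 1 - p * h\<bar>"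
        by (simp add: abs_mult)
      also have "\<dots> \<le> \<bar>a\<bar> powr p * (\<epsilon> * \<bar>h\<bar> + C * \<bar>h\<bar> powr p)"
        by (intro mult_left_mono one) auto
      also have "\<dots> = \<epsilon> * (\<bar>a\<bar> powr (p - 1) * \<bar>b\<bar>) + C * \<bar>b\<bar> powr p"
        using abs_powr_mult_base[of a p, symmetric] unfolding b
        by (simp add: abs_mult powr_mult algebra_simps)
      finally show ?thesis .
    qed
  qed
qed

text \<open>
  The pointwise inequality behind the Brezis-Lieb lemma: expand around the large term \<open>b\<close> and absorb
  the first order term by Young's inequality.
\<close>
lemma abs_powr_perturb:
  fixes p \<epsilon> :: real
  assumes p: "1 < p" and \<epsilon>: "0 < \<epsilon>"
  obtains C where "0 \<le> C"
    "\<And>a b. \<bar>\<bar>a + b\<bar> powr p - \<bar>b\<bar> powr p\<bar> \<le> \<epsilon> * \<bar>b\<bar> powr p + C * \<bar>a\<bar> powr p"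
proof -
  obtain C where C: "0 \<le> C"
    "\<And>a b. \<bar>\<bar>a + b\<bar> powr p - \<bar>a\<bar> powr p - p * dpow p a * b\<bar>
        \<le> 1 * (\<bar>a\<bar> powr (p - 1) * \<bar>b\<bar>) + C * \<bar>b\<bar> powr p"
    using abs_powr_first_order[OF p zero_less_one] by blast
  define \<eta> where "\<eta> = \<epsilon> / (p + 1)"
  have \<eta>: "\<eta> > 0" "(p + 1) * \<eta> = \<epsilon>" using p \<epsilon> by (simp_all add: \<eta>_def)
  show ?thesis
  proof (rule that)
    show "0 \<le> (p + 1) * \<eta> powr (1 - p) + C" using C p by simp
    fix a b :: real
    have "\<bar>p * dpow p b * a\<bar> = p * (\<bar>b\<bar> powr (p - 1) * \<bar>a\<bar>)"
      using p by (simp add: abs_mult)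
    then have "\<bar>\<bar>a + b\<bar> powr p - \<bar>b\<bar> powr p\<bar> \<le> (p + 1) * (\<bar>b\<bar> powr (p - 1) * \<bar>a\<bar>) + C * \<bar>a\<bar> powr p"
      using C(2)[of b a] unfolding add.commute[of b a] distrib_right by linarith
    also have "\<dots> \<le> (p + 1) * (\<eta> * \<bar>b\<bar> powr p + \<eta> powr (1 - p) * \<bar>a\<bar> powr p) + C * \<bar>a\<bar> powr p"
      using p \<eta> by (intro add_right_mono mult_left_mono young_weighted) auto
    also have "\<dots> = \<epsilon> * \<bar>b\<bar> powr p + ((p + 1) * \<eta> powr (1 - p) + C) * \<bar>a\<bar> powr p"
      unfolding \<eta>(2)[symmetric] by (simp add: algebra_simps)
    finally show "\<bar>\<bar>a + b\<bar> powr p - \<bar>b\<bar> powr p\<bar>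
        \<le> \<epsilon> * \<bar>b\<bar> powr p + ((p + 1) * \<eta> powr (1 - p) + C) * \<bar>a\<bar> powr p" .
  qed
qed

section \<open>Spaces of p-integrable functions\<close>

definition Lp :: "'b measure \<Rightarrow> real \<Rightarrow> ('b \<Rightarrow> real) set" where
  "Lp M p = {U \<in> borel_measurable M. integrable M (\<lambda>x. \<bar>U x\<bar> powr p)}"

text \<open>
  The \<open>p\<close>-th power of the norm; roots are taken only where homogeneity requires them.
\<close>
definition Lp_pow :: "'b measure \<Rightarrow> real \<Rightarrow> ('b \<Rightarrow> real) \<Rightarrow> real" where
  "Lp_pow M p U = (LINT x|M. \<bar>U x\<bar> powr p)"

lemma Lp_measurable: "U \<in> Lp M p \<Longrightarrow> U \<in> borel_measurable M"
  and Lp_integrable: "U \<in> Lp M p \<Longrightarrow> integrable M (\<lambda>x. \<bar>U x\<bar> powr p)"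
  by (simp_all add: Lp_def)

lemma Lp_pow_nonneg [simp]: "0 \<le> Lp_pow M p U"
  by (simp add: Lp_pow_def)

lemma Lp_iff_nn_integral:
  assumes "U \<in> borel_measurable M"
  shows "U \<in> Lp M p \<longleftrightarrow> (\<integral>\<^sup>+x. ennreal (\<bar>U x\<bar> powr p) \<partial>M) < \<infinity>"
proof -
  have [measurable]: "U \<in> borel_measurable M" by fact
  show ?thesis by (simp add: Lp_def integrable_iff_bounded assms)
qed

lemma ennreal_Lp_pow:
  "U \<in> Lp M p \<Longrightarrow> ennreal (Lp_pow M p U) = (\<integral>\<^sup>+x. ennreal (\<bar>U x\<bar> powr p) \<partial>M)"
  unfolding Lp_pow_def Lp_def by (subst nn_integral_eq_integral) auto

lemma Lp_scale:
  assumes "U \<in> Lp M p"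
  shows "(\<lambda>x. c * U x) \<in> Lp M p" "Lp_pow M p (\<lambda>x. c * U x) = \<bar>c\<bar> powr p * Lp_pow M p U"
  using assms by (auto simp: Lp_def Lp_pow_def abs_mult powr_mult)

lemma Lp_add:
  assumes U: "U \<in> Lp M p" and V: "V \<in> Lp M p" and p: "0 \<le> p"
  shows "(\<lambda>x. U x + V x) \<in> Lp M p"
    "Lp_pow M p (\<lambda>x. U x + V x) \<le> 2 powr p * (Lp_pow M p U + Lp_pow M p V)"
proof -
  have [measurable]: "U \<in> borel_measurable M" "V \<in> borel_measurable M"
    using U V by (auto simp: Lp_def)
  have i: "integrable M (\<lambda>x. 2 powr p * (\<bar>U x\<bar> powr p + \<bar>V x\<bar> powr p))"
    using U V by (auto simp: Lp_def)
  show *: "(\<lambda>x. U x + V x) \<in> Lp M p"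
    unfolding Lp_def
    by (auto intro!: Bochner_Integration.integrable_bound[OF i] abs_add_powr_le[OF p] AE_I2
        order.trans[OF abs_add_powr_le[OF p] abs_ge_self])
  have "Lp_pow M p (\<lambda>x. U x + V x) \<le> (LINT x|M. 2 powr p * (\<bar>U x\<bar> powr p + \<bar>V x\<bar> powr p))"
    unfolding Lp_pow_def
    by (intro integral_mono i abs_add_powr_le p) (use * in \<open>auto simp: Lp_def\<close>)
  also have "\<dots> = 2 powr p * (Lp_pow M p U + Lp_pow M p V)"
    using U V by (simp add: Lp_def Lp_pow_def)
  finally show "Lp_pow M p (\<lambda>x. U x + V x) \<le> 2 powr p * (Lp_pow M p U + Lp_pow M p V)" .
qed

lemma Lp_diff:
  assumes U: "U \<in> Lp M p" and V: "V \<in> Lp M p" and p: "0 \<le> p"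
  shows "(\<lambda>x. U x - V x) \<in> Lp M p"
    "Lp_pow M p (\<lambda>x. U x - V x) \<le> 2 powr p * (Lp_pow M p U + Lp_pow M p V)"
  using Lp_add[OF U Lp_scale(1)[OF V, of "-1"] p] Lp_scale(2)[OF V, of "-1"] by simp_all

lemma Lp_pow_eq_0_iff:
  assumes "U \<in> Lp M p"
  shows "Lp_pow M p U = 0 \<longleftrightarrow> (AE x in M. U x = 0)"
  unfolding Lp_pow_def
  by (subst integral_nonneg_eq_0_iff_AE) (use assms in \<open>auto simp: Lp_def\<close>)

lemma integrable_powr_times:
  assumes U: "U \<in> Lp M p" and V: "V \<in> Lp M p" and p: "1 < p"
  shows "integrable M (\<lambda>x. \<bar>U x\<bar> powr (p - 1) * \<bar>V x\<bar>)"
proof (rule Bochner_Integration.integrable_bound)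
  show "integrable M (\<lambda>x. 1 * \<bar>U x\<bar> powr p + 1 powr (1 - p) * \<bar>V x\<bar> powr p)"
    using U V by (auto simp: Lp_def)
  show "(\<lambda>x. \<bar>U x\<bar> powr (p - 1) * \<bar>V x\<bar>) \<in> borel_measurable M"
    using Lp_measurable[OF U] Lp_measurable[OF V] by measurable
qed (use young_weighted[OF p zero_less_one] in \<open>auto intro!: AE_I2\<close>)

text \<open>
  Makes the integral defining the differential of \<open>\<integral>\<bar>U\<bar>\<^sup>p\<close> at \<open>U\<close> in direction \<open>V\<close> meaningful.
\<close>
lemma integrable_dpow_times:
  assumes U: "U \<in> Lp M p" and V: "V \<in> Lp M p" and p: "1 < p"
  shows "integrable M (\<lambda>x. dpow p (U x) * V x)"
proof (rule Bochner_Integration.integrable_bound[OF integrable_powr_times[OF assms]])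
  show "(\<lambda>x. dpow p (U x) * V x) \<in> borel_measurable M"
    using Lp_measurable[OF U] Lp_measurable[OF V] by measurable
qed (simp add: abs_mult)

text \<open>
  The term \<open>\<bar>a\<bar>\<^sup>p\<^sup>-\<^sup>1 \<bar>b\<bar>\<close> of the pointwise expansion has to be bounded by the first power of the norm
  of \<open>V\<close>; Young's inequality gives this once \<open>V\<close> is scaled to norm one.
\<close>
lemma Lp_pow_frechet:
  fixes p \<epsilon> :: real
  assumes U: "U \<in> Lp M p" and p: "1 < p" and \<epsilon>: "0 < \<epsilon>"
  obtains \<delta> where "0 < \<delta>"
    "\<And>V. V \<in> Lp M p \<Longrightarrow> Lp_pow M p V \<le> \<delta> \<Longrightarrow>
       \<bar>Lp_pow M p (\<lambda>x. U x + V x) - Lp_pow M p U - p * (LINT x|M. dpow p (U x) * V x)\<bar>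
         \<le> \<epsilon> * Lp_pow M p V powr (1 / p)"
proof -
  define I where "I = Lp_pow M p U"
  have I: "0 \<le> I" by (simp add: I_def)
  define \<epsilon>' where "\<epsilon>' = \<epsilon> / (2 * (I + 1))"
  have \<epsilon>': "0 < \<epsilon>'" "\<epsilon>' * (I + 1) = \<epsilon> / 2" using \<epsilon> I by (simp_all add: \<epsilon>'_def field_simps)
  obtain C where C: "0 \<le> C"
    "\<And>a b. \<bar>\<bar>a + b\<bar> powr p - \<bar>a\<bar> powr p - p * dpow p a * b\<bar>
        \<le> \<epsilon>' * (\<bar>a\<bar> powr (p - 1) * \<bar>b\<bar>) + C * \<bar>b\<bar> powr p"
    using abs_powr_first_order[OF p \<epsilon>'(1)] by blast
  \<comment> \<open>With this choice \<open>C \<parallel>V\<parallel>\<^sup>p\<^sup>-\<^sup>1 \<le> \<epsilon> / 2\<close>, so the remainder term is also of first order.\<close>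
  define \<delta> where "\<delta> = (\<epsilon> / (2 * (C + 1))) powr (p / (p - 1))"
  have \<delta>: "0 < \<delta>" using \<epsilon> C by (simp add: \<delta>_def)
  show ?thesis
  proof (rule that[OF \<delta>])
    fix V assume V: "V \<in> Lp M p" and small: "Lp_pow M p V \<le> \<delta>"
    define m where "m = Lp_pow M p V"
    define n where "n = m powr (1 / p)"
    have m: "0 \<le> m" "m \<le> \<delta>" using small by (simp_all add: m_def)
    have n: "0 \<le> n" "n powr p = m" using m p by (simp_all add: n_def powr_powr)
    have UV: "(\<lambda>x. U x + V x) \<in> Lp M p" using Lp_add[OF U V] p by simp
    have young: "(LINT x|M. \<bar>U x\<bar> powr (p - 1) * \<bar>V x\<bar>) \<le> n * (I + 1)"
    proof (cases "n = 0")
      case True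
      then have "Lp_pow M p V = 0" using n p by (simp add: m_def)
      then have ae: "AE x in M. V x = 0" using Lp_pow_eq_0_iff[OF V] by simp
      have "(LINT x|M. \<bar>U x\<bar> powr (p - 1) * \<bar>V x\<bar>) = 0"
        by (rule integral_eq_zero_AE) (use ae in eventually_elim, simp)
      then show ?thesis using True by simp
    next
      case False
      then have n0: "0 < n" using n by simp
      have mn: "m = n powr p" using n by simp
      have "(LINT x|M. \<bar>U x\<bar> powr (p - 1) * \<bar>V x\<bar>)
          \<le> (LINT x|M. n * (\<bar>U x\<bar> powr p + \<bar>V x / n\<bar> powr p))"
      proof (rule integral_mono[OF integrable_powr_times[OF U V p]])
        show "integrable M (\<lambda>x. n * (\<bar>U x\<bar> powr p + \<bar>V x / n\<bar> powr p))"
          using U Lp_scale(1)[OF V, of "1 / n"] by (simp add: Lp_def)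
        fix x
        have "\<bar>U x\<bar> powr (p - 1) * \<bar>V x / n\<bar> \<le> \<bar>U x\<bar> powr p + \<bar>V x / n\<bar> powr p"
          using young_weighted[OF p zero_less_one, of "U x" "V x / n"] by simp
        then have "n * (\<bar>U x\<bar> powr (p - 1) * \<bar>V x / n\<bar>) \<le> n * (\<bar>U x\<bar> powr p + \<bar>V x / n\<bar> powr p)"
          using n by (intro mult_left_mono)
        then show "\<bar>U x\<bar> powr (p - 1) * \<bar>V x\<bar> \<le> n * (\<bar>U x\<bar> powr p + \<bar>V x / n\<bar> powr p)"
          using n0 by (simp add: abs_mult)
      qed
      also have "\<dots> = n * (I + (1 / n) powr p * m)"
        using U Lp_scale(1)[OF V, of "1 / n"] Lp_scale(2)[OF V, of "1 / n"] n0
        by (simp add: Lp_def Lp_pow_def I_def m_def)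
      also have "(1 / n) powr p * m = 1"
        unfolding mn using n0 by (simp add: powr_divide)
      finally show ?thesis .
    qed
    have Cm: "C * m \<le> \<epsilon> / 2 * n"
    proof -
      have "n powr (p - 1) \<le> \<delta> powr ((p - 1) / p)"
        using m p by (simp add: n_def powr_powr) (auto intro: powr_mono2 simp: field_simps)
      also have "\<dots> = \<epsilon> / (2 * (C + 1))"
        using p \<epsilon> C by (simp add: \<delta>_def powr_powr)
      finally have "C * (n powr (p - 1) * n) \<le> C * (\<epsilon> / (2 * (C + 1)) * n)"
        using C n by (intro mult_left_mono mult_right_mono) auto
      also have "\<dots> \<le> \<epsilon> / 2 * n"
      proof -
        have "C * (\<epsilon> / (2 * (C + 1))) \<le> \<epsilon> / 2" using C \<epsilon> by (simp add: field_simps)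
        from mult_right_mono[OF this n(1)] show ?thesis by (simp add: mult.assoc)
      qed
      finally show ?thesis using abs_powr_mult_base[of n p] n by simp
    qed
    have "\<bar>Lp_pow M p (\<lambda>x. U x + V x) - Lp_pow M p U - p * (LINT x|M. dpow p (U x) * V x)\<bar>
      = \<bar>LINT x|M. \<bar>U x + V x\<bar> powr p - \<bar>U x\<bar> powr p - p * dpow p (U x) * V x\<bar>"
      using U V UV integrable_dpow_times[OF U V p]
      by (simp add: Lp_def Lp_pow_def mult.assoc)
    also have "\<dots> \<le> (LINT x|M. \<bar>\<bar>U x + V x\<bar> powr p - \<bar>U x\<bar> powr p - p * dpow p (U x) * V x\<bar>)"
      by (rule integral_abs_bound)
    also have "\<dots> \<le> (LINT x|M. \<epsilon>' * (\<bar>U x\<bar> powr (p - 1) * \<bar>V x\<bar>) + C * \<bar>V x\<bar> powr p)"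
      using U V UV integrable_dpow_times[OF U V p] integrable_powr_times[OF U V p]
      by (intro integral_mono C(2)) (auto simp: Lp_def mult.assoc)
    also have "\<dots> = \<epsilon>' * (LINT x|M. \<bar>U x\<bar> powr (p - 1) * \<bar>V x\<bar>) + C * m"
      using V integrable_powr_times[OF U V p] by (simp add: Lp_def m_def Lp_pow_def)
    also have "\<dots> \<le> \<epsilon>' * (n * (I + 1)) + \<epsilon> / 2 * n"
      using young \<epsilon>' Cm by (intro add_mono mult_left_mono) auto
    also have "\<dots> = (\<epsilon>' * (I + 1)) * n + \<epsilon> / 2 * n" by (simp add: mult_ac)
    also have "\<dots> = \<epsilon> * n" unfolding \<epsilon>' by (simp add: field_simps)
    finally show "\<bar>Lp_pow M p (\<lambda>x. U x + V x) - Lp_pow M p U - p * (LINT x|M. dpow p (U x) * V x)\<bar>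
         \<le> \<epsilon> * Lp_pow M p V powr (1 / p)" by (simp add: n_def m_def)
  qed
qed

lemma Lp_pow_has_derivative:
  fixes p t :: real
  assumes U: "U \<in> Lp M p" and V: "V \<in> Lp M p" and p: "1 < p"
  shows "((\<lambda>t. Lp_pow M p (\<lambda>x. U x + t * V x)) has_real_derivative
            p * (LINT x|M. dpow p (U x + t * V x) * V x)) (at t)"
proof -
  define W where "W = (\<lambda>x. U x + t * V x)"
  have W: "W \<in> Lp M p" unfolding W_def using Lp_add(1)[OF U Lp_scale(1)[OF V]] p by simp
  define n where "n = Lp_pow M p V powr (1 / p)"
  have n: "0 \<le> n" by (simp add: n_def)
  define G where "G = (\<lambda>t. Lp_pow M p (\<lambda>x. U x + t * V x))"
  define d where "d = p * (LINT x|M. dpow p (W x) * V x)"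
  have "(\<lambda>h. (G (t + h) - G t) / h) \<midarrow>0\<rightarrow> d"
    unfolding LIM_eq
  proof (intro allI impI)
    fix \<epsilon> :: real assume \<epsilon>: "0 < \<epsilon>"
    obtain \<delta> where \<delta>: "0 < \<delta>" "\<And>V. V \<in> Lp M p \<Longrightarrow> Lp_pow M p V \<le> \<delta> \<Longrightarrow>
       \<bar>Lp_pow M p (\<lambda>x. W x + V x) - Lp_pow M p W - p * (LINT x|M. dpow p (W x) * V x)\<bar>
         \<le> \<epsilon> / (n + 1) / 2 * Lp_pow M p V powr (1 / p)"
      using Lp_pow_frechet[OF W p, of "\<epsilon> / (n + 1) / 2"] \<epsilon> n by auto
    have "(\<lambda>h. \<bar>h\<bar> powr p * Lp_pow M p V) \<midarrow>0\<rightarrow> \<bar>0\<bar> powr p * Lp_pow M p V"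
      using p by (intro tendsto_intros tendsto_powr') auto
    then have "eventually (\<lambda>h. \<bar>h\<bar> powr p * Lp_pow M p V < \<delta>) (at (0::real))"
      using \<delta>(1) by (auto simp: order_tendsto_iff)
    then obtain \<eta> where \<eta>: "0 < \<eta>" "\<And>h. h \<noteq> 0 \<Longrightarrow> dist h 0 < \<eta> \<Longrightarrow> \<bar>h\<bar> powr p * Lp_pow M p V < \<delta>"
      unfolding eventually_at by auto
    show "\<exists>\<eta>>0. \<forall>h. h \<noteq> 0 \<and> norm (h - 0) < \<eta> \<longrightarrow> norm ((G (t + h) - G t) / h - d) < \<epsilon>"
    proof (intro exI[of _ \<eta>] conjI allI impI \<eta>(1))
      fix h :: real assume h: "h \<noteq> 0 \<and> norm (h - 0) < \<eta>"
      have "Lp_pow M p (\<lambda>x. h * V x) \<le> \<delta>"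
        using Lp_scale(2)[OF V, of h] \<eta>(2)[of h] h by (simp add: dist_real_def)
      from \<delta>(2)[OF Lp_scale(1)[OF V] this]
      have "\<bar>Lp_pow M p (\<lambda>x. W x + h * V x) - Lp_pow M p W - p * (LINT x|M. dpow p (W x) * (h * V x))\<bar>
         \<le> \<epsilon> / (n + 1) / 2 * Lp_pow M p (\<lambda>x. h * V x) powr (1 / p)" .
      moreover have "(\<lambda>x. W x + h * V x) = (\<lambda>x. U x + (t + h) * V x)"
        by (auto simp: W_def algebra_simps)
      moreover have "p * (LINT x|M. dpow p (W x) * (h * V x)) = d * h"
        by (simp add: d_def mult.left_commute mult_ac)
      moreover have "Lp_pow M p (\<lambda>x. h * V x) powr (1 / p) = \<bar>h\<bar> * n"
        using Lp_scale(2)[OF V, of h] p by (simp add: powr_mult powr_powr n_def)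
      ultimately have *: "\<bar>G (t + h) - G t - d * h\<bar> \<le> \<epsilon> / (n + 1) / 2 * (\<bar>h\<bar> * n)"
        by (simp add: G_def W_def)
      have "\<bar>(G (t + h) - G t) / h - d\<bar> = \<bar>G (t + h) - G t - d * h\<bar> / \<bar>h\<bar>"
        using h by (simp add: abs_divide[symmetric] diff_divide_distrib)
      also have "\<dots> \<le> \<epsilon> / (n + 1) / 2 * (\<bar>h\<bar> * n) / \<bar>h\<bar>"
        using * by (intro divide_right_mono) auto
      also have "\<dots> = \<epsilon> / 2 * (n / (n + 1))" using h by simp
      also have "\<dots> \<le> \<epsilon> / 2 * 1" using \<epsilon> n by (intro mult_left_mono) auto
      also have "\<dots> < \<epsilon>" using \<epsilon> by simp
      finally show "norm ((G (t + h) - G t) / h - d) < \<epsilon>" by simp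
    qed
  qed
  then show ?thesis by (simp add: DERIV_def G_def d_def W_def)
qed

text \<open>
  Fatou's lemma in the form in which it bounds the norm of an almost everywhere limit.
\<close>
lemma nn_integral_le_of_AE_limit:
  fixes f :: "nat \<Rightarrow> 'b \<Rightarrow> real"
  assumes [measurable]: "\<And>n. f n \<in> borel_measurable M"
    and lim: "AE x in M. (\<lambda>n. f n x) \<longlonglongrightarrow> g x"
    and le: "\<And>n. (\<integral>\<^sup>+x. ennreal (f n x) \<partial>M) \<le> B"
  shows "(\<integral>\<^sup>+x. ennreal (g x) \<partial>M) \<le> B"
proof -
  have "(\<integral>\<^sup>+x. ennreal (g x) \<partial>M) = (\<integral>\<^sup>+x. liminf (\<lambda>n. ennreal (f n x)) \<partial>M)"
  proof (rule nn_integral_cong_AE)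
    show "AE x in M. ennreal (g x) = liminf (\<lambda>n. ennreal (f n x))"
      using lim
    proof eventually_elim
      case (elim x)
      then have "(\<lambda>n. ennreal (f n x)) \<longlonglongrightarrow> ennreal (g x)" by (rule tendsto_ennrealI)
      then show ?case by (simp add: lim_imp_Liminf)
    qed
  qed
  also have "\<dots> \<le> liminf (\<lambda>n. \<integral>\<^sup>+x. ennreal (f n x) \<partial>M)"
    by (rule nn_integral_liminf) simp
  also have "\<dots> \<le> B"
    by (rule Liminf_le) (use le in auto)
  finally show ?thesis .
qed

text \<open>
  The Brezis-Lieb lemma: the error \<open>\<bar>\<bar>U\<^sub>n\<bar>\<^sup>p - \<bar>U\<^sub>n - U\<bar>\<^sup>p - \<bar>U\<bar>\<^sup>p\<bar>\<close> exceeds \<open>\<epsilon>\<bar>U\<^sub>n - U\<bar>\<^sup>p\<close> by at most a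
  fixed multiple of \<open>\<bar>U\<bar>\<^sup>p\<close>, so the excess tends to zero in mean by dominated convergence.
\<close>
lemma brezis_lieb:
  fixes p B :: real
  assumes Un: "\<And>n. U n \<in> Lp M p" and p: "1 < p"
    and B: "\<And>n. Lp_pow M p (U n) \<le> B"
    and Um: "U' \<in> borel_measurable M"
    and lim: "AE x in M. (\<lambda>n. U n x) \<longlonglongrightarrow> U' x"
  shows "U' \<in> Lp M p"
    and "(\<lambda>n. Lp_pow M p (U n) - Lp_pow M p (\<lambda>x. U n x - U' x)) \<longlonglongrightarrow> Lp_pow M p U'"
proof -
  have meas [measurable]: "\<And>n. U n \<in> borel_measurable M" "U' \<in> borel_measurable M"
    using Un Um by (auto simp: Lp_def)
  have tp: "((\<lambda>n. \<bar>f n\<bar> powr p) \<longlongrightarrow> \<bar>l\<bar> powr p) F" if "(f \<longlongrightarrow> l) F" for f :: "nat \<Rightarrow> real" and l F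
    using that p by (intro tendsto_powr' tendsto_intros) auto
  have "(\<integral>\<^sup>+x. ennreal (\<bar>U' x\<bar> powr p) \<partial>M) \<le> ennreal B"
  proof (rule nn_integral_le_of_AE_limit[where f = "\<lambda>n x. \<bar>U n x\<bar> powr p"])
    show "AE x in M. (\<lambda>n. \<bar>U n x\<bar> powr p) \<longlonglongrightarrow> \<bar>U' x\<bar> powr p"
      using lim by eventually_elim (rule tp)
    show "\<And>n. (\<integral>\<^sup>+x. ennreal (\<bar>U n x\<bar> powr p) \<partial>M) \<le> ennreal B"
      using B Un by (simp add: ennreal_Lp_pow[symmetric] ennreal_leI)
  qed simp
  then show U': "U' \<in> Lp M p"
    by (subst Lp_iff_nn_integral) (auto simp: less_top[symmetric] top_unique)
  define I where "I = Lp_pow M p U'"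
  have D: "(\<lambda>x. U n x - U' x) \<in> Lp M p" for n
    using Lp_diff(1)[OF Un U'] p by simp
  define K where "K = 2 powr p * (B + I)"
  have K: "Lp_pow M p (\<lambda>x. U n x - U' x) \<le> K" for n
    unfolding K_def I_def
    by (rule order.trans[OF Lp_diff(2)[OF Un U']]) (use p B in \<open>auto intro!: mult_left_mono\<close>)
  have K0: "0 \<le> K" using K[of 0] Lp_pow_nonneg order.trans by blast
  define g where "g = (\<lambda>n x. \<bar>\<bar>U n x\<bar> powr p - \<bar>U n x - U' x\<bar> powr p - \<bar>U' x\<bar> powr p\<bar>)"
  have gi: "integrable M (g n)" for n
    unfolding g_def using D Un U' by (auto simp: Lp_def)
  have main: "\<exists>N. \<forall>n\<ge>N. (LINT x|M. g n x) < \<epsilon>" if \<epsilon>: "0 < \<epsilon>" for \<epsilon>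
  proof -
    define \<epsilon>' where "\<epsilon>' = \<epsilon> / (2 * (K + 1))"
    have \<epsilon>': "0 < \<epsilon>'" using \<epsilon> K0 by (simp add: \<epsilon>'_def)
    obtain C where C: "0 \<le> C"
      "\<And>a b. \<bar>\<bar>a + b\<bar> powr p - \<bar>b\<bar> powr p\<bar> \<le> \<epsilon>' * \<bar>b\<bar> powr p + C * \<bar>a\<bar> powr p"
      using abs_powr_perturb[OF p \<epsilon>'] by blast
    \<comment> \<open>The excess of the error over \<open>\<epsilon>' \<bar>U\<^sub>n - U\<bar>\<^sup>p\<close>.\<close>
    define W where "W = (\<lambda>n x. max (g n x - \<epsilon>' * \<bar>U n x - U' x\<bar> powr p) 0)"
    have Wi: "integrable M (W n)" for n
      unfolding W_def using gi[of n] D[of n]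
      by (intro Bochner_Integration.integrable_max) (auto simp: Lp_def)
    have W_le: "W n x \<le> (C + 1) * \<bar>U' x\<bar> powr p" for n x
    proof -
      have "g n x \<le> \<bar>\<bar>U n x\<bar> powr p - \<bar>U n x - U' x\<bar> powr p\<bar> + \<bar>U' x\<bar> powr p"
        unfolding g_def using powr_ge_zero[of "\<bar>U' x\<bar>" p] by linarith
      then show ?thesis using C(2)[of "U' x" "U n x - U' x"] C(1) by (simp add: W_def algebra_simps)
    qed
    have "(\<lambda>n. LINT x|M. W n x) \<longlonglongrightarrow> (LINT x|M. 0)"
    proof (rule integral_dominated_convergence)
      show "integrable M (\<lambda>x. (C + 1) * \<bar>U' x\<bar> powr p)" using U' by (simp add: Lp_def)
      show "AE x in M. (\<lambda>n. W n x) \<longlonglongrightarrow> 0"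
        using lim
      proof eventually_elim
        case (elim x)
        have "(\<lambda>n. U n x - U' x) \<longlonglongrightarrow> U' x - U' x" using elim by (intro tendsto_intros)
        from tp[OF this] have d: "(\<lambda>n. \<bar>U n x - U' x\<bar> powr p) \<longlonglongrightarrow> 0" by simp
        have "(\<lambda>n. W n x) \<longlonglongrightarrow> max (\<bar>\<bar>U' x\<bar> powr p - 0 - \<bar>U' x\<bar> powr p\<bar> - \<epsilon>' * 0) 0"
          unfolding W_def g_def by (intro tendsto_intros d tp elim)
        then show ?case by simp
      qed
      show "AE x in M. norm (W n x) \<le> (C + 1) * \<bar>U' x\<bar> powr p" for n
        using W_le[of n] by (auto simp: W_def)
    qed (use Wi in auto)
    then have "eventually (\<lambda>n. (LINT x|M. W n x) < \<epsilon> / 2) sequentially"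
      using \<epsilon> by (intro order_tendstoD(2)) auto
    then obtain N where N: "\<And>n. N \<le> n \<Longrightarrow> (LINT x|M. W n x) < \<epsilon> / 2"
      by (auto simp: eventually_sequentially)
    have "(LINT x|M. g n x) < \<epsilon>" if n: "N \<le> n" for n
    proof -
      have "(LINT x|M. g n x) \<le> (LINT x|M. W n x + \<epsilon>' * \<bar>U n x - U' x\<bar> powr p)"
        using gi Wi D[of n] by (intro integral_mono) (auto simp: Lp_def W_def)
      also have "\<dots> = (LINT x|M. W n x) + \<epsilon>' * Lp_pow M p (\<lambda>x. U n x - U' x)"
        using Wi D[of n] by (simp add: Lp_def Lp_pow_def)
      also have "\<dots> < \<epsilon> / 2 + \<epsilon>' * K"
        using N[OF n] K[of n] \<epsilon>' by (intro add_less_le_mono mult_left_mono) auto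
      also have "\<epsilon>' * K \<le> \<epsilon> / 2" using \<epsilon> K0 by (simp add: \<epsilon>'_def field_simps)
      finally show ?thesis by simp
    qed
    then show ?thesis by blast
  qed
  have "(\<lambda>n. Lp_pow M p (U n) - Lp_pow M p (\<lambda>x. U n x - U' x) - I) \<longlonglongrightarrow> 0"
  proof (rule LIMSEQ_I)
    fix \<epsilon> :: real assume "0 < \<epsilon>"
    from main[OF this] obtain N where N: "\<And>n. n \<ge> N \<Longrightarrow> (LINT x|M. g n x) < \<epsilon>" by blast
    have "\<bar>Lp_pow M p (U n) - Lp_pow M p (\<lambda>x. U n x - U' x) - I\<bar> \<le> (LINT x|M. g n x)" for n
    proof -
      have "Lp_pow M p (U n) - Lp_pow M p (\<lambda>x. U n x - U' x) - I
        = (LINT x|M. \<bar>U n x\<bar> powr p - \<bar>U n x - U' x\<bar> powr p - \<bar>U' x\<bar> powr p)"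
        using Un[of n] D[of n] U' by (simp add: Lp_def Lp_pow_def I_def)
      then show ?thesis unfolding g_def by (simp only: integral_abs_bound)
    qed
    then show "\<exists>N. \<forall>n\<ge>N. norm (Lp_pow M p (U n) - Lp_pow M p (\<lambda>x. U n x - U' x) - I - 0) < \<epsilon>"
      using N by (metis diff_zero le_less_trans real_norm_def)
  qed
  then show "(\<lambda>n. Lp_pow M p (U n) - Lp_pow M p (\<lambda>x. U n x - U' x)) \<longlonglongrightarrow> Lp_pow M p U'"
    by (simp add: LIM_zero_iff I_def)
qed

lemma continuous_on_parametric_integral:
  fixes F :: "'c::metric_space \<Rightarrow> 'b \<Rightarrow> real"
  assumes "\<And>t. t \<in> T \<Longrightarrow> F t \<in> borel_measurable M"
    and cont: "\<And>x. continuous_on T (\<lambda>t. F t x)"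
    and bound: "\<And>t x. t \<in> T \<Longrightarrow> \<bar>F t x\<bar> \<le> B x"
    and B: "integrable M B"
  shows "continuous_on T (\<lambda>t. LINT x|M. F t x)"
  unfolding continuous_on_sequentially
proof (intro allI ballI impI)
  fix \<tau> t assume t: "t \<in> T" and "(\<forall>n. \<tau> n \<in> T) \<and> \<tau> \<longlonglongrightarrow> t"
  then have \<tau>: "\<And>n. \<tau> n \<in> T" "\<tau> \<longlonglongrightarrow> t" by auto
  have "(\<lambda>n. LINT x|M. F (\<tau> n) x) \<longlonglongrightarrow> (LINT x|M. F t x)"
  proof (rule integral_dominated_convergence[OF _ _ B])
    show "AE x in M. (\<lambda>n. F (\<tau> n) x) \<longlonglongrightarrow> F t x"
    proof (rule AE_I2)
      fix x
      show "(\<lambda>n. F (\<tau> n) x) \<longlonglongrightarrow> F t x"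
        using cont[of x] t \<tau> unfolding continuous_on_sequentially o_def by auto
    qed
  qed (use assms t \<tau> in auto)
  then show "((\<lambda>t. LINT x|M. F t x) \<circ> \<tau>) \<longlonglongrightarrow> (LINT x|M. F t x)" by (simp add: o_def)
qed

section \<open>The Gagliardo seminorm and the Sobolev inequality\<close>

text \<open>
  With the increment as a function on pairs and the kernel absorbed into a measure on pairs, the
  Gagliardo seminorm becomes an \<open>L\<^sup>p\<close> norm, and the general facts on such norms apply to it.
\<close>
definition incr :: "('a::ab_group_add \<Rightarrow> real) \<Rightarrow> 'a \<times> 'a \<Rightarrow> real" where
  "incr u z = u (fst z) - u (snd z)"

definition gag_kernel :: "real \<Rightarrow> real \<Rightarrow> 'a::euclidean_space \<times> 'a \<Rightarrow> real" where
  "gag_kernel s p z = 1 / norm (fst z - snd z) powr (real DIM('a) + p * s)"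

definition gag_measure :: "real \<Rightarrow> real \<Rightarrow> ('a::euclidean_space \<times> 'a) measure" where
  "gag_measure s p = density lebesgue (\<lambda>z. ennreal (gag_kernel s p z))"

lemma AE_lebesgue_fst_snd:
  fixes P :: "'a::euclidean_space \<Rightarrow> bool"
  assumes "AE x in lebesgue. P x"
  shows "AE z in (lebesgue :: ('a \<times> 'a) measure). P (fst z) \<and> P (snd z)"
proof -
  have "AE x in lborel. P x" using assms by (simp add: AE_completion_iff)
  then obtain N where N: "N \<in> null_sets lborel" "{x. \<not> P x} \<subseteq> N"
    by (auto elim!: AE_E simp: null_sets_def)
  have "N \<times> UNIV \<in> null_sets (lborel \<Otimes>\<^sub>M lborel :: ('a \<times> 'a) measure)"
       "UNIV \<times> N \<in> null_sets (lborel \<Otimes>\<^sub>M lborel :: ('a \<times> 'a) measure)"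
    using N by (auto simp: null_sets_def lborel.emeasure_pair_measure_Times)
  then have "N \<times> UNIV \<union> UNIV \<times> N \<in> null_sets (lborel :: ('a \<times> 'a) measure)"
    unfolding lborel_prod by (rule null_sets.Un)
  then have "AE z in (lborel :: ('a \<times> 'a) measure). z \<notin> N \<times> UNIV \<union> UNIV \<times> N"
    by (rule AE_not_in)
  then have "AE z in (lborel :: ('a \<times> 'a) measure). P (fst z) \<and> P (snd z)"
    by eventually_elim (use N(2) in auto)
  then show ?thesis by (simp add: AE_completion_iff)
qed

lemma incr_borel_measurable:
  fixes u :: "'a::euclidean_space \<Rightarrow> real"
  assumes [measurable]: "u \<in> borel_measurable borel"
  shows "incr u \<in> borel_measurable borel"
proof -
  have "incr u \<in> borel_measurable (borel \<Otimes>\<^sub>M borel)"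
    unfolding incr_def[abs_def] by measurable
  then show ?thesis by (simp add: borel_prod)
qed

text \<open>
  A Lebesgue measurable function need not be Borel, so the composition with the projections is
  handled through a Borel representative and the completeness of Lebesgue measure on pairs.
\<close>
lemma incr_measurable [measurable]:
  fixes u :: "'a::euclidean_space \<Rightarrow> real"
  assumes "u \<in> borel_measurable lebesgue"
  shows "incr u \<in> borel_measurable lebesgue"
proof -
  obtain g where g: "g \<in> borel_measurable lborel" "AE x in lborel. u x = g x"
    using completion_ex_borel_measurable_real[OF assms] by auto
  have "AE x in lebesgue. u x = g x" using g(2) by (simp add: AE_completion_iff)
  from AE_lebesgue_fst_snd[OF this]
  have ae: "AE z in lebesgue. incr g z = incr u z"
    by eventually_elim (simp add: incr_def)
  have "incr g \<in> borel_measurable lebesgue"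
    using incr_borel_measurable[of g] g(1) by (simp add: measurable_completion)
  from borel_measurable_AE[OF this ae] show ?thesis .
qed

lemma gag_kernel_measurable [measurable]:
  "gag_kernel s p \<in> borel_measurable borel"
proof -
  have [measurable]: "(\<lambda>z::'a \<times> 'a. norm (fst z - snd z)) \<in> borel_measurable borel"
    by (intro borel_measurable_continuous_onI continuous_intros)
  show ?thesis unfolding gag_kernel_def[abs_def] by measurable
qed

lemma gag_kernel_measurable_lebesgue [measurable]:
  "gag_kernel s p \<in> borel_measurable lebesgue"
  by (simp add: measurable_completion)

lemma gag_kernel_nonneg [simp]: "0 \<le> gag_kernel s p z"
  by (simp add: gag_kernel_def)

lemma incr_measurable_gag [measurable]:
  "u \<in> borel_measurable lebesgue \<Longrightarrow> incr u \<in> borel_measurable (gag_measure s p)"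
  unfolding gag_measure_def by simp

lemma AE_gag_measureI:
  assumes "AE z in lebesgue. P z"
  shows "AE z in gag_measure s p. P z"
  unfolding gag_measure_def by (subst AE_density) (use assms in \<open>auto elim: eventually_mono\<close>)

lemma gagliardo_pow_eq:
  fixes u :: "'a::euclidean_space \<Rightarrow> real"
  assumes "u \<in> borel_measurable lebesgue"
  shows "gagliardo_pow s p u = (\<integral>\<^sup>+ z. ennreal (\<bar>incr u z\<bar> powr p) \<partial>gag_measure s p)"
proof -
  have [measurable]: "incr u \<in> borel_measurable lebesgue" using assms by measurable
  have "(\<integral>\<^sup>+ z. ennreal (\<bar>incr u z\<bar> powr p) \<partial>gag_measure s p)
      = (\<integral>\<^sup>+ z. ennreal (gag_kernel s p z) * ennreal (\<bar>incr u z\<bar> powr p) \<partial>lebesgue)"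
    unfolding gag_measure_def by (rule nn_integral_density) measurable
  then show ?thesis
    by (simp add: gagliardo_pow_def gag_kernel_def incr_def ennreal_mult[symmetric])
qed

lemma gagliardo_pow_mono:
  fixes u :: "'a::euclidean_space \<Rightarrow> real"
  assumes "0 \<le> p" "\<And>x y. \<bar>v x - v y\<bar> \<le> \<bar>u x - u y\<bar>"
  shows "gagliardo_pow s p v \<le> gagliardo_pow s p u"
  unfolding gagliardo_pow_def
  by (intro nn_integral_mono ennreal_leI divide_right_mono powr_mono2 assms) auto

lemma gagliardo_pow_cong_AE:
  fixes u :: "'a::euclidean_space \<Rightarrow> real"
  assumes "AE x in lebesgue. u x = v x"
  shows "gagliardo_pow s p u = gagliardo_pow s p v"
  unfolding gagliardo_pow_def
  by (rule nn_integral_cong_AE) (use AE_lebesgue_fst_snd[OF assms] in eventually_elim, simp)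

lemma gagliardo_pow_fubini:
  fixes u :: "'a::euclidean_space \<Rightarrow> real"
  assumes [measurable]: "u \<in> borel_measurable borel"
  shows "gagliardo_pow s p u = (\<integral>\<^sup>+ x. (\<integral>\<^sup>+ y.
     ennreal (\<bar>u x - u y\<bar> powr p / norm (x - y) powr (real DIM('a) + p * s)) \<partial>lborel) \<partial>lborel)"
proof -
  have [measurable]: "incr u \<in> borel_measurable borel" by (rule incr_borel_measurable) fact
  define F where "F = (\<lambda>z. ennreal (\<bar>incr u z\<bar> powr p * gag_kernel s p z))"
  have [measurable]: "F \<in> borel_measurable borel" unfolding F_def by measurable
  have "gagliardo_pow s p u = (\<integral>\<^sup>+ z. F z \<partial>(lborel \<Otimes>\<^sub>M lborel))"
    unfolding gagliardo_pow_def F_def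
    by (simp add: nn_integral_completion incr_def gag_kernel_def lborel_prod)
  also have "\<dots> = (\<integral>\<^sup>+ x. (\<integral>\<^sup>+ y. F (x, y) \<partial>lborel) \<partial>lborel)"
  proof (rule lborel.nn_integral_fst[symmetric])
    show "F \<in> borel_measurable (lborel \<Otimes>\<^sub>M lborel)" unfolding lborel_prod by measurable
  qed
  finally show ?thesis by (simp add: F_def incr_def gag_kernel_def)
qed

text \<open>
  The exponent \<open>q = p\<^sup>*\<close> is the fixed point of \<open>q = p + (p s / N) q\<close>; this is the form used below.
\<close>
lemma crit_exp_relations:
  fixes s p :: real
  assumes "0 < s" "1 < p" "p * s < real N"
  shows "crit_exp N s p * (1 - p * s / real N) = p" "p < crit_exp N s p" "0 < p * s / real N" "p * s / real N < 1"
proof -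
  have N: "0 < real N" using assms mult_pos_pos[of p s] by linarith
  show "0 < p * s / real N" "p * s / real N < 1" using assms N by auto
  have *: "1 - p * s / real N = (real N - p * s) / real N" using N by (simp add: field_simps)
  show "crit_exp N s p * (1 - p * s / real N) = p"
    unfolding crit_exp_def * using assms N by simp
  show "p < crit_exp N s p" unfolding crit_exp_def using assms N by (simp add: field_simps)
qed

lemma clip_lipschitz:
  fixes a b c d :: real
  shows "\<bar>max c (min a d) - max c (min b d)\<bar> \<le> \<bar>a - b\<bar>"
  by linarith

text \<open>
  The constant that the argument below produces; only its positivity and its independence of \<open>u\<close> matter.
\<close>
definition sobolev_const :: "nat \<Rightarrow> real \<Rightarrow> real \<Rightarrow> real" where
  "sobolev_const N s p = (unit_ball_vol (real N) / 2) powr (1 + p * s / real N) * 2 powr (- crit_exp N s p)"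

text \<open>
  The set where \<open>\<bar>u\<bar> > t/2\<close>, with \<open>t = \<bar>u x\<bar>\<close>, has measure at most \<open>m = (2/t)\<^sup>q \<integral>\<bar>u\<bar>\<^sup>q\<close>. On the ball
  around \<open>x\<close> of measure \<open>2m\<close> it therefore misses at least half of the points, and each missed point
  contributes a difference of at least \<open>t/2\<close>. For \<open>q = p\<^sup>*\<close> the resulting bound is a multiple of
  \<open>t\<^sup>q\<close>.
\<close>
lemma gagliardo_inner_lower_bound:
  fixes u :: "'a::euclidean_space \<Rightarrow> real"
  assumes [measurable]: "u \<in> borel_measurable borel"
    and s: "0 < s" and p: "1 < p" and ps: "p * s < real DIM('a)"
    and q: "q = crit_exp DIM('a) s p" and \<theta>: "\<theta> = p * s / real DIM('a)"
    and T: "(\<integral>\<^sup>+x. ennreal (\<bar>u x\<bar> powr q) \<partial>lborel) = ennreal T" "0 < T"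
  shows "ennreal (sobolev_const DIM('a) s p * T powr (- \<theta>) * \<bar>u x\<bar> powr q)
    \<le> (\<integral>\<^sup>+ y. ennreal (\<bar>u x - u y\<bar> powr p / norm (x - y) powr (real DIM('a) + p * s)) \<partial>lborel)"
proof (cases "u x = 0")
  case False
  define N where "N = real DIM('a)"
  have N: "0 < N" by (simp add: N_def)
  define \<omega> where "\<omega> = unit_ball_vol N"
  have \<omega>: "0 < \<omega>" by (simp add: \<omega>_def N_def)
  note rel = crit_exp_relations[OF s p ps, folded q \<theta>]
  define t where "t = \<bar>u x\<bar>"
  have t: "0 < t" using False by (simp add: t_def)
  define c where "c = (t / 2) powr q"
  have c: "0 < c" using t by (simp add: c_def)
  define m where "m = T / c"
  have m: "0 < m" using c T by (simp add: m_def)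
  define E where "E = {y. t / 2 < \<bar>u y\<bar>}"
  have [measurable]: "E \<in> sets borel" unfolding E_def by measurable
  have "ennreal c * emeasure lborel E = (\<integral>\<^sup>+y. ennreal c * indicator E y \<partial>lborel)"
    by (simp add: nn_integral_cmult_indicator)
  also have "\<dots> \<le> (\<integral>\<^sup>+x. ennreal (\<bar>u x\<bar> powr q) \<partial>lborel)"
    using t rel(2) p
    by (intro nn_integral_mono) (auto simp: E_def c_def indicator_def intro!: ennreal_leI powr_mono2)
  finally have "ennreal c * emeasure lborel E \<le> ennreal T" using T by simp
  then have "ennreal (1 / c) * (ennreal c * emeasure lborel E) \<le> ennreal (1 / c) * ennreal T"
    by (intro mult_left_mono) auto
  then have Em: "emeasure lborel E \<le> ennreal m"
    using c T by (simp add: mult.assoc[symmetric] ennreal_mult[symmetric] m_def)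
  \<comment> \<open>The radius of the ball of measure \<open>2 m\<close>.\<close>
  define \<rho> where "\<rho> = (2 * m / \<omega>) powr (1 / N)"
  have \<rho>: "0 < \<rho>" using m \<omega> by (simp add: \<rho>_def)
  have "\<rho> ^ DIM('a) = \<rho> powr N" using \<rho> by (simp add: N_def powr_realpow)
  also have "\<dots> = 2 * m / \<omega>" using N m \<omega> by (simp add: \<rho>_def powr_powr)
  finally have B: "emeasure lborel (ball x \<rho>) = ennreal (2 * m)"
    using \<rho> \<omega> by (simp add: emeasure_ball \<omega>_def[unfolded N_def, symmetric])
  have "ennreal (2 * m) \<le> emeasure lborel (ball x \<rho> - E \<union> E)"
    unfolding B[symmetric] by (intro emeasure_mono) auto
  also have "\<dots> \<le> emeasure lborel (ball x \<rho> - E) + emeasure lborel E"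
    by (intro emeasure_subadditive) auto
  also have "\<dots> \<le> emeasure lborel (ball x \<rho> - E) + ennreal m"
    using Em by (intro add_left_mono)
  finally have half: "ennreal m \<le> emeasure lborel (ball x \<rho> - E)"
    using m by (cases "emeasure lborel (ball x \<rho> - E)")
      (auto simp: ennreal_plus[symmetric] simp del: ennreal_plus)
  define k where "k = (t / 2) powr p / \<rho> powr (N + p * s)"
  have k: "0 \<le> k" by (simp add: k_def)
  have "p * s = N * \<theta>" using N by (simp add: \<theta> N_def)
  then have "\<rho> powr (N + p * s) = (\<rho> powr N) powr (1 + \<theta>)" by (simp add: powr_powr algebra_simps)
  also have "\<rho> powr N = 2 * m / \<omega>" by fact
  finally have \<rho>e: "\<rho> powr (N + p * s) = (2 * m / \<omega>) powr (1 + \<theta>)" .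
  have "k * m = (t / 2) powr p * ((\<omega> / 2) powr (1 + \<theta>) * m powr (- \<theta>))"
  proof -
    have "(2 * m / \<omega>) powr (1 + \<theta>) * (\<omega> / 2) powr (1 + \<theta>) = m powr (1 + \<theta>)"
      using m \<omega> by (simp add: powr_mult[symmetric])
    moreover have "m powr (1 + \<theta>) * m powr (- \<theta>) = m" using m by (simp add: powr_add[symmetric])
    moreover have "0 < (2 * m / \<omega>) powr (1 + \<theta>)" using m \<omega> by simp
    ultimately have "m / (2 * m / \<omega>) powr (1 + \<theta>) = (\<omega> / 2) powr (1 + \<theta>) * m powr (- \<theta>)"
      by (metis (no_types, lifting) mult.assoc nonzero_mult_div_cancel_left less_irrefl)
    then show ?thesis by (simp only: k_def \<rho>e times_divide_eq_left times_divide_eq_right[symmetric])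
  qed
  also have "m powr (- \<theta>) = T powr (- \<theta>) * (t / 2) powr (q * \<theta>)"
  proof -
    have "c powr \<theta> = (t / 2) powr (q * \<theta>)" unfolding c_def powr_powr ..
    then show ?thesis using T c by (simp add: m_def powr_divide powr_minus_divide)
  qed
  also have "(t / 2) powr p * ((\<omega> / 2) powr (1 + \<theta>) * (T powr (- \<theta>) * (t / 2) powr (q * \<theta>)))
      = (\<omega> / 2) powr (1 + \<theta>) * T powr (- \<theta>) * (t / 2) powr (p + q * \<theta>)"
    by (simp add: powr_add mult_ac)
  \<comment> \<open>Here the critical exponent is needed.\<close>
  also have "p + q * \<theta> = q" using rel(1) by (simp add: algebra_simps)
  also have "(t / 2) powr q = 2 powr (- q) * t powr q"
    using t by (simp add: powr_divide powr_minus_divide)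
  finally have km: "k * m = sobolev_const DIM('a) s p * T powr (- \<theta>) * \<bar>u x\<bar> powr q"
    by (simp add: sobolev_const_def \<omega>_def N_def q \<theta> t_def mult_ac)
  have "ennreal (k * m) \<le> ennreal k * emeasure lborel (ball x \<rho> - E)"
    using half k m by (simp add: ennreal_mult mult_left_mono)
  also have "\<dots> = (\<integral>\<^sup>+y. ennreal k * indicator (ball x \<rho> - E) y \<partial>lborel)"
    by (simp add: nn_integral_cmult_indicator)
  also have "\<dots> \<le> (\<integral>\<^sup>+ y. ennreal (\<bar>u x - u y\<bar> powr p / norm (x - y) powr (N + p * s)) \<partial>lborel)"
  proof (rule nn_integral_mono)
    fix y
    show "ennreal k * indicator (ball x \<rho> - E) y
        \<le> ennreal (\<bar>u x - u y\<bar> powr p / norm (x - y) powr (N + p * s))"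
    proof (cases "y \<in> ball x \<rho> - E")
      case True
      then have y: "norm (x - y) < \<rho>" "\<bar>u y\<bar> \<le> t / 2" by (auto simp: E_def dist_norm)
      then have d: "t / 2 \<le> \<bar>u x - u y\<bar>" unfolding t_def by linarith
      have "x \<noteq> y" using d t by auto
      then have "k \<le> \<bar>u x - u y\<bar> powr p / norm (x - y) powr (N + p * s)"
        unfolding k_def using y d t N p s \<rho>
        by (intro frac_le powr_mono2) auto
      then show ?thesis using True by (simp add: ennreal_leI)
    qed simp
  qed
  finally show ?thesis unfolding km by (simp add: N_def)
qed simp

lemma bounded_imp_subset_cball: "bounded S \<Longrightarrow> \<exists>R. S \<subseteq> cball (0::'a::euclidean_space) R"
  using bounded_subset_ballD[of S 0] ball_subset_cball by (meson order.trans)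

lemma emeasure_cball_finite: "emeasure lebesgue (cball (c::'a::euclidean_space) R) < top"
  using lmeasurable_cball[of c R] by (simp only: fmeasurable_def mem_Collect_eq infinity_ennreal_def)

lemma sobolev_const_pos: "0 < sobolev_const DIM('a::euclidean_space) s p"
proof -
  have "0 < unit_ball_vol (real DIM('a))" by (rule unit_ball_vol_pos) simp
  then have "unit_ball_vol (real DIM('a)) / 2 \<noteq> 0" by linarith
  then show ?thesis unfolding sobolev_const_def by (simp only: zero_less_mult_iff powr_gt_zero) simp
qed

text \<open>
  Integrating the pointwise bound gives \<open>c T\<^sup>1\<^sup>-\<^sup>\<theta> \<le> [u]\<^sup>p\<close> for \<open>T = \<integral>\<bar>u\<bar>\<^sup>q\<close> and \<open>\<theta> = p s / N\<close>, and \<open>1 - \<theta> = p / q\<close>.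
\<close>
lemma sobolev_finite:
  fixes u :: "'a::euclidean_space \<Rightarrow> real"
  assumes u: "u \<in> borel_measurable lebesgue"
    and s: "0 < s" and p: "1 < p" and ps: "p * s < real DIM('a)"
    and q: "q = crit_exp DIM('a) s p"
    and fin: "(\<integral>\<^sup>+x. ennreal (\<bar>u x\<bar> powr q) \<partial>lebesgue) < \<infinity>"
  shows "ennreal (sobolev_const DIM('a) s p * Lp_pow lebesgue q u powr (p / q)) \<le> gagliardo_pow s p u"
proof -
  obtain g where g: "g \<in> borel_measurable lborel" "AE x in lborel. u x = g x"
    using completion_ex_borel_measurable_real[OF u] by auto
  have [measurable]: "g \<in> borel_measurable borel" using g by simp
  define \<theta> where "\<theta> = p * s / real DIM('a)"
  define T where "T = Lp_pow lebesgue q u"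
  define S where "S = sobolev_const DIM('a) s p"
  have S: "0 < S" unfolding S_def by (simp add: sobolev_const_pos)
  note rel = crit_exp_relations[OF s p ps, folded q \<theta>_def]
  have uL: "u \<in> Lp lebesgue q" using fin u by (simp add: Lp_iff_nn_integral)
  have gT: "(\<integral>\<^sup>+x. ennreal (\<bar>g x\<bar> powr q) \<partial>lborel) = ennreal T"
    unfolding T_def ennreal_Lp_pow[OF uL] nn_integral_completion
    by (rule nn_integral_cong_AE) (use g(2) in eventually_elim, simp)
  show ?thesis
  proof (cases "T = 0")
    case False
    then have T: "0 < T" using Lp_pow_nonneg[of lebesgue q u] unfolding T_def by linarith
    have "ennreal (S * T powr (p / q)) = ennreal (S * T powr (- \<theta>)) * ennreal T"
    proof -
      have "T powr (p / q) = T powr (1 - \<theta>)"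
        using rel p by (intro arg_cong[where f = "\<lambda>e. T powr e"]) (simp add: field_simps)
      then show ?thesis using T S by (simp add: ennreal_mult[symmetric] powr_diff powr_minus_divide)
    qed
    also have "\<dots> = (\<integral>\<^sup>+x. ennreal (S * T powr (- \<theta>)) * ennreal (\<bar>g x\<bar> powr q) \<partial>lborel)"
      by (subst nn_integral_cmult) (auto simp: gT)
    also have "\<dots> = (\<integral>\<^sup>+x. ennreal (S * T powr (- \<theta>) * \<bar>g x\<bar> powr q) \<partial>lborel)"
      using S by (simp add: ennreal_mult)
    also have "\<dots> \<le> gagliardo_pow s p g"
      unfolding gagliardo_pow_fubini[OF \<open>g \<in> borel_measurable borel\<close>] S_def
      by (intro nn_integral_mono gagliardo_inner_lower_bound[OF _ s p ps q \<theta>_def gT T]) simp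
    also have "\<dots> = gagliardo_pow s p u"
      by (rule gagliardo_pow_cong_AE) (use g(2) in \<open>simp add: AE_completion_iff eq_commute\<close>)
    finally show ?thesis by (simp add: S_def T_def)
  qed (simp add: T_def)
qed

text \<open>
  The argument above needs \<open>\<integral>\<bar>u\<bar>\<^sup>q < \<infinity>\<close> beforehand; truncations of \<open>u\<close> have this property, and
  truncation does not increase differences.
\<close>
lemma sobolev:
  fixes u :: "'a::euclidean_space \<Rightarrow> real"
  assumes u: "u \<in> borel_measurable lebesgue"
    and s: "0 < s" and p: "1 < p" and ps: "p * s < real DIM('a)"
    and q: "q = crit_exp DIM('a) s p"
    and \<Omega>: "bounded \<Omega>" "AE x in lebesgue. x \<notin> \<Omega> \<longrightarrow> u x = 0"
    and fin: "gagliardo_pow s p u < \<infinity>"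
  shows "u \<in> Lp lebesgue q"
    and "sobolev_const DIM('a) s p * Lp_pow lebesgue q u powr (p / q) \<le> enn2real (gagliardo_pow s p u)"
proof -
  define S where "S = sobolev_const DIM('a) s p"
  have S: "0 < S" unfolding S_def by (simp add: sobolev_const_pos)
  have q0: "0 < q" using crit_exp_relations[OF s p ps, folded q] p by linarith
  define G where "G = enn2real (gagliardo_pow s p u)"
  have G: "gagliardo_pow s p u = ennreal G" "0 \<le> G"
  proof -
    have "gagliardo_pow s p u < top" using fin by (simp only: infinity_ennreal_def)
    then show "gagliardo_pow s p u = ennreal G" unfolding G_def by (simp only: ennreal_enn2real)
    show "0 \<le> G" unfolding G_def by (rule enn2real_nonneg)
  qed
  obtain R where R: "\<Omega> \<subseteq> cball 0 R" using bounded_imp_subset_cball \<Omega> by metis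
  define v where "v = (\<lambda>k x. max (- real k) (min (u x) (real k)))"
  have vm: "v k \<in> borel_measurable lebesgue" for k unfolding v_def by (intro borel_measurable_max borel_measurable_min u borel_measurable_const)
  have vfin: "(\<integral>\<^sup>+x. ennreal (\<bar>v k x\<bar> powr q) \<partial>lebesgue) < \<infinity>" for k
  proof -
    have "(\<integral>\<^sup>+x. ennreal (\<bar>v k x\<bar> powr q) \<partial>lebesgue)
        \<le> (\<integral>\<^sup>+x. ennreal (real k powr q) * indicator (cball (0::'a) R) x \<partial>lebesgue)"
    proof (rule nn_integral_mono_AE)
      show "AE x in lebesgue. ennreal (\<bar>v k x\<bar> powr q) \<le> ennreal (real k powr q) * indicator (cball 0 R) x"
        using \<Omega>(2)
      proof eventually_elim
        case (elim x)
        show ?case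
        proof (cases "x \<in> cball 0 R")
          case True
          have "\<bar>v k x\<bar> \<le> real k" unfolding v_def by linarith
          then have "\<bar>v k x\<bar> powr q \<le> real k powr q" using q0 by (intro powr_mono2) auto
          then show ?thesis using True by (simp add: ennreal_leI)
        next
          case False
          then have "u x = 0" using elim R by (meson in_mono)
          then show ?thesis by (simp add: v_def)
        qed
      qed
    qed
    also have "\<dots> = ennreal (real k powr q) * emeasure lebesgue (cball (0::'a) R)"
      by (rule nn_integral_cmult_indicator) simp
    also have "\<dots> < \<infinity>"
      unfolding infinity_ennreal_def
      by (rule ennreal_mult_less_top[THEN iffD2]) (use emeasure_cball_finite[of "0::'a" R] in auto)
    finally show ?thesis .
  qed
  define B where "B = (G / S) powr (q / p)"
  have vB: "(\<integral>\<^sup>+x. ennreal (\<bar>v k x\<bar> powr q) \<partial>lebesgue) \<le> ennreal B" for k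
  proof -
    have "ennreal (S * Lp_pow lebesgue q (v k) powr (p / q)) \<le> gagliardo_pow s p (v k)"
      unfolding S_def by (rule sobolev_finite[OF vm s p ps q vfin])
    also have "\<dots> \<le> gagliardo_pow s p u"
      unfolding v_def using p by (intro gagliardo_pow_mono clip_lipschitz) simp
    finally have "S * Lp_pow lebesgue q (v k) powr (p / q) \<le> G"
      using G by (simp add: ennreal_le_iff)
    then have "Lp_pow lebesgue q (v k) powr (p / q) \<le> G / S" using S by (simp add: field_simps)
    then have "(Lp_pow lebesgue q (v k) powr (p / q)) powr (q / p) \<le> B"
      unfolding B_def using q0 p by (intro powr_mono2) auto
    then have "Lp_pow lebesgue q (v k) \<le> B" using q0 p by (simp add: powr_powr)
    moreover have "v k \<in> Lp lebesgue q" using vm vfin by (simp add: Lp_iff_nn_integral)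
    ultimately show ?thesis by (simp add: ennreal_Lp_pow[symmetric] ennreal_leI)
  qed
  have "(\<integral>\<^sup>+x. ennreal (\<bar>u x\<bar> powr q) \<partial>lebesgue) \<le> ennreal B"
  proof (rule nn_integral_le_of_AE_limit[where f = "\<lambda>k x. \<bar>v k x\<bar> powr q"])
    show "AE x in lebesgue. (\<lambda>k. \<bar>v k x\<bar> powr q) \<longlonglongrightarrow> \<bar>u x\<bar> powr q"
    proof (rule AE_I2)
      fix x
      obtain k0 :: nat where "\<bar>u x\<bar> \<le> real k0" using real_arch_simple by blast
      have "v k x = u x" if "k0 \<le> k" for k
      proof -
        have "\<bar>u x\<bar> \<le> real k" using \<open>\<bar>u x\<bar> \<le> real k0\<close> that by linarith
        then show ?thesis unfolding v_def by linarith
      qed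
      then have "\<forall>k\<ge>k0. \<bar>v k x\<bar> powr q = \<bar>u x\<bar> powr q" by simp
      then show "(\<lambda>k. \<bar>v k x\<bar> powr q) \<longlonglongrightarrow> \<bar>u x\<bar> powr q"
        by (intro tendsto_eventually) (auto simp: eventually_sequentially)
    qed
    show "(\<lambda>x. \<bar>v k x\<bar> powr q) \<in> borel_measurable lebesgue" for k using vm[of k] by measurable
  qed (rule vB)
  from le_less_trans[OF this ennreal_less_top]
  have fu: "(\<integral>\<^sup>+x. ennreal (\<bar>u x\<bar> powr q) \<partial>lebesgue) < \<infinity>" by simp
  then show "u \<in> Lp lebesgue q" using u by (simp add: Lp_iff_nn_integral)
  show "sobolev_const DIM('a) s p * Lp_pow lebesgue q u powr (p / q) \<le> enn2real (gagliardo_pow s p u)"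
    using sobolev_finite[OF u s p ps q fu] G by (simp add: ennreal_le_iff)
qed

lemma Lp_finite_measure_mono:
  fixes u :: "'a::euclidean_space \<Rightarrow> real"
  assumes u: "u \<in> Lp lebesgue q" and r: "0 < r" "r \<le> q"
    and \<Omega>: "AE x in lebesgue. x \<notin> cball 0 R \<longrightarrow> u x = 0"
  shows "u \<in> Lp lebesgue r"
    and "Lp_pow lebesgue r u \<le> measure lebesgue (cball (0::'a) R) + Lp_pow lebesgue q u"
proof -
  have um: "u \<in> borel_measurable lebesgue" using u by (simp add: Lp_def)
  have i: "integrable lebesgue (\<lambda>x. indicator (cball 0 R) x + \<bar>u x\<bar> powr q)"
    using u emeasure_cball_finite[of "0::'a" R]
    by (intro Bochner_Integration.integrable_add) (auto simp: Lp_def)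
  have ae: "AE x in lebesgue. \<bar>u x\<bar> powr r \<le> indicator (cball 0 R) x + \<bar>u x\<bar> powr q"
    using \<Omega>
  proof eventually_elim
    case (elim x)
    show ?case
    proof (cases "x \<in> cball 0 R")
      case True
      have "\<bar>u x\<bar> powr r \<le> 1 + \<bar>u x\<bar> powr q"
      proof (cases "\<bar>u x\<bar> \<le> 1")
        case True
        then have "\<bar>u x\<bar> powr r \<le> 1"
          using r powr_mono2[of r "\<bar>u x\<bar>" 1] by simp
        moreover have "0 \<le> \<bar>u x\<bar> powr q" by simp
        ultimately show ?thesis by linarith
      next
        case False
        then have "\<bar>u x\<bar> powr r \<le> \<bar>u x\<bar> powr q" using r by (intro powr_mono) auto
        then show ?thesis by simp
      qed
      then show ?thesis using True by simp
    next
      case False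
      then show ?thesis using elim by simp
    qed
  qed
  show L: "u \<in> Lp lebesgue r"
    unfolding Lp_def using um ae
    by (auto intro!: Bochner_Integration.integrable_bound[OF i] elim!: eventually_mono)
  have "Lp_pow lebesgue r u \<le> (LINT x|lebesgue. indicator (cball 0 R) x + \<bar>u x\<bar> powr q)"
    unfolding Lp_pow_def using L ae by (intro integral_mono_AE i) (auto simp: Lp_def)
  also have "\<dots> = measure lebesgue (cball (0::'a) R) + Lp_pow lebesgue q u"
    using u emeasure_cball_finite[of "0::'a" R]
    by (subst Bochner_Integration.integral_add) (auto simp: Lp_def Lp_pow_def)
  finally show "Lp_pow lebesgue r u \<le> measure lebesgue (cball (0::'a) R) + Lp_pow lebesgue q u" .
qed

lemma W0_measurable:
  fixes u :: "'a::euclidean_space \<Rightarrow> real"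
  assumes "u \<in> W0 s p \<Omega>"
  shows "u \<in> borel_measurable lebesgue"
proof (rule borel_measurable_LIMSEQ_real)
  define f where "f = (\<lambda>n x. indicator (cball 0 (real n)) x *\<^sub>R u x)"
  show "f n \<in> borel_measurable lebesgue" for n
  proof -
    have "u absolutely_integrable_on cball 0 (real n)" using assms by (simp add: W0_def)
    then show ?thesis
      unfolding f_def set_integrable_def by (rule borel_measurable_integrable)
  qed
  show "(\<lambda>n. f n x) \<longlonglongrightarrow> u x" for x
  proof (rule tendsto_eventually)
    obtain k0 :: nat where "norm x \<le> real k0" using real_arch_simple by blast
    then have "\<forall>k\<ge>k0. f k x = u x" by (auto simp: f_def indicator_def)
    then show "eventually (\<lambda>n. f n x = u x) sequentially" by (auto simp: eventually_sequentially)
  qed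
qed

text \<open>
  The Sobolev inequality makes functions of finite seminorm integrable, so local integrability may be
  weakened to measurability. Membership of limits and of truncated functions is then easy to check.
\<close>
lemma W0_iff:
  fixes u :: "'a::euclidean_space \<Rightarrow> real"
  assumes s: "0 < s" and p: "1 < p" and ps: "p * s < real DIM('a)" and \<Omega>: "bounded \<Omega>"
  shows "u \<in> W0 s p \<Omega> \<longleftrightarrow> u \<in> borel_measurable lebesgue \<and>
    (AE x in lebesgue. x \<notin> \<Omega> \<longrightarrow> u x = 0) \<and> gagliardo_pow s p u < \<infinity>"
proof
  assume u: "u \<in> W0 s p \<Omega>"
  from W0_measurable[OF u] u show "u \<in> borel_measurable lebesgue \<and>
    (AE x in lebesgue. x \<notin> \<Omega> \<longrightarrow> u x = 0) \<and> gagliardo_pow s p u < \<infinity>"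
    unfolding W0_def by blast
next
  assume u: "u \<in> borel_measurable lebesgue \<and>
    (AE x in lebesgue. x \<notin> \<Omega> \<longrightarrow> u x = 0) \<and> gagliardo_pow s p u < \<infinity>"
  then have um: "u \<in> borel_measurable lebesgue" and u0: "AE x in lebesgue. x \<notin> \<Omega> \<longrightarrow> u x = 0"
    and ug: "gagliardo_pow s p u < \<infinity>" by blast+
  obtain R where R: "\<Omega> \<subseteq> cball 0 R" using bounded_imp_subset_cball \<Omega> by metis
  have 1: "u \<in> Lp lebesgue (crit_exp DIM('a) s p)"
    by (rule sobolev(1)[OF um s p ps refl \<Omega> u0 ug])
  have 2: "1 \<le> crit_exp DIM('a) s p" using crit_exp_relations(2)[OF s p ps] p by linarith
  have 3: "AE x in lebesgue. x \<notin> cball 0 R \<longrightarrow> u x = 0"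
    using u0 by eventually_elim (use R in blast)
  have "u \<in> Lp lebesgue 1" by (rule Lp_finite_measure_mono(1)[OF 1 _ 2 3]) simp
  then have "integrable lebesgue (\<lambda>x. \<bar>u x\<bar>)" by (simp add: Lp_def)
  then have int: "integrable lebesgue u" by (simp only: integrable_abs_iff[OF um])
  have "u absolutely_integrable_on K" if "compact K" for K
  proof -
    have "K \<in> sets lebesgue" using lmeasurable_compact[OF that] by (rule fmeasurableD)
    then show ?thesis unfolding set_integrable_def by (rule integrable_mult_indicator[OF _ int])
  qed
  then show "u \<in> W0 s p \<Omega>" using u0 ug unfolding W0_def by blast
qed

section \<open>Lipschitz functions\<close>

lemma ex_dyadic_ring:
  fixes t :: real
  assumes "0 < t"
  obtains j :: int where "2 powr real_of_int j \<le> t" "t < 2 * 2 powr real_of_int j"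
proof
  define j where "j = \<lfloor>log 2 t\<rfloor>"
  have t: "t = 2 powr (log 2 t)" using assms by simp
  have "2 powr real_of_int j \<le> 2 powr (log 2 t)"
    unfolding j_def by (intro powr_mono) linarith+
  then show "2 powr real_of_int j \<le> t" using t by simp
  have "2 powr (log 2 t) < 2 powr (real_of_int j + 1)"
    unfolding j_def by (intro powr_less_mono) linarith+
  then show "t < 2 * 2 powr real_of_int j" using t by (simp add: powr_add)
qed

text \<open>
  On a dyadic ring of radius \<open>\<rho>\<close> the integrand is at most \<open>min (2 L \<rho>) M powr p \<rho>\<^sup>-\<^sup>N\<^sup>-\<^sup>p\<^sup>s\<close> and the
  volume is of order \<open>\<rho>\<^sup>N\<close>. The bounds \<open>\<rho>\<^sup>p\<^sup>(\<^sup>1\<^sup>-\<^sup>s\<^sup>)\<close> for small and \<open>\<rho>\<^sup>-\<^sup>p\<^sup>s\<close> for large rings form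
  convergent geometric series.
\<close>
lemma lipschitz_kernel_integral_finite:
  fixes L M :: real
  assumes s: "0 < s" "s < 1" and p: "1 < p" and L: "0 \<le> L" and M: "0 \<le> M"
  obtains \<kappa> where "0 \<le> \<kappa>"
    "\<And>x::'a::euclidean_space. (\<integral>\<^sup>+ y. ennreal (min (L * norm (x - y)) M powr p
        / norm (x - y) powr (real DIM('a) + p * s)) \<partial>lborel) \<le> ennreal \<kappa>"
proof -
  define N where "N = real DIM('a)"
  define \<omega> where "\<omega> = unit_ball_vol N"
  have \<omega>: "0 \<le> \<omega>" by (simp add: \<omega>_def N_def)
  define \<rho> where "\<rho> = (\<lambda>j::int. 2 powr real_of_int j)"
  have \<rho>: "0 < \<rho> j" for j by (simp add: \<rho>_def)
  define b where "b = (\<lambda>j. \<omega> * 2 powr N * (min (L * (2 * \<rho> j)) M powr p * \<rho> j powr (- (p * s))))"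
  have b0: "0 \<le> b j" for j using \<omega> by (simp add: b_def)
  define F where "F = (\<lambda>x y::'a. min (L * norm (x - y)) M powr p / norm (x - y) powr (N + p * s))"
  have Fm [measurable]: "F x \<in> borel_measurable borel" for x unfolding F_def by measurable
  define ring where "ring = (\<lambda>x j. {y::'a. \<rho> j \<le> norm (x - y) \<and> norm (x - y) < 2 * \<rho> j})"
  have ringm [measurable]: "ring x j \<in> sets borel" for x j unfolding ring_def by measurable
  have ps: "0 < p * s" using s p by simp
  have ring_le: "(\<integral>\<^sup>+y. ennreal (F x y) * indicator (ring x j) y \<partial>lborel) \<le> ennreal (b j)" for x j
  proof -
    define k where "k = min (L * (2 * \<rho> j)) M powr p / \<rho> j powr (N + p * s)"
    have "(\<integral>\<^sup>+y. ennreal (F x y) * indicator (ring x j) y \<partial>lborel)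
        \<le> (\<integral>\<^sup>+y. ennreal k * indicator (ball x (2 * \<rho> j)) y \<partial>lborel)"
    proof (rule nn_integral_mono)
      fix y
      show "ennreal (F x y) * indicator (ring x j) y \<le> ennreal k * indicator (ball x (2 * \<rho> j)) y"
      proof (cases "y \<in> ring x j")
        case True
        then have y: "\<rho> j \<le> norm (x - y)" "norm (x - y) < 2 * \<rho> j" by (auto simp: ring_def)
        have "F x y \<le> k" unfolding F_def k_def
        proof (intro frac_le powr_mono2)
          show "min (L * norm (x - y)) M \<le> min (L * (2 * \<rho> j)) M"
            using y L by (intro min.mono mult_left_mono) auto
        qed (use y \<rho>[of j] L M p ps in \<open>auto simp: N_def\<close>)
        then show ?thesis using True y by (simp add: dist_norm ennreal_leI)
      qed simp
    qed
    also have "\<dots> = ennreal k * emeasure lborel (ball x (2 * \<rho> j))"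
      by (rule nn_integral_cmult_indicator) simp
    also have "\<dots> = ennreal k * ennreal (\<omega> * (2 * \<rho> j) ^ DIM('a))"
      using \<rho>[of j] by (simp add: emeasure_ball \<omega>_def N_def)
    also have "(2 * \<rho> j) ^ DIM('a) = (2 * \<rho> j) powr N"
      using \<rho>[of j] by (simp add: N_def powr_realpow)
    also have "ennreal k * ennreal (\<omega> * (2 * \<rho> j) powr N) = ennreal (k * (\<omega> * (2 * \<rho> j) powr N))"
      using \<omega> by (intro ennreal_mult[symmetric]) (auto simp: k_def)
    also have "k * (\<omega> * (2 * \<rho> j) powr N) = b j"
      using \<rho>[of j] unfolding k_def b_def
      by (simp add: powr_mult powr_add powr_minus_divide)
    finally show ?thesis .
  qed
  have sum1: "summable (\<lambda>k. b (int k))"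
  proof (rule summable_comparison_test)
    have "norm (b (int k)) \<le> \<omega> * 2 powr N * M powr p * (2 powr (- (p * s))) ^ k" for k
    proof -
      have "min (L * (2 * \<rho> (int k))) M powr p \<le> M powr p"
        using L M \<rho>[of "int k"] p by (intro powr_mono2) auto
      then have "b (int k) \<le> \<omega> * 2 powr N * (M powr p * \<rho> (int k) powr (- (p * s)))"
        unfolding b_def using \<omega> by (intro mult_left_mono mult_right_mono) auto
      also have "\<rho> (int k) powr (- (p * s)) = (2 powr (- (p * s))) ^ k"
        by (simp add: \<rho>_def powr_powr powr_realpow[symmetric] mult.commute)
      finally show ?thesis using b0[of "int k"] by (simp add: mult.assoc)
    qed
    then show "\<exists>K. \<forall>k\<ge>K. norm (b (int k)) \<le> \<omega> * 2 powr N * M powr p * (2 powr (- (p * s))) ^ k"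
      by blast
    have "2 powr (- (p * s)) < 2 powr 0" using ps by (intro powr_less_mono) auto
    then show "summable (\<lambda>k. \<omega> * 2 powr N * M powr p * (2 powr (- (p * s))) ^ k)"
      by (intro summable_mult summable_geometric) simp
  qed
  have sum2: "summable (\<lambda>k. b (- 1 - int k))"
  proof (rule summable_comparison_test)
    define e where "e = p - p * s"
    have e: "0 < e" unfolding e_def using s p by (simp add: algebra_simps)
    define c where "c = \<omega> * 2 powr N * ((2 * L) powr p * 2 powr (- e))"
    have "norm (b (- 1 - int k)) \<le> c * (2 powr (- e)) ^ k" for k
    proof -
      define r where "r = \<rho> (- 1 - int k)"
      have r: "0 < r" using \<rho> by (simp add: r_def)
      have "min (L * (2 * r)) M powr p \<le> (2 * L * r) powr p"
        using L M r p by (intro powr_mono2) auto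
      then have "b (- 1 - int k) \<le> \<omega> * 2 powr N * ((2 * L * r) powr p * r powr (- (p * s)))"
        unfolding b_def r_def[symmetric] using \<omega> by (intro mult_left_mono mult_right_mono) auto
      also have "(2 * L * r) powr p * r powr (- (p * s)) = (2 * L) powr p * r powr e"
        using r L by (simp add: powr_mult powr_add[symmetric] e_def)
      also have "r powr e = 2 powr (- e) * (2 powr (- e)) ^ k"
      proof -
        have "r powr e = 2 powr ((- 1 - real k) * e)" by (simp add: r_def \<rho>_def powr_powr)
        also have "(- 1 - real k) * e = - e + (- e) * real k" by (simp add: algebra_simps)
        also have "2 powr (- e + (- e) * real k) = 2 powr (- e) * (2 powr (- e)) powr real k"
          by (simp only: powr_add powr_powr)
        finally show ?thesis by (simp add: powr_realpow)
      qed
      finally show ?thesis using b0[of "- 1 - int k"] by (simp add: c_def mult.assoc)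
    qed
    then show "\<exists>K. \<forall>k\<ge>K. norm (b (- 1 - int k)) \<le> c * (2 powr (- e)) ^ k" by blast
    have "2 powr (- e) < 2 powr 0" using e by (intro powr_less_mono) auto
    then show "summable (\<lambda>k. c * (2 powr (- e)) ^ k)"
      by (intro summable_mult summable_geometric) simp
  qed
  define K where "K = (\<Sum>k. ennreal (b (int k))) + (\<Sum>k. ennreal (b (- 1 - int k)))"
  have K: "K \<noteq> top"
    unfolding K_def using ennreal_suminf_neq_top[OF sum1 b0] ennreal_suminf_neq_top[OF sum2 b0]
    by (simp add: ennreal_add_eq_top)
  have bound: "(\<integral>\<^sup>+y. ennreal (F x y) \<partial>lborel) \<le> K" for x
  proof -
    define f where "f = (\<lambda>j y. ennreal (F x y) * indicator (ring x j) y)"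
    have fm [measurable]: "f j \<in> borel_measurable borel" for j unfolding f_def by measurable
    have "(\<integral>\<^sup>+y. ennreal (F x y) \<partial>lborel)
        \<le> (\<integral>\<^sup>+y. (\<Sum>k. f (int k) y) + (\<Sum>k. f (- 1 - int k) y) \<partial>lborel)"
    proof (rule nn_integral_mono)
      fix y
      show "ennreal (F x y) \<le> (\<Sum>k. f (int k) y) + (\<Sum>k. f (- 1 - int k) y)"
      proof (cases "x = y")
        case False
        then have "0 < norm (x - y)" by simp
        then obtain j :: int where j: "2 powr real_of_int j \<le> norm (x - y)"
            "norm (x - y) < 2 * 2 powr real_of_int j"
          by (rule ex_dyadic_ring)
        then have fj: "f j y = ennreal (F x y)" by (simp add: f_def ring_def \<rho>_def)
        have term_le: "g k \<le> (\<Sum>k. g k)" for g :: "nat \<Rightarrow> ennreal" and k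
          using sum_le_suminf[of g "{k}"] by simp
        show ?thesis
        proof (cases "0 \<le> j")
          case True
          then have "f j y \<le> (\<Sum>k. f (int k) y)"
            using term_le[of "\<lambda>k. f (int k) y" "nat j"] by simp
          then show ?thesis using fj by (simp add: add_increasing2)
        next
          case False
          then have "f j y \<le> (\<Sum>k. f (- 1 - int k) y)"
            using term_le[of "\<lambda>k. f (- 1 - int k) y" "nat (- 1 - j)"] by simp
          then show ?thesis using fj by (simp add: add_increasing)
        qed
      qed (use p in \<open>simp add: F_def\<close>)
    qed
    also have "\<dots> = (\<integral>\<^sup>+y. (\<Sum>k. f (int k) y) \<partial>lborel) + (\<integral>\<^sup>+y. (\<Sum>k. f (- 1 - int k) y) \<partial>lborel)"
      by (rule nn_integral_add) measurable
    also have "\<dots> = (\<Sum>k. \<integral>\<^sup>+y. f (int k) y \<partial>lborel) + (\<Sum>k. \<integral>\<^sup>+y. f (- 1 - int k) y \<partial>lborel)"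
      by (simp add: nn_integral_suminf)
    also have "\<dots> \<le> K"
      unfolding K_def f_def by (intro add_mono suminf_le ring_le) auto
    finally show ?thesis .
  qed
  show ?thesis
  proof (rule that)
    show "0 \<le> enn2real K" by simp
    fix x :: 'a
    show "(\<integral>\<^sup>+ y. ennreal (min (L * norm (x - y)) M powr p
        / norm (x - y) powr (real DIM('a) + p * s)) \<partial>lborel) \<le> ennreal (enn2real K)"
      using bound[of x] K by (simp add: F_def N_def less_top)
  qed
qed

text \<open>
  Differences vanish unless one of the two points lies in the bounded support; by symmetry the double
  integral is at most twice the measure of the support times the one-point bound.
\<close>
lemma lipschitz_gagliardo_finite:
  fixes \<eta> :: "'a::euclidean_space \<Rightarrow> real"
  assumes s: "0 < s" "s < 1" and p: "1 < p" and S: "bounded S"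
    and off: "\<And>x. x \<notin> S \<Longrightarrow> \<eta> x = 0"
    and lip: "\<And>x y. \<bar>\<eta> x - \<eta> y\<bar> \<le> L * norm (x - y)" and bd: "\<And>x. \<bar>\<eta> x\<bar> \<le> M"
  shows "gagliardo_pow s p \<eta> < \<infinity>"
proof -
  have M: "0 \<le> M" using bd[of 0] by linarith
  have L: "0 \<le> L"
  proof -
    obtain b :: 'a where "b \<in> Basis" using nonempty_Basis by blast
    then show ?thesis using lip[of b 0] by (simp add: norm_Basis)
  qed
  obtain R where R: "S \<subseteq> cball (0::'a) R" using bounded_imp_subset_cball[OF S] by blast
  define C where "C = cball (0::'a) R"
  have Cm [measurable]: "C \<in> sets borel" by (simp add: C_def)
  have "continuous_on UNIV \<eta>"
  proof (rule continuous_onI)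
    fix x e assume e: "0 < (e::real)"
    show "\<exists>d>0. \<forall>x'\<in>UNIV. dist x' x < d \<longrightarrow> dist (\<eta> x') (\<eta> x) \<le> e"
    proof (intro exI[of _ "e / (L + 1)"] conjI ballI impI)
      fix x' assume d: "dist x' x < e / (L + 1)"
      have "dist (\<eta> x') (\<eta> x) \<le> L * dist x' x" using lip[of x' x] by (simp add: dist_norm)
      also have "\<dots> \<le> (L + 1) * (e / (L + 1))" using d L by (intro mult_mono) auto
      finally show "dist (\<eta> x') (\<eta> x) \<le> e" using L by simp
    qed (use e L in auto)
  qed
  then have [measurable]: "\<eta> \<in> borel_measurable borel" by (rule borel_measurable_continuous_onI)
  obtain \<kappa> where \<kappa>: "0 \<le> \<kappa>"
    "\<And>x::'a. (\<integral>\<^sup>+ y. ennreal (min (L * norm (x - y)) (2 * M) powr p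
        / norm (x - y) powr (real DIM('a) + p * s)) \<partial>lborel) \<le> ennreal \<kappa>"
    by (rule lipschitz_kernel_integral_finite[OF s p L, of "2 * M", where ?'a = 'a]) (use M in auto)
  define F where "F = (\<lambda>x y::'a. ennreal (min (L * norm (x - y)) (2 * M) powr p
        / norm (x - y) powr (real DIM('a) + p * s)))"
  have FF: "(\<lambda>z. F (fst z) (snd z)) \<in> borel_measurable (borel \<Otimes>\<^sub>M borel)"
    unfolding F_def by measurable
  have F1 [measurable]: "F x \<in> borel_measurable borel" for x unfolding F_def by measurable
  have F2 [measurable]: "(\<lambda>x. F x y) \<in> borel_measurable borel" for y unfolding F_def by measurable
  have F1i: "(\<integral>\<^sup>+y. F x y \<partial>lborel) \<le> ennreal \<kappa>" for x using \<kappa>(2)[of x] by (simp add: F_def)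
  have F2i: "(\<integral>\<^sup>+x. F x y \<partial>lborel) \<le> ennreal \<kappa>" for y
    using \<kappa>(2)[of y] by (simp add: F_def norm_minus_commute)
  have Cfin: "emeasure lborel C < top"
    unfolding C_def using emeasure_lborel_cball_finite[of "0::'a" R] by (simp only: infinity_ennreal_def)
  have "gagliardo_pow s p \<eta> \<le> (\<integral>\<^sup>+x. (\<integral>\<^sup>+y. (F x y * indicator C x + F x y * indicator C y) \<partial>lborel) \<partial>lborel)"
    unfolding gagliardo_pow_fubini[OF \<open>\<eta> \<in> borel_measurable borel\<close>]
  proof (intro nn_integral_mono)
    fix x y :: 'a
    show "ennreal (\<bar>\<eta> x - \<eta> y\<bar> powr p / norm (x - y) powr (real DIM('a) + p * s))
       \<le> F x y * indicator C x + F x y * indicator C y"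
    proof (cases "x \<in> C \<or> y \<in> C")
      case True
      have "\<bar>\<eta> x - \<eta> y\<bar> \<le> min (L * norm (x - y)) (2 * M)"
        using lip[of x y] bd[of x] bd[of y] by simp
      then have "ennreal (\<bar>\<eta> x - \<eta> y\<bar> powr p / norm (x - y) powr (real DIM('a) + p * s)) \<le> F x y"
        unfolding F_def using p by (intro ennreal_leI divide_right_mono powr_mono2) auto
      then show ?thesis using True by (auto simp: add_increasing add_increasing2 split: split_indicator)
    next
      case False
      then have "\<eta> x = 0" "\<eta> y = 0" using off R unfolding C_def by blast+
      then show ?thesis by simp
    qed
  qed
  also have "\<dots> = (\<integral>\<^sup>+x. (\<integral>\<^sup>+y. F x y * indicator C x \<partial>lborel) \<partial>lborel)
      + (\<integral>\<^sup>+x. (\<integral>\<^sup>+y. F x y * indicator C y \<partial>lborel) \<partial>lborel)"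
  proof -
    have m1: "(\<lambda>z. F (fst z) (snd z) * indicator C (fst z)) \<in> borel_measurable (lborel \<Otimes>\<^sub>M lborel)"
      and m2: "(\<lambda>z. F (fst z) (snd z) * indicator C (snd z)) \<in> borel_measurable (lborel \<Otimes>\<^sub>M lborel)"
      unfolding F_def by measurable
    show ?thesis
      using lborel.borel_measurable_nn_integral_fst[OF m1] lborel.borel_measurable_nn_integral_fst[OF m2]
      by (subst nn_integral_add[symmetric]) (auto intro!: nn_integral_cong nn_integral_add)
  qed
  also have "(\<integral>\<^sup>+x. (\<integral>\<^sup>+y. F x y * indicator C y \<partial>lborel) \<partial>lborel)
      = (\<integral>\<^sup>+y. (\<integral>\<^sup>+x. F x y * indicator C y \<partial>lborel) \<partial>lborel)"
    by (rule lborel_pair.Fubini') (unfold F_def, measurable)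
  also have "(\<integral>\<^sup>+x. (\<integral>\<^sup>+y. F x y * indicator C x \<partial>lborel) \<partial>lborel)
     \<le> (\<integral>\<^sup>+x. ennreal \<kappa> * indicator C x \<partial>lborel)"
    by (intro nn_integral_mono) (auto simp: nn_integral_multc intro!: mult_right_mono F1i)
  also have "(\<integral>\<^sup>+y. (\<integral>\<^sup>+x. F x y * indicator C y \<partial>lborel) \<partial>lborel)
     \<le> (\<integral>\<^sup>+y. ennreal \<kappa> * indicator C y \<partial>lborel)"
    by (intro nn_integral_mono) (auto simp: nn_integral_multc intro!: mult_right_mono F2i)
  also have "(\<integral>\<^sup>+x. ennreal \<kappa> * indicator C x \<partial>lborel) = ennreal \<kappa> * emeasure lborel C"
    by (rule nn_integral_cmult_indicator) simp
  also have "ennreal \<kappa> * emeasure lborel C + ennreal \<kappa> * emeasure lborel C < \<infinity>"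
    using Cfin by (simp add: ennreal_mult_less_top)
  finally show ?thesis by (simp add: add_left_mono add_right_mono)
qed

section \<open>Averages over dyadic cells\<close>

text \<open>
  Along a subsequence the successive distances are summable, so the telescoping series converges
  absolutely almost everywhere.
\<close>
lemma L1_Cauchy_AE_convergent_subsequence:
  fixes f :: "nat \<Rightarrow> 'b \<Rightarrow> real"
  assumes f: "\<And>n. integrable M (f n)"
    and Cauchy: "\<And>\<epsilon>. 0 < \<epsilon> \<Longrightarrow> \<exists>K. \<forall>m\<ge>K. \<forall>n\<ge>K. (LINT x|M. \<bar>f m x - f n x\<bar>) < \<epsilon>"
  obtains r :: "nat \<Rightarrow> nat" where "strict_mono r" "AE x in M. convergent (\<lambda>n. f (r n) x)"
proof -
  have [measurable]: "f n \<in> borel_measurable M" for n using f by (rule borel_measurable_integrable)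
  have "\<forall>j. \<exists>K. \<forall>m\<ge>K. \<forall>n\<ge>K. (LINT x|M. \<bar>f m x - f n x\<bar>) < (1 / 2) ^ j"
    using Cauchy by simp
  then obtain K where K: "\<And>j m n. K j \<le> m \<Longrightarrow> K j \<le> n \<Longrightarrow> (LINT x|M. \<bar>f m x - f n x\<bar>) < (1 / 2) ^ j"
    by metis
  \<comment> \<open>Beyond index \<open>K j\<close> the distances are below \<open>2\<^sup>-\<^sup>j\<close>.\<close>
  define r where "r = rec_nat (K 0) (\<lambda>j m. max (K (Suc j)) (Suc m))"
  have r_Suc: "r (Suc j) = max (K (Suc j)) (Suc (r j))" for j by (simp add: r_def)
  have r: "strict_mono r" by (rule strict_monoI_Suc) (simp add: r_Suc)
  have rK: "K j \<le> r j" for j by (cases j) (simp_all add: r_def)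
  have "r j \<le> r (Suc j)" for j by (simp add: r_Suc)
  then have step: "(LINT x|M. \<bar>f (r (Suc j)) x - f (r j) x\<bar>) < (1 / 2) ^ j" for j
    using K[of j "r (Suc j)" "r j"] rK[of j] order.trans by blast
  define d where "d = (\<lambda>j x. \<bar>f (r (Suc j)) x - f (r j) x\<bar>)"
  have [measurable]: "d j \<in> borel_measurable M" for j unfolding d_def by measurable
  have di: "(\<integral>\<^sup>+x. ennreal (d j x) \<partial>M) \<le> ennreal ((1 / 2) ^ j)" for j
  proof -
    have "integrable M (d j)" unfolding d_def using f by simp
    then have "(\<integral>\<^sup>+x. ennreal (d j x) \<partial>M) = ennreal (LINT x|M. d j x)"
      by (rule nn_integral_eq_integral) (simp add: d_def)
    then show ?thesis using step[of j] by (simp add: d_def ennreal_leI)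
  qed
  have "(\<integral>\<^sup>+x. (\<Sum>j. ennreal (d j x)) \<partial>M) = (\<Sum>j. \<integral>\<^sup>+x. ennreal (d j x) \<partial>M)"
    by (rule nn_integral_suminf) simp
  also have "\<dots> \<le> (\<Sum>j. ennreal ((1 / 2) ^ j))"
    by (intro suminf_le di) auto
  also have "\<dots> < top"
    by (simp add: less_top[symmetric]) (rule ennreal_suminf_neq_top, auto intro: summable_geometric)
  finally have "(\<integral>\<^sup>+x. (\<Sum>j. ennreal (d j x)) \<partial>M) \<noteq> \<infinity>" by simp
  then have "AE x in M. (\<Sum>j. ennreal (d j x)) \<noteq> \<infinity>"
    by (intro nn_integral_PInf_AE) simp_all
  then have "AE x in M. convergent (\<lambda>n. f (r n) x)"
  proof eventually_elim
    case (elim x)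
    have "summable (\<lambda>j. d j x)"
      by (rule summable_suminf_not_top) (use elim in \<open>auto simp: d_def\<close>)
    then have "summable (\<lambda>j. f (r (Suc j)) x - f (r j) x)"
      unfolding d_def by (rule summable_rabs_cancel)
    then have "convergent (\<lambda>n. \<Sum>j<n. f (r (Suc j)) x - f (r j) x)"
      by (rule summable_iff_convergent[THEN iffD1])
    then have "convergent (\<lambda>n. f (r n) x - f (r 0) x)"
      by (simp add: sum_lessThan_telescope[of "\<lambda>j. f (r j) x"])
    then have "convergent (\<lambda>n. (f (r n) x - f (r 0) x) + f (r 0) x)"
      by (rule convergent_add) (rule convergent_const)
    then show ?case by simp
  qed
  with r show ?thesis by (rule that)
qed

text \<open>
  The lower corner of the dyadic cube of side \<open>2\<^sup>-\<^sup>k\<close> that contains \<open>x\<close>, scaled by \<open>2\<^sup>k\<close>. It labels the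
  cubes by countably many points and makes them level sets of a measurable map.
\<close>
definition grid :: "nat \<Rightarrow> 'a::euclidean_space \<Rightarrow> 'a" where
  "grid k x = (\<Sum>b\<in>Basis. real_of_int \<lfloor>2 ^ k * (x \<bullet> b)\<rfloor> *\<^sub>R b)"

definition cell :: "nat \<Rightarrow> 'a::euclidean_space \<Rightarrow> 'a set" where
  "cell k x = {y. grid k y = grid k x}"

lemma grid_inner: "b \<in> Basis \<Longrightarrow> grid k x \<bullet> b = real_of_int \<lfloor>2 ^ k * (x \<bullet> b)\<rfloor>"
  unfolding grid_def by (simp add: inner_sum_left_Basis)

lemma mem_cell_iff: "y \<in> cell k x \<longleftrightarrow> (\<forall>b\<in>Basis. \<lfloor>2 ^ k * (y \<bullet> b)\<rfloor> = \<lfloor>2 ^ k * (x \<bullet> b)\<rfloor>)"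
proof
  assume "y \<in> cell k x"
  then have "grid k y \<bullet> b = grid k x \<bullet> b" for b by (simp add: cell_def)
  then show "\<forall>b\<in>Basis. \<lfloor>2 ^ k * (y \<bullet> b)\<rfloor> = \<lfloor>2 ^ k * (x \<bullet> b)\<rfloor>" by (metis grid_inner of_int_eq_iff)
next
  assume "\<forall>b\<in>Basis. \<lfloor>2 ^ k * (y \<bullet> b)\<rfloor> = \<lfloor>2 ^ k * (x \<bullet> b)\<rfloor>"
  then show "y \<in> cell k x" by (simp add: cell_def grid_def)
qed

lemma grid_measurable [measurable]: "grid k \<in> borel_measurable (borel :: 'a::euclidean_space measure)"
proof -
  have "(\<lambda>x::'a. real_of_int \<lfloor>2 ^ k * (x \<bullet> b)\<rfloor> *\<^sub>R b) \<in> borel_measurable borel" for b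
    by measurable
  then show ?thesis unfolding grid_def[abs_def] by (intro borel_measurable_sum) auto
qed

lemma countable_range_grid: "countable (range (grid k :: 'a::euclidean_space \<Rightarrow> 'a))"
proof (rule countable_subset)
  show "range (grid k :: 'a \<Rightarrow> 'a)
      \<subseteq> (\<lambda>m. \<Sum>b\<in>Basis. real_of_int (m b) *\<^sub>R b) ` (Pi\<^sub>E Basis (\<lambda>_. UNIV))"
  proof
    fix z :: 'a assume "z \<in> range (grid k)"
    then obtain x where "z = grid k x" by auto
    then have "z = (\<Sum>b\<in>Basis. real_of_int (restrict (\<lambda>b. \<lfloor>2 ^ k * (x \<bullet> b)\<rfloor>) Basis b) *\<^sub>R b)"
      by (simp add: grid_def)
    then show "z \<in> (\<lambda>m. \<Sum>b\<in>Basis. real_of_int (m b) *\<^sub>R b) ` (Pi\<^sub>E Basis (\<lambda>_. UNIV))"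
      by (rule image_eqI[where x = "restrict (\<lambda>b. \<lfloor>2 ^ k * (x \<bullet> b)\<rfloor>) Basis"]) auto
  qed
  show "countable ((\<lambda>m. \<Sum>b\<in>Basis. real_of_int (m b) *\<^sub>R b) ` (Pi\<^sub>E (Basis :: 'a set) (\<lambda>_. UNIV :: int set)))"
    by (intro countable_image countable_PiE) auto
qed

lemma cell_measurable [measurable]: "cell k x \<in> sets borel"
  unfolding cell_def by measurable

lemma cell_diameter: "y \<in> cell k x \<Longrightarrow> norm (x - y) \<le> real DIM('a) / 2 ^ k" for x :: "'a::euclidean_space"
proof -
  assume y: "y \<in> cell k x"
  have "\<bar>(x - y) \<bullet> b\<bar> \<le> 1 / 2 ^ k" if "b \<in> Basis" for b
  proof -
    have "\<lfloor>2 ^ k * (y \<bullet> b)\<rfloor> = \<lfloor>2 ^ k * (x \<bullet> b)\<rfloor>" using y that by (simp add: mem_cell_iff)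
    then have "\<bar>2 ^ k * (x \<bullet> b) - 2 ^ k * (y \<bullet> b)\<bar> \<le> 1" by linarith
    then have "\<bar>2 ^ k * ((x - y) \<bullet> b)\<bar> \<le> 1" by (simp add: inner_diff_left right_diff_distrib)
    then show ?thesis by (simp add: abs_mult field_simps)
  qed
  then have "(\<Sum>b\<in>Basis. \<bar>(x - y) \<bullet> b\<bar>) \<le> (\<Sum>b\<in>(Basis :: 'a set). 1 / 2 ^ k)" by (rule sum_mono)
  then show ?thesis using norm_le_l1[of "x - y"] by simp
qed

lemma emeasure_cell: "emeasure lborel (cell k (x :: 'a::euclidean_space)) = ennreal ((1 / 2 ^ k) ^ DIM('a))"
proof -
  define l where "l = (1 / 2 ^ k) *\<^sub>R grid k x"
  define u where "u = l + (1 / 2 ^ k) *\<^sub>R (\<Sum>b\<in>Basis. b)"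
  have lb: "l \<bullet> b = real_of_int \<lfloor>2 ^ k * (x \<bullet> b)\<rfloor> / 2 ^ k"
    and ub: "u \<bullet> b = l \<bullet> b + 1 / 2 ^ k" if "b \<in> Basis" for b
    using that by (simp_all add: l_def u_def grid_inner inner_add_left inner_sum_left_Basis)
  have mem: "y \<in> cell k x \<longleftrightarrow> (\<forall>b\<in>Basis. l \<bullet> b \<le> y \<bullet> b \<and> y \<bullet> b < u \<bullet> b)" for y
  proof -
    have "\<lfloor>2 ^ k * (y \<bullet> b)\<rfloor> = \<lfloor>2 ^ k * (x \<bullet> b)\<rfloor> \<longleftrightarrow> l \<bullet> b \<le> y \<bullet> b \<and> y \<bullet> b < u \<bullet> b"
      if "b \<in> Basis" for b
      unfolding ub[OF that] lb[OF that] floor_eq_iff by (simp add: field_simps)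
    then show ?thesis by (simp add: mem_cell_iff)
  qed
  have "emeasure lborel (cell k x) = emeasure lborel (box l u)"
  proof (rule antisym)
    have "emeasure lborel (cell k x) \<le> emeasure lborel (cbox l u)"
      by (intro emeasure_mono) (auto simp: mem mem_box less_imp_le)
    also have "\<dots> = emeasure lborel (box l u)"
      by (simp add: emeasure_lborel_box_eq emeasure_lborel_cbox_eq)
    finally show "emeasure lborel (cell k x) \<le> emeasure lborel (box l u)" .
    show "emeasure lborel (box l u) \<le> emeasure lborel (cell k x)"
      by (intro emeasure_mono) (auto simp: mem mem_box less_imp_le)
  qed
  also have "\<dots> = ennreal (\<Prod>b\<in>Basis. (u - l) \<bullet> b)"
    by (rule emeasure_lborel_box) (simp add: ub)
  also have "(\<Prod>b\<in>Basis. (u - l) \<bullet> b) = (\<Prod>b\<in>(Basis::'a set). 1 / 2 ^ k)"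
    by (rule prod.cong) (simp_all add: inner_diff_left ub)
  finally show ?thesis by simp
qed

definition cell_avg :: "nat \<Rightarrow> ('a::euclidean_space \<Rightarrow> real) \<Rightarrow> 'a \<Rightarrow> real" where
  "cell_avg k u x = (LINT y|lborel. indicator (cell k x) y * u y) * (2 ^ k) ^ DIM('a)"

lemma cell_avg_measurable:
  assumes [measurable]: "u \<in> borel_measurable borel"
  shows "cell_avg k u \<in> borel_measurable (borel :: 'a::euclidean_space measure)"
proof -
  have [measurable]: "Measurable.pred (borel \<Otimes>\<^sub>M borel) (\<lambda>z::'a \<times> 'a. grid k (snd z) = grid k (fst z))"
    by measurable
  have "(\<lambda>z::'a \<times> 'a. indicator (cell k (fst z)) (snd z) * u (snd z)) \<in> borel_measurable (borel \<Otimes>\<^sub>M borel)"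
    unfolding cell_def indicator_def mem_Collect_eq by measurable
  then have "(\<lambda>(x, y). indicator (cell k x) y * u y) \<in> borel_measurable (borel \<Otimes>\<^sub>M lborel :: ('a \<times> 'a) measure)"
    by (simp add: split_beta' cong: measurable_cong_sets sets_pair_measure_cong)
  from lborel.borel_measurable_lebesgue_integral[OF this]
  show ?thesis unfolding cell_avg_def[abs_def] by measurable
qed

lemma ennreal_integral_le_nn_integral:
  assumes "f \<in> borel_measurable M" "\<And>x. 0 \<le> f x"
  shows "ennreal (LINT x|M. f x) \<le> (\<integral>\<^sup>+x. ennreal (f x) \<partial>M)"
  using assms by (subst integral_eq_nn_integral) (auto simp: ennreal_enn2real_if)

text \<open>
  On a cell of diameter \<open>d\<close> and volume \<open>V\<close> the mean oscillation is at most the mean of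
  \<open>\<bar>u x - u y\<bar> \<le> \<eta> + \<eta>\<^sup>1\<^sup>-\<^sup>p \<bar>u x - u y\<bar>\<^sup>p\<close>; inserting the kernel costs the factor \<open>d\<^sup>N\<^sup>+\<^sup>p\<^sup>s / V\<close>, which is
  of order \<open>d\<^sup>p\<^sup>s\<close>.
\<close>
lemma cell_avg_approximation:
  fixes u :: "'a::euclidean_space \<Rightarrow> real"
  assumes [measurable]: "u \<in> borel_measurable borel" "A \<in> sets borel"
    and ui: "integrable lborel u" and s: "0 < s" and p: "1 < p" and \<eta>: "0 < \<eta>"
  shows "(\<integral>\<^sup>+x. ennreal \<bar>u x - cell_avg k u x\<bar> * indicator A x \<partial>lborel)
    \<le> ennreal \<eta> * emeasure lborel A
      + ennreal (\<eta> powr (1 - p) * real DIM('a) powr (real DIM('a) + p * s) * (2 powr (- (p * s))) ^ k)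
        * gagliardo_pow s p u"
proof -
  define N where "N = real DIM('a)"
  have N: "0 < N" by (simp add: N_def)
  define V where "V = (1 / 2 ^ k :: real) ^ DIM('a)"
  have V: "0 < V" by (simp add: V_def)
  define d where "d = N / 2 ^ k"
  have d: "0 < d" using N by (simp add: d_def)
  define c where "c = \<eta> powr (1 - p) * d powr (N + p * s) / V"
  have c0: "0 \<le> c" using V by (simp add: c_def)
  have c: "c = \<eta> powr (1 - p) * N powr (N + p * s) * (2 powr (- (p * s))) ^ k"
  proof -
    have "V = (2 ^ k) powr (- N)" unfolding V_def N_def by (simp add: powr_minus_divide powr_realpow power_one_over)
    moreover have "d powr (N + p * s) = N powr (N + p * s) * (2 ^ k) powr (- N - p * s)"
      using N powr_minus_divide[of "2 ^ k :: real" "N + p * s"] unfolding d_def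
      by (simp add: powr_divide)
    moreover have "(2 ^ k) powr (- N - p * s) = (2 ^ k) powr (- N) * ((2::real) ^ k) powr (- (p * s))"
      by (simp add: powr_add[symmetric])
    moreover have "((2::real) ^ k) powr (- (p * s)) = (2 powr (- (p * s))) ^ k"
      by (simp add: powr_realpow[symmetric] powr_powr mult.commute)
    ultimately show ?thesis using V by (simp add: c_def)
  qed
  define K where "K = (\<lambda>x y. \<bar>u x - u y\<bar> powr p / norm (x - y) powr (N + p * s))"
  have K0: "0 \<le> K x y" for x y by (simp add: K_def)
  have Km: "(\<lambda>z. ennreal (K (fst z) (snd z))) \<in> borel_measurable (borel \<Otimes>\<^sub>M borel)"
    unfolding K_def by measurable
  have [measurable]: "K x \<in> borel_measurable borel" for x unfolding K_def by measurable
  have osc: "\<bar>u x - cell_avg k u x\<bar> * V \<le> (LINT y|lborel. indicator (cell k x) y * \<bar>u x - u y\<bar>)" for x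
  proof -
    have mc: "measure lborel (cell k x) = V"
      using emeasure_cell[of k x] V unfolding V_def[symmetric] by (simp add: measure_def)
    have fin: "emeasure lborel (cell k x) < \<infinity>" using emeasure_cell[of k x] by simp
    have i1: "integrable lborel (\<lambda>y. indicator (cell k x) y * u y)"
      using integrable_mult_indicator[OF _ ui, of "cell k x"] by simp
    have i2: "integrable lborel (\<lambda>y. indicator (cell k x) y * u x)"
      using fin by (intro integrable_mult_left) (simp add: integrable_indicator_iff)
    have "cell_avg k u x * V = (LINT y|lborel. indicator (cell k x) y * u y)"
      by (simp add: cell_avg_def V_def power_mult_distrib[symmetric])
    moreover have "u x * V = (LINT y|lborel. indicator (cell k x) y * u x)"
      using mc by simp
    ultimately have "(u x - cell_avg k u x) * V
        = (LINT y|lborel. indicator (cell k x) y * u x - indicator (cell k x) y * u y)"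
      using i1 i2 by (simp add: left_diff_distrib)
    then have "\<bar>(u x - cell_avg k u x) * V\<bar>
        \<le> (LINT y|lborel. \<bar>indicator (cell k x) y * u x - indicator (cell k x) y * u y\<bar>)"
      by (simp only: integral_abs_bound)
    also have "(\<lambda>y. \<bar>indicator (cell k x) y * u x - indicator (cell k x) y * u y\<bar>)
        = (\<lambda>y. indicator (cell k x) y * \<bar>u x - u y\<bar>)"
      by (auto split: split_indicator)
    finally show ?thesis using V by (simp add: abs_mult)
  qed
  have pt: "ennreal \<bar>u x - cell_avg k u x\<bar> \<le> ennreal \<eta> + ennreal c * (\<integral>\<^sup>+y. ennreal (K x y) \<partial>lborel)" for x
  proof -
    have point: "indicator (cell k x) y * \<bar>u x - u y\<bar> \<le> \<eta> * indicator (cell k x) y + c * V * K x y" for y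
    proof (cases "y \<in> cell k x")
      case True
      then have n: "norm (x - y) \<le> d" using cell_diameter by (simp add: d_def N_def)
      define t where "t = \<bar>u x - u y\<bar>"
      have "t \<le> \<eta> + \<eta> powr (1 - p) * t powr p"
      proof (cases "t \<le> \<eta>")
        case True
        then show ?thesis by (smt (verit) mult_nonneg_nonneg powr_ge_zero)
      next
        case False
        then have t: "0 < t" using \<eta> by linarith
        have "1 \<le> (t / \<eta>) powr (p - 1)" using False \<eta> p by (intro ge_one_powr_ge_zero) auto
        then have "t * 1 \<le> t * (t / \<eta>) powr (p - 1)" using t by (intro mult_left_mono) auto
        also have "\<dots> = \<eta> powr (1 - p) * t powr p"
          using t \<eta> abs_powr_mult_base[of t p] powr_minus_divide[of \<eta> "p - 1"] by (simp add: powr_divide mult_ac)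
        finally show ?thesis using \<eta> by simp
      qed
      moreover have "t powr p \<le> d powr (N + p * s) * K x y"
      proof (cases "x = y")
        case False
        then have "0 < norm (x - y)" by simp
        moreover from this have "norm (x - y) powr (N + p * s) \<le> d powr (N + p * s)"
          using n N s p by (intro powr_mono2) auto
        ultimately have "t powr p * norm (x - y) powr (N + p * s) \<le> t powr p * d powr (N + p * s)"
          by (intro mult_left_mono) auto
        then show ?thesis using \<open>0 < norm (x - y)\<close> by (simp add: K_def t_def field_simps)
      qed (simp add: t_def K_def)
      then have "\<eta> powr (1 - p) * t powr p \<le> \<eta> powr (1 - p) * (d powr (N + p * s) * K x y)"
        by (intro mult_left_mono) auto
      ultimately show ?thesis using True V by (simp add: c_def t_def mult.assoc)
    next
      case False
      then show ?thesis using K0[of x y] c0 V by simp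
    qed
    have "ennreal (\<bar>u x - cell_avg k u x\<bar> * V)
        \<le> ennreal (LINT y|lborel. indicator (cell k x) y * \<bar>u x - u y\<bar>)"
      by (intro ennreal_leI osc)
    also have "\<dots> \<le> (\<integral>\<^sup>+y. ennreal (indicator (cell k x) y * \<bar>u x - u y\<bar>) \<partial>lborel)"
      by (rule ennreal_integral_le_nn_integral) auto
    also have "\<dots> \<le> (\<integral>\<^sup>+y. ennreal \<eta> * indicator (cell k x) y + ennreal (c * V) * ennreal (K x y) \<partial>lborel)"
    proof (rule nn_integral_mono)
      fix y
      have "ennreal (indicator (cell k x) y * \<bar>u x - u y\<bar>) \<le> ennreal (\<eta> * indicator (cell k x) y + c * V * K x y)"
        by (rule ennreal_leI[OF point])
      also have "\<dots> = ennreal \<eta> * indicator (cell k x) y + ennreal (c * V) * ennreal (K x y)"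
        using \<eta> c0 V K0[of x y] by (simp add: ennreal_mult ennreal_indicator)
      finally show "ennreal (indicator (cell k x) y * \<bar>u x - u y\<bar>)
         \<le> ennreal \<eta> * indicator (cell k x) y + ennreal (c * V) * ennreal (K x y)" .
    qed
    also have "\<dots> = ennreal \<eta> * ennreal V + ennreal (c * V) * (\<integral>\<^sup>+y. ennreal (K x y) \<partial>lborel)"
      using emeasure_cell[of k x]
      by (subst nn_integral_add) (auto simp: nn_integral_cmult nn_integral_cmult_indicator V_def)
    also have "\<dots> = ennreal V * (ennreal \<eta> + ennreal c * (\<integral>\<^sup>+y. ennreal (K x y) \<partial>lborel))"
      using V c0 by (simp add: ennreal_mult distrib_left mult_ac)
    finally have "ennreal V * ennreal \<bar>u x - cell_avg k u x\<bar>
        \<le> ennreal V * (ennreal \<eta> + ennreal c * (\<integral>\<^sup>+y. ennreal (K x y) \<partial>lborel))"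
      using V by (simp add: ennreal_mult mult.commute)
    then show ?thesis using V by (subst (asm) ennreal_mult_le_mult_iff) auto
  qed
  have Kint [measurable]: "(\<lambda>x. \<integral>\<^sup>+y. ennreal (K x y) \<partial>lborel) \<in> borel_measurable borel"
    using lborel.borel_measurable_nn_integral_fst[of "\<lambda>z. ennreal (K (fst z) (snd z))" borel] Km
    by (simp cong: measurable_cong_sets sets_pair_measure_cong)
  have "(\<integral>\<^sup>+x. ennreal \<bar>u x - cell_avg k u x\<bar> * indicator A x \<partial>lborel)
      \<le> (\<integral>\<^sup>+x. ennreal \<eta> * indicator A x + ennreal c * (\<integral>\<^sup>+y. ennreal (K x y) \<partial>lborel) \<partial>lborel)"
    by (intro nn_integral_mono) (use pt in \<open>auto split: split_indicator\<close>)
  also have "\<dots> = ennreal \<eta> * emeasure lborel A + ennreal c * gagliardo_pow s p u"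
  proof -
    have "gagliardo_pow s p u = (\<integral>\<^sup>+x. (\<integral>\<^sup>+y. ennreal (K x y) \<partial>lborel) \<partial>lborel)"
      unfolding gagliardo_pow_fubini[OF assms(1)] K_def N_def ..
    then show ?thesis
      by (subst nn_integral_add) (auto simp: nn_integral_cmult nn_integral_cmult_indicator)
  qed
  finally show ?thesis by (simp add: c N_def)
qed

section \<open>Compactness\<close>

lemma powr_conv_AE:
  assumes "0 < p" "AE x in M. (\<lambda>n. f n x) \<longlonglongrightarrow> (g x :: real)"
  shows "AE x in M. (\<lambda>n. \<bar>f n x\<bar> powr p) \<longlonglongrightarrow> \<bar>g x\<bar> powr p"
  using assms(2) by eventually_elim (use assms(1) in \<open>intro tendsto_powr' tendsto_intros; auto\<close>)

text \<open>
  The part of \<open>w\<^sub>n\<close> below a height \<open>T\<close> is handled by dominated convergence, the part above it by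
  \<open>\<bar>w\<bar>\<^sup>r \<le> T\<^sup>r\<^sup>-\<^sup>q \<bar>w\<bar>\<^sup>q\<close>.
\<close>
lemma Lp_pow_tendsto_0:
  fixes w :: "nat \<Rightarrow> 'a::euclidean_space \<Rightarrow> real"
  assumes w: "\<And>n. w n \<in> Lp lebesgue q" and B: "\<And>n. Lp_pow lebesgue q (w n) \<le> B"
    and r: "0 < r" "r < q"
    and off: "\<And>n. AE x in lebesgue. x \<notin> cball 0 R \<longrightarrow> w n x = 0"
    and lim: "AE x in lebesgue. (\<lambda>n. w n x) \<longlonglongrightarrow> 0"
  shows "(\<lambda>n. Lp_pow lebesgue r (w n)) \<longlonglongrightarrow> 0"
proof (rule LIMSEQ_I)
  fix \<epsilon> :: real assume \<epsilon>: "0 < \<epsilon>"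
  have wm [measurable]: "w n \<in> borel_measurable lebesgue" for n using w by (simp add: Lp_def)
  have B0: "0 \<le> B" using B[of 0] Lp_pow_nonneg[of lebesgue q "w 0"] by linarith
  \<comment> \<open>The height above which the \<open>L\<^sup>q\<close> bound leaves less than \<open>\<epsilon> / 2\<close>.\<close>
  define T where "T = (2 * (B + 1) / \<epsilon>) powr (1 / (q - r))"
  have T: "0 < T" using \<epsilon> B0 by (simp add: T_def)
  have Tq: "T powr (r - q) * B < \<epsilon> / 2"
  proof -
    have "T powr (r - q) = (2 * (B + 1) / \<epsilon>) powr (- 1)"
      unfolding T_def powr_powr using r by (intro arg_cong[where f = "\<lambda>e. _ powr e"]) (simp add: field_simps)
    also have "\<dots> = \<epsilon> / (2 * (B + 1))" using \<epsilon> B0 by (simp add: powr_minus_divide)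
    finally have T_eq: "T powr (r - q) = \<epsilon> / (2 * (B + 1))" .
    show ?thesis unfolding T_eq using \<epsilon> B0 by (simp add: field_simps)
  qed
  define h where "h = (\<lambda>n x. indicator (cball (0::'a) R) x * min \<bar>w n x\<bar> T powr r)"
  have [measurable]: "cball (0::'a) R \<in> sets lebesgue" by simp
  have hm: "h n \<in> borel_measurable lebesgue" for n unfolding h_def by measurable
  have hdom: "integrable lebesgue (\<lambda>x. T powr r * indicator (cball (0::'a) R) x)"
    using emeasure_cball_finite[of "0::'a" R] by (intro integrable_mult_right) (simp add: integrable_indicator_iff)
  have hle: "AE x in lebesgue. norm (h n x) \<le> T powr r * indicator (cball 0 R) x" for n
    unfolding h_def using r T by (intro AE_I2) (auto split: split_indicator intro!: powr_mono2)
  have hi: "integrable lebesgue (h n)" for n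
    by (rule Bochner_Integration.integrable_bound[OF hdom hm])
       (use hle[of n] in eventually_elim, auto split: split_indicator)
  have "(\<lambda>n. LINT x|lebesgue. h n x) \<longlonglongrightarrow> (LINT x|(lebesgue :: 'a measure). (0::real))"
  proof (rule integral_dominated_convergence[OF _ hm hdom _ hle])
    show "AE x in lebesgue. (\<lambda>n. h n x) \<longlonglongrightarrow> 0"
      using lim
    proof eventually_elim
      case (elim x)
      have "(\<lambda>n. indicator (cball 0 R) x * min \<bar>w n x\<bar> T powr r) \<longlonglongrightarrow> indicator (cball 0 R) x * min \<bar>0\<bar> T powr r"
        using r T elim by (intro tendsto_intros tendsto_powr') auto
      then show ?case using T r by (simp add: h_def)
    qed
  qed simp
  then have "eventually (\<lambda>n. (LINT x|lebesgue. h n x) < \<epsilon> / 2) sequentially"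
    using \<epsilon> by (intro order_tendstoD(2)) auto
  then obtain K where K: "\<And>n. K \<le> n \<Longrightarrow> (LINT x|lebesgue. h n x) < \<epsilon> / 2"
    by (auto simp: eventually_sequentially)
  have "Lp_pow lebesgue r (w n) < \<epsilon>" if n: "K \<le> n" for n
  proof -
    have wr: "w n \<in> Lp lebesgue r" using Lp_finite_measure_mono(1)[OF w _ _ off] r by simp
    have "Lp_pow lebesgue r (w n) \<le> (LINT x|lebesgue. h n x + T powr (r - q) * \<bar>w n x\<bar> powr q)"
      unfolding Lp_pow_def
    proof (rule integral_mono_AE)
      show "integrable lebesgue (\<lambda>x. h n x + T powr (r - q) * \<bar>w n x\<bar> powr q)"
        using hi w by (auto simp: Lp_def)
      show "AE x in lebesgue. \<bar>w n x\<bar> powr r \<le> h n x + T powr (r - q) * \<bar>w n x\<bar> powr q"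
        using off[of n]
      proof eventually_elim
        case (elim x)
        show ?case
        proof (cases "x \<in> cball 0 R")
          case in_ball: True
          show ?thesis
          proof (cases "\<bar>w n x\<bar> \<le> T")
            case True
            have "\<bar>w n x\<bar> powr r = h n x" using in_ball True by (simp add: h_def min_def)
            then show ?thesis by simp
          next
            case False
            then have t: "T \<le> \<bar>w n x\<bar>" "0 < \<bar>w n x\<bar>" using T by auto
            have "\<bar>w n x\<bar> powr (r - q) \<le> T powr (r - q)" using T t r by (intro powr_mono2') auto
            then have "\<bar>w n x\<bar> powr (r - q) * \<bar>w n x\<bar> powr q \<le> T powr (r - q) * \<bar>w n x\<bar> powr q"
              by (intro mult_right_mono) auto
            then have "\<bar>w n x\<bar> powr r \<le> T powr (r - q) * \<bar>w n x\<bar> powr q"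
              using t by (simp add: powr_add[symmetric])
            moreover have "0 \<le> h n x" by (simp add: h_def)
            ultimately show ?thesis by linarith
          qed
        next
          case False
          then have "w n x = 0" using elim by simp
          then show ?thesis by (simp add: h_def)
        qed
      qed
    qed (use wr in \<open>simp add: Lp_def\<close>)
    also have "\<dots> = (LINT x|lebesgue. h n x) + T powr (r - q) * Lp_pow lebesgue q (w n)"
      using hi[of n] w[of n] by (simp add: Lp_def Lp_pow_def)
    also have "\<dots> < \<epsilon> / 2 + \<epsilon> / 2"
      using K[OF n] mult_left_mono[OF B[of n], of "T powr (r - q)"] Tq by simp
    finally show ?thesis by simp
  qed
  then show "\<exists>K. \<forall>n\<ge>K. norm (Lp_pow lebesgue r (w n) - 0) < \<epsilon>" by auto
qed

lemma Lp_one_iff: "u \<in> Lp M 1 \<longleftrightarrow> integrable M u"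
proof -
  have "u \<in> borel_measurable M \<Longrightarrow> integrable M (\<lambda>x. \<bar>u x\<bar>) \<longleftrightarrow> integrable M u"
    by (rule integrable_abs_iff)
  then show ?thesis unfolding Lp_def by (auto intro: borel_measurable_integrable)
qed

lemma Lp_pow_one: "Lp_pow M 1 u = (LINT x|M. \<bar>u x\<bar>)"
  by (simp add: Lp_pow_def)

text \<open>
  A diagonal sequence makes all cell averages converge; since these approximate the functions
  uniformly in mean, the sequence is Cauchy in mean.
\<close>
lemma gagliardo_bounded_AE_convergent_subsequence:
  fixes g :: "nat \<Rightarrow> 'a::euclidean_space \<Rightarrow> real"
  assumes gm: "\<And>n. g n \<in> borel_measurable borel"
    and gi: "\<And>n. integrable lborel (g n)" and gC: "\<And>n. (LINT x|lborel. \<bar>g n x\<bar>) \<le> C"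
    and s: "0 < s" and p: "1 < p"
    and G: "\<And>n. gagliardo_pow s p (g n) \<le> ennreal G" "0 \<le> G"
  obtains r :: "nat \<Rightarrow> nat" where "strict_mono r"
    "AE x in lborel. x \<in> cball 0 R \<longrightarrow> convergent (\<lambda>n. g (r n) x)"
proof -
  note gm [measurable]
  define A where "A = cball (0::'a) R"
  have Am [measurable]: "A \<in> sets borel" by (simp add: A_def)
  define mA where "mA = measure lborel A"
  have Afin: "emeasure lborel A < \<infinity>" unfolding A_def by (rule emeasure_lborel_cball_finite)
  then have mA: "emeasure lborel A = ennreal mA" "0 \<le> mA"
    by (simp_all add: mA_def emeasure_eq_ennreal_measure)
  \<comment> \<open>The integrals over the cells, indexed by level and label; they form a countable family.\<close>
  define I where "I = (\<lambda>n (kz :: nat \<times> 'a). LINT y|lborel. indicator {y. grid (fst kz) y = snd kz} y * g n y)"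
  have I_avg: "cell_avg k (g n) x = I n (k, grid k x) * (2 ^ k) ^ DIM('a)" for k n x
    by (simp add: I_def cell_avg_def cell_def)
  have I_le: "norm (I n kz) \<le> C" for n kz
  proof -
    have [measurable]: "{y::'a. grid (fst kz) y = snd kz} \<in> sets borel" by measurable
    have i: "integrable lborel (\<lambda>y. indicator {y. grid (fst kz) y = snd kz} y * g n y)"
      using integrable_mult_indicator[OF _ gi, of "{y. grid (fst kz) y = snd kz}" n] by simp
    have "norm (I n kz) \<le> (LINT y|lborel. norm (indicator {y. grid (fst kz) y = snd kz} y * g n y))"
      unfolding I_def by (rule integral_norm_bound)
    also have "\<dots> \<le> (LINT y|lborel. \<bar>g n y\<bar>)"
      using gi by (intro integral_mono integrable_norm i) (auto split: split_indicator)
    finally show ?thesis using gC[of n] by linarith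
  qed
  define S where "S = (SIGMA k:(UNIV :: nat set). range (grid k :: 'a \<Rightarrow> 'a))"
  have "countable S" unfolding S_def by (intro countable_SIGMA countable_range_grid) auto
  then obtain r0 where r0: "strict_mono (r0 :: nat \<Rightarrow> nat)"
    and r0l: "\<And>kz. kz \<in> S \<Longrightarrow> \<exists>l. (\<lambda>n. I (r0 n) kz) \<longlonglongrightarrow> l"
    using function_convergent_subsequence[of S I C] I_le by metis
  define h where "h = (\<lambda>n x. indicator A x * g (r0 n) x)"
  have hi: "integrable lborel (h n)" for n
    unfolding h_def using integrable_mult_indicator[OF _ gi, of A "r0 n"] by simp
  have hm [measurable]: "h n \<in> borel_measurable borel" for n unfolding h_def by measurable
  have approx: "\<exists>k. \<forall>n. (\<integral>\<^sup>+x. ennreal \<bar>g n x - cell_avg k (g n) x\<bar> * indicator A x \<partial>lborel) \<le> ennreal \<epsilon>"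
    if \<epsilon>: "0 < \<epsilon>" for \<epsilon>
  proof -
    define \<eta> where "\<eta> = \<epsilon> / (2 * (mA + 1))"
    have \<eta>: "0 < \<eta>" using \<epsilon> mA by (simp add: \<eta>_def)
    define c where "c = \<eta> powr (1 - p) * real DIM('a) powr (real DIM('a) + p * s)"
    have c: "0 \<le> c" by (simp add: c_def)
    have "2 powr (- (p * s)) < 2 powr 0" using s p by (intro powr_less_mono) auto
    then have "(\<lambda>k. c * (2 powr (- (p * s))) ^ k * G) \<longlonglongrightarrow> c * 0 * G"
      by (intro tendsto_intros LIMSEQ_power_zero) simp
    then have "eventually (\<lambda>k. c * (2 powr (- (p * s))) ^ k * G < \<epsilon> / 2) sequentially"
      using \<epsilon> by (intro order_tendstoD(2)) auto
    then obtain k where k: "c * (2 powr (- (p * s))) ^ k * G < \<epsilon> / 2"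
      by (auto simp: eventually_sequentially)
    have "(\<integral>\<^sup>+x. ennreal \<bar>g n x - cell_avg k (g n) x\<bar> * indicator A x \<partial>lborel) \<le> ennreal \<epsilon>" for n
    proof -
      have "(\<integral>\<^sup>+x. ennreal \<bar>g n x - cell_avg k (g n) x\<bar> * indicator A x \<partial>lborel)
         \<le> ennreal \<eta> * emeasure lborel A + ennreal (c * (2 powr (- (p * s))) ^ k) * gagliardo_pow s p (g n)"
        unfolding c_def by (rule cell_avg_approximation[OF gm Am gi s p \<eta>])
      also have "\<dots> \<le> ennreal \<eta> * ennreal mA + ennreal (c * (2 powr (- (p * s))) ^ k) * ennreal G"
        unfolding mA(1) by (intro add_left_mono mult_left_mono G) simp
      also have "\<dots> = ennreal (\<eta> * mA + c * (2 powr (- (p * s))) ^ k * G)"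
        using \<eta> mA c G(2) by (simp add: ennreal_mult)
      also have "\<dots> \<le> ennreal \<epsilon>"
      proof (rule ennreal_leI)
        have "\<eta> * mA \<le> \<epsilon> / 2" using \<epsilon> mA by (simp add: \<eta>_def field_simps)
        then show "\<eta> * mA + c * (2 powr (- (p * s))) ^ k * G \<le> \<epsilon>" using k by linarith
      qed
      finally show ?thesis .
    qed
    then show ?thesis by blast
  qed
  have avg_Cauchy: "\<exists>K. \<forall>m\<ge>K. \<forall>n\<ge>K.
      (\<integral>\<^sup>+x. ennreal \<bar>cell_avg k (g (r0 m)) x - cell_avg k (g (r0 n)) x\<bar> * indicator A x \<partial>lborel) \<le> ennreal \<epsilon>"
    if \<epsilon>: "0 < \<epsilon>" for \<epsilon> k
  proof -
    define a where "a = (\<lambda>n. cell_avg k (g (r0 n)))"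
    have am [measurable]: "a n \<in> borel_measurable borel" for n
      unfolding a_def by (rule cell_avg_measurable) simp
    define b where "b = (\<lambda>x. lim (\<lambda>n. a n x))"
    have bm [measurable]: "b \<in> borel_measurable borel" unfolding b_def by measurable
    have lim: "(\<lambda>n. a n x) \<longlonglongrightarrow> b x" for x
    proof -
      have "(k, grid k x) \<in> S" by (simp add: S_def)
      then obtain l where "(\<lambda>n. I (r0 n) (k, grid k x)) \<longlonglongrightarrow> l" using r0l by blast
      then have "(\<lambda>n. a n x) \<longlonglongrightarrow> l * (2 ^ k) ^ DIM('a)"
        unfolding a_def I_avg by (intro tendsto_intros)
      then show ?thesis unfolding b_def by (simp add: limI)
    qed
    define M where "M = C * (2 ^ k) ^ DIM('a)"
    have ab: "\<bar>a n x\<bar> \<le> M" for n x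
      using I_le[of "r0 n" "(k, grid k x)"] by (simp add: a_def I_avg M_def abs_mult mult_right_mono)
    have bb: "\<bar>b x\<bar> \<le> M" for x
      by (rule tendsto_upperbound[OF tendsto_rabs[OF lim]]) (use ab in auto)
    define f where "f = (\<lambda>n x. indicator A x * \<bar>a n x - b x\<bar>)"
    have dom: "integrable lborel (\<lambda>x. 2 * M * indicator A x)"
      using Afin by (intro integrable_mult_right) (simp add: integrable_indicator_iff)
    have fb: "norm (f n x) \<le> 2 * M * indicator A x" for n x
      using ab[of n x] bb[of x] by (auto simp: f_def split: split_indicator)
    have fm: "f n \<in> borel_measurable lborel" for n unfolding f_def by measurable
    have fi: "integrable lborel (f n)" for n
      by (rule Bochner_Integration.integrable_bound[OF dom fm])
         (intro AE_I2, metis fb order.trans abs_ge_self real_norm_def)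
    have "(\<lambda>n. LINT x|lborel. f n x) \<longlonglongrightarrow> (LINT x|(lborel :: 'a measure). (0::real))"
    proof (rule integral_dominated_convergence[OF _ fm dom])
      show "AE x in lborel. (\<lambda>n. f n x) \<longlonglongrightarrow> 0"
      proof (rule AE_I2)
        fix x :: 'a
        have "(\<lambda>n. indicator A x * \<bar>a n x - b x\<bar>) \<longlonglongrightarrow> indicator A x * \<bar>b x - b x\<bar>"
          by (intro tendsto_intros lim)
        then show "(\<lambda>n. f n x) \<longlonglongrightarrow> 0" by (simp add: f_def)
      qed
    qed (use fb in auto)
    then have "eventually (\<lambda>n. (LINT x|lborel. f n x) < \<epsilon> / 2) sequentially"
      using \<epsilon> by (intro order_tendstoD(2)) auto
    then obtain K where K: "\<And>n. K \<le> n \<Longrightarrow> (LINT x|lborel. f n x) < \<epsilon> / 2"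
      by (auto simp: eventually_sequentially)
    have "(\<integral>\<^sup>+x. ennreal \<bar>a m x - a n x\<bar> * indicator A x \<partial>lborel) \<le> ennreal \<epsilon>" if "K \<le> m" "K \<le> n" for m n
    proof -
      have "(\<integral>\<^sup>+x. ennreal \<bar>a m x - a n x\<bar> * indicator A x \<partial>lborel) \<le> (\<integral>\<^sup>+x. ennreal (f m x + f n x) \<partial>lborel)"
        by (intro nn_integral_mono) (auto simp: f_def simp del: ennreal_plus split: split_indicator intro!: ennreal_leI)
      also have "\<dots> = ennreal (LINT x|lborel. f m x + f n x)"
        using fi by (intro nn_integral_eq_integral) (auto simp: f_def)
      also have "\<dots> \<le> ennreal \<epsilon>" using K[OF that(1)] K[OF that(2)] fi by (intro ennreal_leI) simp
      finally show ?thesis .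
    qed
    then show ?thesis unfolding a_def by blast
  qed
  have "\<exists>K. \<forall>m\<ge>K. \<forall>n\<ge>K. (LINT x|lborel. \<bar>h m x - h n x\<bar>) < \<epsilon>" if \<epsilon>: "0 < \<epsilon>" for \<epsilon>
  proof -
    obtain k where k: "\<And>n. (\<integral>\<^sup>+x. ennreal \<bar>g n x - cell_avg k (g n) x\<bar> * indicator A x \<partial>lborel) \<le> ennreal (\<epsilon> / 4)"
      using approx[of "\<epsilon> / 4"] \<epsilon> by auto
    obtain K where K: "\<And>m n. K \<le> m \<Longrightarrow> K \<le> n \<Longrightarrow>
      (\<integral>\<^sup>+x. ennreal \<bar>cell_avg k (g (r0 m)) x - cell_avg k (g (r0 n)) x\<bar> * indicator A x \<partial>lborel) \<le> ennreal (\<epsilon> / 4)"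
      using avg_Cauchy[of "\<epsilon> / 4" k] \<epsilon> by auto
    have "(LINT x|lborel. \<bar>h m x - h n x\<bar>) < \<epsilon>" if mn: "K \<le> m" "K \<le> n" for m n
    proof -
      define a where "a = (\<lambda>n. cell_avg k (g (r0 n)))"
      have [measurable]: "a n \<in> borel_measurable borel" for n
        unfolding a_def by (rule cell_avg_measurable) simp
      have "ennreal (LINT x|lborel. \<bar>h m x - h n x\<bar>) = (\<integral>\<^sup>+x. ennreal \<bar>h m x - h n x\<bar> \<partial>lborel)"
        using hi by (intro nn_integral_eq_integral[symmetric]) auto
      also have "\<dots> \<le> (\<integral>\<^sup>+x. ennreal \<bar>g (r0 m) x - a m x\<bar> * indicator A x
           + (ennreal \<bar>a m x - a n x\<bar> * indicator A x + ennreal \<bar>g (r0 n) x - a n x\<bar> * indicator A x) \<partial>lborel)"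
      proof (rule nn_integral_mono)
        fix x
        have "\<bar>g (r0 m) x - g (r0 n) x\<bar> \<le> \<bar>g (r0 m) x - a m x\<bar> + (\<bar>a m x - a n x\<bar> + \<bar>g (r0 n) x - a n x\<bar>)"
          by linarith
        from ennreal_leI[OF this]
        show "ennreal \<bar>h m x - h n x\<bar> \<le> ennreal \<bar>g (r0 m) x - a m x\<bar> * indicator A x
           + (ennreal \<bar>a m x - a n x\<bar> * indicator A x + ennreal \<bar>g (r0 n) x - a n x\<bar> * indicator A x)"
          by (auto simp: h_def split: split_indicator)
      qed
      also have "\<dots> = (\<integral>\<^sup>+x. ennreal \<bar>g (r0 m) x - a m x\<bar> * indicator A x \<partial>lborel)
          + ((\<integral>\<^sup>+x. ennreal \<bar>a m x - a n x\<bar> * indicator A x \<partial>lborel)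
             + (\<integral>\<^sup>+x. ennreal \<bar>g (r0 n) x - a n x\<bar> * indicator A x \<partial>lborel))"
        by (simp add: nn_integral_add)
      also have "\<dots> \<le> ennreal (\<epsilon> / 4) + (ennreal (\<epsilon> / 4) + ennreal (\<epsilon> / 4))"
        unfolding a_def by (intro add_mono k K mn)
      also have "\<dots> = ennreal (3 * \<epsilon> / 4)" using \<epsilon> by (simp add: ennreal_plus[symmetric] del: ennreal_plus)
      finally have "(LINT x|lborel. \<bar>h m x - h n x\<bar>) \<le> 3 * \<epsilon> / 4"
        using \<epsilon> by (subst (asm) ennreal_le_iff) auto
      then show ?thesis using \<epsilon> by linarith
    qed
    then show ?thesis by blast
  qed
  from L1_Cauchy_AE_convergent_subsequence[OF hi this]
  obtain r1 :: "nat \<Rightarrow> nat" where r1: "strict_mono r1" "AE x in lborel. convergent (\<lambda>n. h (r1 n) x)"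
    by blast
  show ?thesis
  proof (rule that[of "r0 \<circ> r1"])
    show "strict_mono (r0 \<circ> r1)" using r0 r1(1) by (rule strict_mono_o)
    show "AE x in lborel. x \<in> cball 0 R \<longrightarrow> convergent (\<lambda>n. g ((r0 \<circ> r1) n) x)"
      using r1(2) by eventually_elim (auto simp: h_def A_def)
  qed
qed

section \<open>The variational setting\<close>

text \<open>
  The data of the problem. The strict bound on \<open>\<mu>\<close> is where the Hardy inequality enters: a positive
  Hardy constant expresses it.
\<close>
locale hardy_problem =
  fixes \<Omega> :: "'a::euclidean_space set" and s p r \<Lambda> \<mu> :: real
  assumes s: "0 < s" "s < 1" and p: "1 < p"
    and \<Omega>_open: "open \<Omega>" and \<Omega>_bounded: "bounded \<Omega>" and \<Omega>_0: "0 \<in> \<Omega>"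
    and ps: "p * s < real DIM('a)"
    and pr: "p < r" and r_crit: "r < crit_exp DIM('a) s p"
    and \<Lambda>: "0 < \<Lambda>" and \<mu>: "0 < \<mu>" and \<mu>_hardy: "ennreal \<mu> < hardy_const s p \<Omega>"
begin

lemma r: "1 < r" "0 < r" "r \<noteq> 0" and p0: "0 < p" "0 \<le> p" "p \<noteq> 0"
  using p pr by auto

abbreviation W :: "('a \<Rightarrow> real) set" where "W \<equiv> W0 s p \<Omega>"

abbreviation gmeas :: "('a \<times> 'a) measure" where "gmeas \<equiv> gag_measure s p"

text \<open>
  The Hardy weight on the whole space; functions of the solution space vanish outside \<open>\<Omega>\<close>.
\<close>
definition hmeas :: "'a measure" where
  "hmeas = density lebesgue (\<lambda>x. ennreal (1 / norm x powr (p * s)))"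

definition E :: "('a \<Rightarrow> real) \<Rightarrow> real" where "E u = Lp_pow gmeas p (incr u)"

definition H :: "('a \<Rightarrow> real) \<Rightarrow> real" where "H u = Lp_pow hmeas p u"

definition R :: "('a \<Rightarrow> real) \<Rightarrow> real" where "R u = Lp_pow lebesgue r u"

definition A :: "('a \<Rightarrow> real) \<Rightarrow> real" where "A u = E u - \<mu> * H u"

definition J :: "('a \<Rightarrow> real) \<Rightarrow> real" where "J u = A u / p - \<Lambda> / r * R u"

text \<open>
  The differentials carry the factors \<open>1/p\<close> and \<open>1/r\<close>: the derivative of \<open>A\<close> is \<open>p dA\<close> and that of \<open>R\<close>
  is \<open>r dR\<close>, while that of \<open>J\<close> is \<open>dJ\<close>. With this convention \<open>dA u u = A u\<close> and \<open>dR u u = R u\<close>.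
\<close>
definition dA :: "('a \<Rightarrow> real) \<Rightarrow> ('a \<Rightarrow> real) \<Rightarrow> real" where
  "dA u v = (LINT z|gmeas. dpow p (incr u z) * incr v z) - \<mu> * (LINT x|hmeas. dpow p (u x) * v x)"

definition dR :: "('a \<Rightarrow> real) \<Rightarrow> ('a \<Rightarrow> real) \<Rightarrow> real" where
  "dR u v = (LINT x|lebesgue. dpow r (u x) * v x)"

definition dJ :: "('a \<Rightarrow> real) \<Rightarrow> ('a \<Rightarrow> real) \<Rightarrow> real" where
  "dJ u v = dA u v - \<Lambda> * dR u v"

lemma E_nonneg [simp]: "0 \<le> E u" and H_nonneg [simp]: "0 \<le> H u" and R_nonneg [simp]: "0 \<le> R u"
  by (simp_all add: E_def H_def R_def)

lemma W_iff: "u \<in> W \<longleftrightarrow> u \<in> borel_measurable lebesgue \<and>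
    (AE x in lebesgue. x \<notin> \<Omega> \<longrightarrow> u x = 0) \<and> gagliardo_pow s p u < \<infinity>"
  by (rule W0_iff[OF s(1) p ps \<Omega>_bounded])

lemma W_meas: "u \<in> W \<Longrightarrow> u \<in> borel_measurable lebesgue"
  and W_off: "u \<in> W \<Longrightarrow> AE x in lebesgue. x \<notin> \<Omega> \<longrightarrow> u x = 0"
  and W_fin: "u \<in> W \<Longrightarrow> gagliardo_pow s p u < \<infinity>"
  by (simp_all only: W_iff)

lemma hmeas_measurable:
  "u \<in> borel_measurable lebesgue \<Longrightarrow> u \<in> borel_measurable hmeas"
  by (simp add: hmeas_def)

lemma kernel_h_measurable [measurable]: "(\<lambda>x::'a. 1 / norm x powr (p * s)) \<in> borel_measurable lebesgue"
proof -
  have "(\<lambda>x::'a. 1 / norm x powr (p * s)) \<in> borel_measurable borel" by measurable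
  then show ?thesis by (simp add: measurable_completion)
qed

lemma AE_hmeasI: "AE x in lebesgue. P x \<Longrightarrow> AE x in hmeas. P x"
  unfolding hmeas_def by (subst AE_density) (auto elim: eventually_mono)

lemma W_incr_Lp: "u \<in> W \<Longrightarrow> incr u \<in> Lp gmeas p"
  using W_fin[of u] incr_measurable_gag[OF W_meas, of u]
  by (simp add: Lp_iff_nn_integral gagliardo_pow_eq[OF W_meas])

lemma gagliardo_pow_eq_E: "u \<in> W \<Longrightarrow> gagliardo_pow s p u = ennreal (E u)"
  unfolding E_def by (simp only: ennreal_Lp_pow[OF W_incr_Lp] gagliardo_pow_eq[OF W_meas])

lemma enn2real_gagliardo_pow: "u \<in> W \<Longrightarrow> enn2real (gagliardo_pow s p u) = E u"
  by (simp only: gagliardo_pow_eq_E enn2real_ennreal[OF E_nonneg])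

lemma W0_norm_eq: "u \<in> W \<Longrightarrow> W0_norm s p u = E u powr (1 / p)"
  unfolding W0_norm_def by (simp only: enn2real_gagliardo_pow)

lemma hardy_nn_integral:
  assumes "u \<in> W"
  shows "(\<integral>\<^sup>+ x \<in> \<Omega>. ennreal (\<bar>u x\<bar> powr p / norm x powr (p * s)) \<partial>lebesgue)
    = (\<integral>\<^sup>+x. ennreal (\<bar>u x\<bar> powr p) \<partial>hmeas)"
proof -
  have [measurable]: "u \<in> borel_measurable lebesgue" using assms by (rule W_meas)
  have "(\<integral>\<^sup>+x. ennreal (\<bar>u x\<bar> powr p) \<partial>hmeas)
      = (\<integral>\<^sup>+x. ennreal (1 / norm x powr (p * s)) * ennreal (\<bar>u x\<bar> powr p) \<partial>lebesgue)"
    unfolding hmeas_def by (rule nn_integral_density) measurable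
  also have "\<dots> = (\<integral>\<^sup>+ x \<in> \<Omega>. ennreal (\<bar>u x\<bar> powr p / norm x powr (p * s)) \<partial>lebesgue)"
    by (rule nn_integral_cong_AE)
       (use W_off[OF assms] in eventually_elim, auto simp: ennreal_mult[symmetric] split: split_indicator)
  finally show ?thesis ..
qed

text \<open>
  A number strictly between \<open>\<mu>\<close> and the Hardy constant leaves room for coercivity. The quotient in
  the constant is taken in \<open>[0,\<infinity>]\<close>, where an infinite Hardy integral would make it zero; hence the
  integral is finite for every function of the space.
\<close>
lemma hardy_inequality: "\<exists>\<mu>'>\<mu>. \<forall>u\<in>W. u \<in> Lp hmeas p \<and> \<mu>' * H u \<le> E u"
proof -
  obtain c where c: "ennreal \<mu> < c" "c < hardy_const s p \<Omega>" using dense[OF \<mu>_hardy] by blast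
  then have "c < top" using order.strict_trans2[OF c(2) top_greatest] by simp
  then obtain \<mu>' where \<mu>': "c = ennreal \<mu>'" "0 \<le> \<mu>'" by (cases c rule: ennreal_cases) auto
  have \<mu>\<mu>': "\<mu> < \<mu>'" using c(1) \<mu> unfolding \<mu>'(1) by (simp add: ennreal_less_iff)
  define Hn where "Hn = (\<lambda>u. \<integral>\<^sup>+x. ennreal (\<bar>u x\<bar> powr p) \<partial>hmeas)"
  have le: "ennreal \<mu>' * Hn u \<le> gagliardo_pow s p u" if u: "u \<in> W" for u
  proof (cases "AE x in lebesgue. u x = 0")
    case True
    have "Hn u = (\<integral>\<^sup>+x. 0 \<partial>hmeas)"
      unfolding Hn_def by (rule nn_integral_cong_AE) (use AE_hmeasI[OF True] in eventually_elim, simp)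
    then show ?thesis by simp
  next
    case False
    have "c \<le> gagliardo_pow s p u / Hn u"
      unfolding Hn_def hardy_nn_integral[OF u, symmetric]
      by (rule order.trans[OF less_imp_le[OF c(2)]])
         (unfold hardy_const_def, rule INF_lower, use u False in simp)
    then have "c * Hn u \<le> gagliardo_pow s p u / Hn u * Hn u" by (rule mult_right_mono) simp
    also have "\<dots> = gagliardo_pow s p u * (inverse (Hn u) * Hn u)"
      by (simp add: divide_ennreal_def mult.assoc)
    \<comment> \<open>Equality fails only for the values \<open>0\<close> and \<open>\<infinity>\<close> of the Hardy integral, where the product is \<open>0\<close>.\<close>
    also have "inverse (Hn u) * Hn u \<le> 1"
      by (cases "Hn u" rule: ennreal_cases)
         (auto simp: inverse_ennreal ennreal_mult[symmetric] zero_less_iff_neq_zero le_less)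
    then have "gagliardo_pow s p u * (inverse (Hn u) * Hn u) \<le> gagliardo_pow s p u * 1"
      by (rule mult_left_mono) simp
    finally show ?thesis by (simp add: \<mu>'(1))
  qed
  have Lh: "u \<in> Lp hmeas p" if u: "u \<in> W" for u
  proof -
    have "ennreal \<mu>' * Hn u < top" using le_less_trans[OF le[OF u] W_fin[OF u]] by simp
    then have "Hn u < top" using \<mu>\<mu>' \<mu> by (auto simp: ennreal_mult_less_top)
    then show ?thesis
      by (subst Lp_iff_nn_integral) (use u in \<open>auto simp: Hn_def intro: hmeas_measurable W_meas\<close>)
  qed
  show ?thesis
  proof (intro exI[of _ \<mu>'] conjI ballI \<mu>\<mu>' Lh)
    fix u assume u: "u \<in> W"
    have "ennreal (\<mu>' * H u) = ennreal \<mu>' * Hn u"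
      using \<mu>'(2) ennreal_Lp_pow[OF Lh[OF u]] by (simp add: ennreal_mult H_def Hn_def)
    then have "ennreal (\<mu>' * H u) \<le> ennreal (E u)" using le[OF u] gagliardo_pow_eq_E[OF u] by simp
    then show "\<mu>' * H u \<le> E u" by (simp add: ennreal_le_iff)
  qed
qed

lemma W_hmeas_Lp: "u \<in> W \<Longrightarrow> u \<in> Lp hmeas p"
  using hardy_inequality by blast

lemma A_coercive: "\<exists>\<kappa>>0. \<forall>u\<in>W. \<kappa> * E u \<le> A u"
proof -
  obtain \<mu>' where \<mu>': "\<mu> < \<mu>'" "\<forall>u\<in>W. \<mu>' * H u \<le> E u"
    using hardy_inequality by blast
  show ?thesis
  proof (intro exI[of _ "1 - \<mu> / \<mu>'"] conjI ballI)
    show "0 < 1 - \<mu> / \<mu>'" using \<mu> \<mu>'(1) by simp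
    fix u assume u: "u \<in> W"
    have "\<mu> / \<mu>' * (\<mu>' * H u) \<le> \<mu> / \<mu>' * E u"
      using \<mu> \<mu>'(1) by (intro mult_left_mono \<mu>'(2)[rule_format, OF u]) auto
    then show "(1 - \<mu> / \<mu>') * E u \<le> A u" using \<mu> \<mu>'(1) by (simp add: A_def left_diff_distrib)
  qed
qed

lemma A_nonneg: assumes "u \<in> W" shows "0 \<le> A u"
proof -
  obtain \<kappa> where \<kappa>: "0 < \<kappa>" "\<forall>u\<in>W. \<kappa> * E u \<le> A u" using A_coercive by blast
  have "0 \<le> \<kappa> * E u" using \<kappa>(1) by simp
  then show ?thesis using bspec[OF \<kappa>(2) assms] by linarith
qed

lemma H_le: "\<exists>C>0. \<forall>u\<in>W. H u \<le> C * E u"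
proof -
  obtain \<mu>' where \<mu>': "\<mu> < \<mu>'" "\<forall>u\<in>W. \<mu>' * H u \<le> E u"
    using hardy_inequality by blast
  show ?thesis
  proof (intro exI[of _ "1 / \<mu>'"] conjI ballI)
    show "0 < 1 / \<mu>'" using \<mu> \<mu>'(1) by simp
    fix u assume "u \<in> W"
    from \<mu>'(2)[rule_format, OF this] show "H u \<le> 1 / \<mu>' * E u" using \<mu>'(1) \<mu> by (simp add: field_simps)
  qed
qed

definition rad :: real where "rad = (SOME \<rho>. \<Omega> \<subseteq> cball 0 \<rho>)"

lemma \<Omega>_rad: "\<Omega> \<subseteq> cball 0 rad"
  unfolding rad_def by (rule someI_ex[OF bounded_imp_subset_cball[OF \<Omega>_bounded]])

lemma W_off_rad: "u \<in> W \<Longrightarrow> AE x in lebesgue. x \<notin> cball 0 rad \<longrightarrow> u x = 0"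
  using W_off[of u] \<Omega>_rad by (auto elim!: eventually_mono)

definition q :: real where "q = crit_exp DIM('a) s p"

lemma q: "r < q" "1 < q" "0 < q" "p < q"
  using r_crit r pr by (auto simp: q_def)

lemma W_q: "u \<in> W \<Longrightarrow> u \<in> Lp lebesgue q"
  and W_q_le: "u \<in> W \<Longrightarrow> sobolev_const DIM('a) s p * Lp_pow lebesgue q u powr (p / q) \<le> E u"
proof -
  assume u: "u \<in> W"
  note sob = sobolev[OF W_meas[OF u] s(1) p ps q_def \<Omega>_bounded W_off[OF u] W_fin[OF u]]
  show "u \<in> Lp lebesgue q" by (rule sob(1))
  show "sobolev_const DIM('a) s p * Lp_pow lebesgue q u powr (p / q) \<le> E u"
    using sob(2) unfolding enn2real_gagliardo_pow[OF u] .
qed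

lemma W_q_bound:
  assumes u: "u \<in> W" and G: "E u \<le> G"
  shows "Lp_pow lebesgue q u \<le> (G / sobolev_const DIM('a) s p) powr (q / p)"
proof -
  define S where "S = sobolev_const DIM('a) s p"
  have S: "0 < S" unfolding S_def by (rule sobolev_const_pos)
  have "Lp_pow lebesgue q u powr (p / q) \<le> G / S"
    using W_q_le[OF u] G S by (simp add: S_def[symmetric] field_simps)
  then have "(Lp_pow lebesgue q u powr (p / q)) powr (q / p) \<le> (G / S) powr (q / p)"
    using q p0 by (intro powr_mono2) auto
  then show ?thesis using q p0 by (simp add: powr_powr S_def)
qed

lemma W_r: "u \<in> W \<Longrightarrow> u \<in> Lp lebesgue r"
  using Lp_finite_measure_mono(1)[OF W_q r(2) less_imp_le[OF q(1)] W_off_rad] by blast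

lemma W_integrable: "u \<in> W \<Longrightarrow> integrable lebesgue u"
  using Lp_finite_measure_mono(1)[OF W_q zero_less_one less_imp_le[OF q(2)] W_off_rad]
  by (simp only: Lp_one_iff)

lemma incr_add: "incr (\<lambda>x. a * u x + b * v x) = (\<lambda>z. a * incr u z + b * incr v z)"
  by (auto simp: incr_def algebra_simps)

lemma W_lin:
  assumes u: "u \<in> W" and v: "v \<in> W"
  shows "(\<lambda>x. a * u x + b * v x) \<in> W"
proof -
  have [measurable]: "u \<in> borel_measurable lebesgue" "v \<in> borel_measurable lebesgue"
    using u v by (auto intro: W_meas)
  have m: "(\<lambda>x. a * u x + b * v x) \<in> borel_measurable lebesgue" by measurable
  have "incr (\<lambda>x. a * u x + b * v x) \<in> Lp gmeas p"
    unfolding incr_add using u v p0 by (intro Lp_add(1) Lp_scale(1) W_incr_Lp) auto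
  then have "gagliardo_pow s p (\<lambda>x. a * u x + b * v x) < \<infinity>"
    unfolding gagliardo_pow_eq[OF m] by (simp add: Lp_iff_nn_integral incr_measurable_gag[OF m])
  moreover have "AE x in lebesgue. x \<notin> \<Omega> \<longrightarrow> a * u x + b * v x = 0"
    using W_off[OF u] W_off[OF v] by eventually_elim auto
  ultimately show ?thesis using m unfolding W_iff by blast
qed

lemma W_add: "u \<in> W \<Longrightarrow> v \<in> W \<Longrightarrow> (\<lambda>x. u x + v x) \<in> W"
  and W_diff: "u \<in> W \<Longrightarrow> v \<in> W \<Longrightarrow> (\<lambda>x. u x - v x) \<in> W"
  and W_scale: "u \<in> W \<Longrightarrow> (\<lambda>x. a * u x) \<in> W"
  and W_add_scale: "u \<in> W \<Longrightarrow> v \<in> W \<Longrightarrow> (\<lambda>x. u x + a * v x) \<in> W"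
  using W_lin[of u v 1 1] W_lin[of u v 1 "-1"] W_lin[of u u a 0] W_lin[of u v 1 a] by simp_all

text \<open>
  Applies to the positive part, the negative part and the absolute value.
\<close>
lemma W_contraction:
  assumes u: "u \<in> W" and v: "v \<in> borel_measurable lebesgue"
    and le: "\<And>x y. \<bar>v x - v y\<bar> \<le> \<bar>u x - u y\<bar>" and 0: "\<And>x. u x = 0 \<Longrightarrow> v x = 0"
  shows "v \<in> W" "E v \<le> E u"
proof -
  have g: "gagliardo_pow s p v \<le> gagliardo_pow s p u" using le p0 by (intro gagliardo_pow_mono)
  have "AE x in lebesgue. x \<notin> \<Omega> \<longrightarrow> v x = 0" using W_off[OF u] by eventually_elim (use 0 in auto)
  then show vW: "v \<in> W" using v le_less_trans[OF g W_fin[OF u]] unfolding W_iff by blast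
  show "E v \<le> E u" using g u vW by (simp add: gagliardo_pow_eq_E ennreal_le_iff)
qed

lemma W_pos: "u \<in> W \<Longrightarrow> (\<lambda>x. max (u x) 0) \<in> W" "u \<in> W \<Longrightarrow> E (\<lambda>x. max (u x) 0) \<le> E u"
  and W_neg: "u \<in> W \<Longrightarrow> (\<lambda>x. min (u x) 0) \<in> W" "u \<in> W \<Longrightarrow> E (\<lambda>x. min (u x) 0) \<le> E u"
  and W_abs: "u \<in> W \<Longrightarrow> (\<lambda>x. \<bar>u x\<bar>) \<in> W" "u \<in> W \<Longrightarrow> E (\<lambda>x. \<bar>u x\<bar>) \<le> E u"
proof -
  assume u: "u \<in> W"
  have [measurable]: "u \<in> borel_measurable lebesgue" using u by (rule W_meas)
  note W_contraction[OF u, of "\<lambda>x. max (u x) 0"]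
  moreover have "(\<lambda>x. max (u x) 0) \<in> borel_measurable lebesgue" by measurable
  moreover have "\<bar>max (u x) 0 - max (u y) 0\<bar> \<le> \<bar>u x - u y\<bar>" for x y by linarith
  ultimately show "(\<lambda>x. max (u x) 0) \<in> W" "E (\<lambda>x. max (u x) 0) \<le> E u" by simp_all
  note W_contraction[OF u, of "\<lambda>x. min (u x) 0"]
  moreover have "(\<lambda>x. min (u x) 0) \<in> borel_measurable lebesgue" by measurable
  moreover have "\<bar>min (u x) 0 - min (u y) 0\<bar> \<le> \<bar>u x - u y\<bar>" for x y by linarith
  ultimately show "(\<lambda>x. min (u x) 0) \<in> W" "E (\<lambda>x. min (u x) 0) \<le> E u" by simp_all
  note W_contraction[OF u, of "\<lambda>x. \<bar>u x\<bar>"]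
  moreover have "(\<lambda>x. \<bar>u x\<bar>) \<in> borel_measurable lebesgue" by measurable
  moreover have "\<bar>\<bar>u x\<bar> - \<bar>u y\<bar>\<bar> \<le> \<bar>u x - u y\<bar>" for x y by linarith
  ultimately show "(\<lambda>x. \<bar>u x\<bar>) \<in> W" "E (\<lambda>x. \<bar>u x\<bar>) \<le> E u" by simp_all
qed

lemma E_scale: "u \<in> W \<Longrightarrow> E (\<lambda>x. c * u x) = \<bar>c\<bar> powr p * E u"
  and H_scale: "u \<in> W \<Longrightarrow> H (\<lambda>x. c * u x) = \<bar>c\<bar> powr p * H u"
  and R_scale: "u \<in> W \<Longrightarrow> R (\<lambda>x. c * u x) = \<bar>c\<bar> powr r * R u"
  using Lp_scale(2)[OF W_incr_Lp, of u c] incr_add[of c u 0 u]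
    Lp_scale(2)[OF W_hmeas_Lp, of u c] Lp_scale(2)[OF W_r, of u c]
  by (simp_all add: E_def H_def R_def)

lemma A_scale: "u \<in> W \<Longrightarrow> A (\<lambda>x. c * u x) = \<bar>c\<bar> powr p * A u"
  by (simp add: A_def E_scale H_scale algebra_simps)

lemma R_eq_0_iff: "u \<in> W \<Longrightarrow> R u = 0 \<longleftrightarrow> (AE x in lebesgue. u x = 0)"
  unfolding R_def by (rule Lp_pow_eq_0_iff[OF W_r])

lemma E_eq_0: 
  assumes u: "u \<in> W" and "E u = 0"
  shows "AE x in lebesgue. u x = 0"
proof -
  have "Lp_pow lebesgue q u \<le> (0 / sobolev_const DIM('a) s p) powr (q / p)"
    using W_q_bound[OF u, of 0] assms by simp
  then have "Lp_pow lebesgue q u = 0" using Lp_pow_nonneg[of lebesgue q u] by simp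
  then show ?thesis using Lp_pow_eq_0_iff[OF W_q[OF u]] by simp
qed

text \<open>
  After scaling to \<open>E u = 1\<close> the bound is the one on a bounded set with \<open>\<bar>u\<bar>\<^sup>r \<le> 1 + \<bar>u\<bar>\<^sup>q\<close>; homogeneity
  restores the general case.
\<close>
lemma R_le: "\<exists>C>0. \<forall>u\<in>W. R u \<le> C * E u powr (r / p)"
proof -
  define C where "C = measure lebesgue (cball (0::'a) rad)
    + (1 / sobolev_const DIM('a) s p) powr (q / p)"
  have S: "0 < sobolev_const DIM('a) s p" by (rule sobolev_const_pos)
  then have C: "0 < C" unfolding C_def by (intro add_nonneg_pos) auto
  show ?thesis
  proof (intro exI[of _ C] conjI ballI C)
    fix u assume u: "u \<in> W"
    show "R u \<le> C * E u powr (r / p)"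
    proof (cases "E u = 0")
      case True
      then have "R u = 0" using E_eq_0[OF u] R_eq_0_iff[OF u] by blast
      then show ?thesis using C by simp
    next
      case False
      then have E: "0 < E u" using E_nonneg[of u] by linarith
      \<comment> \<open>The factor that scales \<open>u\<close> to \<open>E = 1\<close>.\<close>
      define c where "c = E u powr (- (1 / p))"
      have c: "0 < c" using E by (simp add: c_def)
      have cp: "c powr p * E u = 1" using E p0 by (simp add: c_def powr_powr powr_neg_one)
      have w: "(\<lambda>x. c * u x) \<in> W" using u by (rule W_scale)
      have "E (\<lambda>x. c * u x) \<le> 1" using E_scale[OF u, of c] c cp by simp
      from W_q_bound[OF w this]
      have "R (\<lambda>x. c * u x) \<le> C"
        unfolding R_def C_def
        using Lp_finite_measure_mono(2)[OF W_q[OF w] r(2) less_imp_le[OF q(1)] W_off_rad[OF w]] by linarith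
      then have "c powr r * R u \<le> C" using R_scale[OF u, of c] c by simp
      then have "E u powr (r / p) * (c powr r * R u) \<le> E u powr (r / p) * C"
        by (rule mult_left_mono) simp
      moreover have one: "E u powr (r / p) * c powr r = 1"
        using E p0 by (simp add: c_def powr_powr powr_add[symmetric])
      ultimately show ?thesis unfolding mult.assoc[symmetric] one by (simp add: mult.commute)
    qed
  qed
qed

lemma energy_eq_J:
  assumes u: "u \<in> W"
  shows "energy s p r \<Lambda> \<mu> \<Omega> u = J u"
proof -
  have [measurable]: "u \<in> borel_measurable lebesgue" using u by (rule W_meas)
  have [measurable]: "\<Omega> \<in> sets lebesgue" using \<Omega>_open by simp
  have 1: "(LINT x:\<Omega>|lebesgue. \<bar>u x\<bar> powr r) = R u"
    unfolding R_def Lp_pow_def set_lebesgue_integral_def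
  proof (rule integral_cong_AE)
    show "AE x in lebesgue. indicator \<Omega> x *\<^sub>R \<bar>u x\<bar> powr r = \<bar>u x\<bar> powr r"
      using W_off[OF u] by eventually_elim (auto split: split_indicator)
  qed measurable
  have "H u = (LINT x|lebesgue. (1 / norm x powr (p * s)) *\<^sub>R (\<bar>u x\<bar> powr p))"
    unfolding H_def Lp_pow_def hmeas_def by (rule integral_density) auto
  also have "\<dots> = (LINT x:\<Omega>|lebesgue. \<bar>u x\<bar> powr p / norm x powr (p * s))"
    unfolding set_lebesgue_integral_def
  proof (rule integral_cong_AE)
    show "(\<lambda>x. (1 / norm x powr (p * s)) *\<^sub>R (\<bar>u x\<bar> powr p)) \<in> borel_measurable lebesgue"
      by measurable
    have "(\<lambda>x. indicator \<Omega> x *\<^sub>R (\<bar>u x\<bar> powr p * (1 / norm x powr (p * s)))) \<in> borel_measurable lebesgue"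
      by measurable
    then show "(\<lambda>x. indicator \<Omega> x *\<^sub>R (\<bar>u x\<bar> powr p / norm x powr (p * s))) \<in> borel_measurable lebesgue"
      by simp
  qed (use W_off[OF u] in eventually_elim, auto split: split_indicator)
  finally have 2: "H u = (LINT x:\<Omega>|lebesgue. \<bar>u x\<bar> powr p / norm x powr (p * s))" .
  show ?thesis
    unfolding energy_def 1 2[symmetric] enn2real_gagliardo_pow[OF u] J_def A_def
    using p0 by (simp add: field_simps)
qed

end

section \<open>Differentiability of the energy and compactness in the solution space\<close>

context hardy_problem
begin

lemma incr_line: "incr (\<lambda>x. u x + t * v x) = (\<lambda>z. incr u z + t * incr v z)"
  using incr_add[of 1 u t v] by simp

lemma int_gag: "u \<in> W \<Longrightarrow> v \<in> W \<Longrightarrow> integrable gmeas (\<lambda>z. dpow p (incr u z) * incr v z)"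
  and int_h: "u \<in> W \<Longrightarrow> v \<in> W \<Longrightarrow> integrable hmeas (\<lambda>x. dpow p (u x) * v x)"
  and int_r: "u \<in> W \<Longrightarrow> v \<in> W \<Longrightarrow> integrable lebesgue (\<lambda>x. dpow r (u x) * v x)"
  by (auto intro!: integrable_dpow_times W_incr_Lp W_hmeas_Lp W_r p r(1))

lemma dA_lin:
  assumes "u \<in> W" "v \<in> W" "w \<in> W"
  shows "dA u (\<lambda>x. a * v x + b * w x) = a * dA u v + b * dA u w"
proof -
  have 1: "(LINT z|gmeas. dpow p (incr u z) * (a * incr v z + b * incr w z))
      = a * (LINT z|gmeas. dpow p (incr u z) * incr v z) + b * (LINT z|gmeas. dpow p (incr u z) * incr w z)"
    using int_gag[OF assms(1,2)] int_gag[OF assms(1,3)]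
    by (simp add: distrib_left mult.left_commute[of _ a] mult.left_commute[of _ b])
  have 2: "(LINT x|hmeas. dpow p (u x) * (a * v x + b * w x))
      = a * (LINT x|hmeas. dpow p (u x) * v x) + b * (LINT x|hmeas. dpow p (u x) * w x)"
    using int_h[OF assms(1,2)] int_h[OF assms(1,3)]
    by (simp add: distrib_left mult.left_commute[of _ a] mult.left_commute[of _ b])
  show ?thesis unfolding dA_def incr_add 1 2 by (simp add: algebra_simps)
qed

lemma dR_lin:
  assumes "u \<in> W" "v \<in> W" "w \<in> W"
  shows "dR u (\<lambda>x. a * v x + b * w x) = a * dR u v + b * dR u w"
  unfolding dR_def using int_r[OF assms(1,2)] int_r[OF assms(1,3)]
  by (simp add: distrib_left mult.left_commute[of _ a] mult.left_commute[of _ b])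

lemma dJ_lin:
  assumes "u \<in> W" "v \<in> W" "w \<in> W"
  shows "dJ u (\<lambda>x. a * v x + b * w x) = a * dJ u v + b * dJ u w"
  unfolding dJ_def dA_lin[OF assms] dR_lin[OF assms] by (simp add: algebra_simps)

lemma dJ_scale: "u \<in> W \<Longrightarrow> v \<in> W \<Longrightarrow> dJ u (\<lambda>x. a * v x) = a * dJ u v"
  using dJ_lin[of u v v a 0] by simp

lemma dA_self: "dA u u = A u" and dR_self: "dR u u = R u"
  by (simp_all add: dA_def dR_def A_def E_def H_def R_def Lp_pow_def)

lemma dJ_self: "dJ u u = A u - \<Lambda> * R u"
  by (simp add: dJ_def dA_self dR_self)

lemma A_has_derivative:
  assumes u: "u \<in> W" and v: "v \<in> W"
  shows "((\<lambda>t. A (\<lambda>x. u x + t * v x)) has_real_derivative p * dA (\<lambda>x. u x + t * v x) v) (at t)"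
proof -
  have "((\<lambda>t. Lp_pow gmeas p (\<lambda>z. incr u z + t * incr v z) - \<mu> * Lp_pow hmeas p (\<lambda>x. u x + t * v x))
      has_real_derivative p * (LINT z|gmeas. dpow p (incr u z + t * incr v z) * incr v z)
        - \<mu> * (p * (LINT x|hmeas. dpow p (u x + t * v x) * v x))) (at t)"
    by (intro DERIV_diff DERIV_cmult Lp_pow_has_derivative W_incr_Lp W_hmeas_Lp u v p)
  then show ?thesis unfolding A_def E_def H_def dA_def incr_line by (simp add: algebra_simps)
qed

lemma R_has_derivative:
  assumes u: "u \<in> W" and v: "v \<in> W"
  shows "((\<lambda>t. R (\<lambda>x. u x + t * v x)) has_real_derivative r * dR (\<lambda>x. u x + t * v x) v) (at t)"
  unfolding R_def dR_def by (intro Lp_pow_has_derivative W_r u v r)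

lemma J_has_derivative:
  assumes u: "u \<in> W" and v: "v \<in> W"
  shows "((\<lambda>t. J (\<lambda>x. u x + t * v x)) has_real_derivative dJ (\<lambda>x. u x + t * v x) v) (at t)"
proof -
  have "((\<lambda>t. A (\<lambda>x. u x + t * v x) / p - \<Lambda> / r * R (\<lambda>x. u x + t * v x))
      has_real_derivative (p * dA (\<lambda>x. u x + t * v x) v) / p - \<Lambda> / r * (r * dR (\<lambda>x. u x + t * v x) v)) (at t)"
    by (intro DERIV_diff DERIV_cmult DERIV_cdivide A_has_derivative R_has_derivative u v)
  then show ?thesis unfolding J_def dJ_def using p0 r by simp
qed

text \<open>
  Each of the three integrals is differentiable in its own \<open>L\<^sup>p\<close> space, and the Hardy and Sobolev
  inequalities bound the norms of the other two spaces by the Gagliardo seminorm.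
\<close>
lemma J_frechet:
  assumes u: "u \<in> W" and \<epsilon>: "0 < \<epsilon>"
  shows "\<exists>\<delta>>0. \<forall>v\<in>W. W0_norm s p v < \<delta> \<longrightarrow>
    \<bar>J (\<lambda>x. u x + v x) - J u - dJ u v\<bar> \<le> \<epsilon> * W0_norm s p v"
proof -
  obtain CH where CH: "0 < CH" "\<forall>u\<in>W. H u \<le> CH * E u" using H_le by blast
  obtain CR where CR: "0 < CR" "\<forall>u\<in>W. R u \<le> CR * E u powr (r / p)" using R_le by blast
  define ch where "ch = CH powr (1 / p)"
  define cr where "cr = CR powr (1 / r)"
  have ch: "0 < ch" and cr: "0 < cr" using CH CR by (simp_all add: ch_def cr_def)
  define \<epsilon>1 where "\<epsilon>1 = \<epsilon> * p / 3"
  define \<epsilon>2 where "\<epsilon>2 = \<epsilon> * p / (3 * \<mu> * ch)"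
  define \<epsilon>3 where "\<epsilon>3 = \<epsilon> * r / (3 * \<Lambda> * cr)"
  have eps: "0 < \<epsilon>1" "0 < \<epsilon>2" "0 < \<epsilon>3"
    using \<epsilon> p0 r \<mu> \<Lambda> ch cr by (simp_all add: \<epsilon>1_def \<epsilon>2_def \<epsilon>3_def)
  obtain \<delta>1 where \<delta>1: "0 < \<delta>1" "\<And>V. V \<in> Lp gmeas p \<Longrightarrow> Lp_pow gmeas p V \<le> \<delta>1 \<Longrightarrow>
       \<bar>Lp_pow gmeas p (\<lambda>x. incr u x + V x) - Lp_pow gmeas p (incr u) - p * (LINT x|gmeas. dpow p (incr u x) * V x)\<bar>
         \<le> \<epsilon>1 * Lp_pow gmeas p V powr (1 / p)"
    by (rule Lp_pow_frechet[OF W_incr_Lp[OF u] p eps(1)]) blast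
  obtain \<delta>2 where \<delta>2: "0 < \<delta>2" "\<And>V. V \<in> Lp hmeas p \<Longrightarrow> Lp_pow hmeas p V \<le> \<delta>2 \<Longrightarrow>
       \<bar>Lp_pow hmeas p (\<lambda>x. u x + V x) - Lp_pow hmeas p u - p * (LINT x|hmeas. dpow p (u x) * V x)\<bar>
         \<le> \<epsilon>2 * Lp_pow hmeas p V powr (1 / p)"
    by (rule Lp_pow_frechet[OF W_hmeas_Lp[OF u] p eps(2)]) blast
  obtain \<delta>3 where \<delta>3: "0 < \<delta>3" "\<And>V. V \<in> Lp lebesgue r \<Longrightarrow> Lp_pow lebesgue r V \<le> \<delta>3 \<Longrightarrow>
       \<bar>Lp_pow lebesgue r (\<lambda>x. u x + V x) - Lp_pow lebesgue r u - r * (LINT x|lebesgue. dpow r (u x) * V x)\<bar>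
         \<le> \<epsilon>3 * Lp_pow lebesgue r V powr (1 / r)"
    by (rule Lp_pow_frechet[OF W_r[OF u] r(1) eps(3)]) blast
  define \<delta> where "\<delta> = min (\<delta>1 powr (1 / p)) (min (\<delta>2 powr (1 / p) / ch) (\<delta>3 powr (1 / r) / cr))"
  have \<delta>: "0 < \<delta>" using \<delta>1 \<delta>2 \<delta>3 ch cr by (simp add: \<delta>_def)
  show ?thesis
  proof (intro exI[of _ \<delta>] conjI ballI impI \<delta>)
    fix v assume v: "v \<in> W" and small: "W0_norm s p v < \<delta>"
    define n where "n = W0_norm s p v"
    have n: "n = E v powr (1 / p)" "0 \<le> n" using W0_norm_eq[OF v] by (simp_all add: n_def)
    have En: "E v = n powr p" using p0 by (simp add: n powr_powr)
    have small': "n \<le> \<delta>1 powr (1 / p)" "ch * n \<le> \<delta>2 powr (1 / p)" "cr * n \<le> \<delta>3 powr (1 / r)"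
      using small ch cr by (simp_all add: n_def[symmetric] \<delta>_def field_simps)
    have root: "a \<le> b" if "0 < k" "0 < b" "0 \<le> t" "t \<le> b powr (1 / k)" "a \<le> t powr k" for a b t k :: real
    proof -
      have "t powr k \<le> (b powr (1 / k)) powr k" using that by (intro powr_mono2) auto
      then show ?thesis using that by (simp add: powr_powr)
    qed
    have Hn: "H v \<le> (ch * n) powr p"
      using bspec[OF CH(2) v] p0 CH(1) n(2) by (simp add: En ch_def powr_mult powr_powr)
    have Rn: "R v \<le> (cr * n) powr r"
      using bspec[OF CR(2) v] p0 r CR(1) n(2) by (simp add: En cr_def powr_mult powr_powr)
    have b1: "E v \<le> \<delta>1" by (rule root[OF p0(1) \<delta>1(1) n(2) small'(1)]) (simp add: En)
    have b2: "H v \<le> \<delta>2" using ch n by (intro root[OF p0(1) \<delta>2(1) _ small'(2) Hn]) simp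
    have b3: "R v \<le> \<delta>3" using cr n by (intro root[OF r(2) \<delta>3(1) _ small'(3) Rn]) simp
    have inc: "incr (\<lambda>x. u x + v x) = (\<lambda>z. incr u z + incr v z)" using incr_line[of u 1 v] by simp
    have root': "a powr (1 / k) \<le> t" if "0 < k" "0 \<le> a" "0 \<le> t" "a \<le> t powr k" for a t k :: real
    proof -
      have "a powr (1 / k) \<le> (t powr k) powr (1 / k)" using that by (intro powr_mono2) auto
      then show ?thesis using that by (simp add: powr_powr)
    qed
    have d1: "\<bar>E (\<lambda>x. u x + v x) - E u - p * (LINT z|gmeas. dpow p (incr u z) * incr v z)\<bar> \<le> \<epsilon>1 * n"
      using \<delta>1(2)[OF W_incr_Lp[OF v]] b1 unfolding E_def[symmetric] inc[symmetric] n(1) by simp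
    have "\<bar>H (\<lambda>x. u x + v x) - H u - p * (LINT x|hmeas. dpow p (u x) * v x)\<bar> \<le> \<epsilon>2 * H v powr (1 / p)"
      using \<delta>2(2)[OF W_hmeas_Lp[OF v]] b2 unfolding H_def[symmetric] by simp
    also have "\<dots> \<le> \<epsilon>2 * (ch * n)"
      using eps ch n by (intro mult_left_mono root'[OF p0(1) _ _ Hn]) auto
    finally have d2: "\<bar>H (\<lambda>x. u x + v x) - H u - p * (LINT x|hmeas. dpow p (u x) * v x)\<bar> \<le> \<epsilon>2 * (ch * n)" .
    have "\<bar>R (\<lambda>x. u x + v x) - R u - r * dR u v\<bar> \<le> \<epsilon>3 * R v powr (1 / r)"
      using \<delta>3(2)[OF W_r[OF v]] b3 unfolding R_def[symmetric] dR_def by simp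
    also have "\<dots> \<le> \<epsilon>3 * (cr * n)"
      using eps cr n by (intro mult_left_mono root'[OF r(2) _ _ Rn]) auto
    finally have d3: "\<bar>R (\<lambda>x. u x + v x) - R u - r * dR u v\<bar> \<le> \<epsilon>3 * (cr * n)" .
    define d where "d = \<epsilon> * n / 3"
    define D1 where "D1 = E (\<lambda>x. u x + v x) - E u - p * (LINT z|gmeas. dpow p (incr u z) * incr v z)"
    define D2 where "D2 = H (\<lambda>x. u x + v x) - H u - p * (LINT x|hmeas. dpow p (u x) * v x)"
    define D3 where "D3 = R (\<lambda>x. u x + v x) - R u - r * dR u v"
    have e1: "\<bar>D1 / p\<bar> \<le> d" using d1 p0 unfolding D1_def[symmetric] d_def \<epsilon>1_def by (simp add: field_simps)
    have e2: "\<bar>\<mu> / p * D2\<bar> \<le> d"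
    proof -
      have "\<mu> / p * \<bar>D2\<bar> \<le> \<mu> / p * (\<epsilon>2 * (ch * n))"
        using d2 p0 \<mu> unfolding D2_def[symmetric] by (intro mult_left_mono) auto
      also have "\<dots> = d" using p0 \<mu> ch by (simp add: d_def \<epsilon>2_def)
      finally show ?thesis using p0 \<mu> by (simp add: abs_mult)
    qed
    have e3: "\<bar>\<Lambda> / r * D3\<bar> \<le> d"
    proof -
      have "\<Lambda> / r * \<bar>D3\<bar> \<le> \<Lambda> / r * (\<epsilon>3 * (cr * n))"
        using d3 r \<Lambda> unfolding D3_def[symmetric] by (intro mult_left_mono) auto
      also have "\<dots> = d" using r \<Lambda> cr by (simp add: d_def \<epsilon>3_def)
      finally show ?thesis using r \<Lambda> by (simp add: abs_mult)
    qed
    have "J (\<lambda>x. u x + v x) - J u - dJ u v = D1 / p - \<mu> / p * D2 - \<Lambda> / r * D3"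
      unfolding J_def A_def dJ_def dA_def D1_def D2_def D3_def using p0 r by (simp add: field_simps)
    then have "\<bar>J (\<lambda>x. u x + v x) - J u - dJ u v\<bar> \<le> d + d + d" using e1 e2 e3 by linarith
    then show "\<bar>J (\<lambda>x. u x + v x) - J u - dJ u v\<bar> \<le> \<epsilon> * W0_norm s p v"
      by (simp add: d_def n_def)
  qed
qed

text \<open>
  Replaces the Frechet condition by the equation tested with functions of the space.
\<close>
theorem weak_solution_iff:
  "weak_solution s p r \<Lambda> \<mu> \<Omega> u \<longleftrightarrow> u \<in> W \<and> (\<forall>v\<in>W. dJ u v = 0)"
proof (cases "u \<in> W")
  case u: True
  have en: "energy s p r \<Lambda> \<mu> \<Omega> (\<lambda>x. u x + v x) - energy s p r \<Lambda> \<mu> \<Omega> u = J (\<lambda>x. u x + v x) - J u"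
    if "v \<in> W" for v
    using that u by (simp add: energy_eq_J W_add)
  show ?thesis
  proof
    assume ws: "weak_solution s p r \<Lambda> \<mu> \<Omega> u"
    have "dJ u v = 0" if v: "v \<in> W" for v
    proof (rule ccontr)
      assume ne: "dJ u v \<noteq> 0"
      define n where "n = W0_norm s p v"
      have n: "0 \<le> n" by (simp add: n_def W0_norm_def)
      define \<epsilon> where "\<epsilon> = \<bar>dJ u v\<bar> / (4 * (n + 1))"
      have \<epsilon>: "0 < \<epsilon>" using ne n by (simp add: \<epsilon>_def)
      obtain \<delta>1 where \<delta>1: "0 < \<delta>1" "\<forall>w\<in>W. W0_norm s p w < \<delta>1 \<longrightarrow>
          \<bar>J (\<lambda>x. u x + w x) - J u\<bar> \<le> \<epsilon> * W0_norm s p w"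
        using ws \<epsilon> en unfolding weak_solution_def critical_point_def by metis
      obtain \<delta>2 where \<delta>2: "0 < \<delta>2" "\<forall>w\<in>W. W0_norm s p w < \<delta>2 \<longrightarrow>
          \<bar>J (\<lambda>x. u x + w x) - J u - dJ u w\<bar> \<le> \<epsilon> * W0_norm s p w"
        using J_frechet[OF u \<epsilon>] by blast
      define t where "t = min \<delta>1 \<delta>2 / (2 * (n + 1))"
      have t: "0 < t" using \<delta>1 \<delta>2 n by (simp add: t_def)
      define w where "w = (\<lambda>x. t * v x)"
      have w: "w \<in> W" unfolding w_def using v by (rule W_scale)
      have nw: "W0_norm s p w = t * n"
        using E_scale[OF v, of t] t p0 unfolding n_def W0_norm_eq[OF w] W0_norm_eq[OF v]
        by (simp add: w_def powr_mult powr_powr)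
      have "t * n \<le> t * (n + 1)" using t by simp
      also have "\<dots> = min \<delta>1 \<delta>2 / 2" using n by (simp add: t_def field_simps)
      also have "\<dots> < min \<delta>1 \<delta>2" using \<delta>1(1) \<delta>2(1) by linarith
      finally have "t * n < min \<delta>1 \<delta>2" .
      then have small: "W0_norm s p w < \<delta>1" "W0_norm s p w < \<delta>2" by (simp_all add: nw)
      have "\<bar>dJ u w\<bar> \<le> 2 * (\<epsilon> * (t * n))"
        using bspec[OF \<delta>1(2) w] bspec[OF \<delta>2(2) w] small unfolding nw by linarith
      then have "t * \<bar>dJ u v\<bar> \<le> t * (2 * (\<epsilon> * n))"
        using dJ_scale[OF u v, of t] t by (simp add: w_def abs_mult mult_ac)
      then have "\<bar>dJ u v\<bar> \<le> 2 * (\<epsilon> * n)" using t by simp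
      also have "\<dots> \<le> 2 * (\<epsilon> * (n + 1))" using \<epsilon> by simp
      also have "\<dots> = \<bar>dJ u v\<bar> / 2" using n by (simp add: \<epsilon>_def field_simps)
      finally show False using ne by simp
    qed
    then show "u \<in> W \<and> (\<forall>v\<in>W. dJ u v = 0)" using u by blast
  next
    assume "u \<in> W \<and> (\<forall>v\<in>W. dJ u v = 0)"
    then have z: "\<And>v. v \<in> W \<Longrightarrow> dJ u v = 0" by blast
    show "weak_solution s p r \<Lambda> \<mu> \<Omega> u"
      unfolding weak_solution_def critical_point_def
    proof (intro conjI allI impI u)
      fix \<epsilon> :: real assume "0 < \<epsilon>"
      then obtain \<delta> where \<delta>: "0 < \<delta>" "\<forall>w\<in>W. W0_norm s p w < \<delta> \<longrightarrow>
          \<bar>J (\<lambda>x. u x + w x) - J u - dJ u w\<bar> \<le> \<epsilon> * W0_norm s p w"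
        using J_frechet[OF u] by blast
      show "\<exists>\<delta>>0. \<forall>v\<in>W. W0_norm s p v < \<delta> \<longrightarrow>
        \<bar>energy s p r \<Lambda> \<mu> \<Omega> (\<lambda>x. u x + v x) - energy s p r \<Lambda> \<mu> \<Omega> u\<bar> \<le> \<epsilon> * W0_norm s p v"
        using \<delta> z en by (intro exI[of _ \<delta>]) simp
    qed
  qed
next
  case False
  then show ?thesis by (simp add: weak_solution_def critical_point_def)
qed

text \<open>
  Passing to Borel representatives makes the result for Borel functions available; the limit is set to
  zero outside \<open>\<Omega>\<close>, and its seminorm is finite by Fatou.
\<close>
lemma W_compact:
  assumes u: "\<And>n. u n \<in> W" and G: "\<And>n. E (u n) \<le> G"
  obtains \<rho> :: "nat \<Rightarrow> nat" and v where "strict_mono \<rho>" "v \<in> W" "AE x in lebesgue. (\<lambda>n. u (\<rho> n) x) \<longlonglongrightarrow> v x"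
proof -
  have G0: "0 \<le> G" using G[of 0] E_nonneg[of "u 0"] by linarith
  have "\<forall>n. \<exists>g\<in>borel_measurable lborel. AE x in lborel. u n x = g x"
    using completion_ex_borel_measurable_real[OF W_meas[OF u]] by blast
  then obtain g where g: "\<And>n. g n \<in> borel_measurable lborel" "\<And>n. AE x in lborel. u n x = g n x"
    by metis
  have gm: "g n \<in> borel_measurable borel" for n using g(1)[of n] by simp
  have ae: "AE x in lebesgue. u n x = g n x" for n using g(2)[of n] by (simp add: AE_completion_iff)
  have gl: "g n \<in> borel_measurable lebesgue" for n using g(1) by (rule measurable_completion)
  have gi: "integrable lborel (g n)" for n
  proof -
    have "integrable lebesgue (g n)"
      using W_integrable[OF u[of n]] integrable_cong_AE[OF W_meas[OF u[of n]] gl ae] by blast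
    then show ?thesis using integrable_completion[of "g n" lborel] g(1) by blast
  qed
  define S where "S = (G / sobolev_const DIM('a) s p) powr (q / p)"
  have gC: "(LINT x|lborel. \<bar>g n x\<bar>) \<le> measure lebesgue (cball (0::'a) rad) + S" for n
  proof -
    have "(LINT x|lborel. \<bar>g n x\<bar>) = (LINT x|lebesgue. \<bar>g n x\<bar>)"
      by (rule integral_completion[symmetric]) (use g(1)[of n] in measurable)
    also have "\<dots> = Lp_pow lebesgue 1 (u n)"
      unfolding Lp_pow_one
    proof (rule integral_cong_AE)
      show "AE x in lebesgue. \<bar>g n x\<bar> = \<bar>u n x\<bar>" using ae[of n] by eventually_elim simp
    qed (use gl[of n] W_meas[OF u[of n]] in measurable)
    also have "\<dots> \<le> measure lebesgue (cball (0::'a) rad) + Lp_pow lebesgue q (u n)"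
      by (rule Lp_finite_measure_mono(2)[OF W_q[OF u] zero_less_one less_imp_le[OF q(2)] W_off_rad[OF u]])
    also have "Lp_pow lebesgue q (u n) \<le> S" unfolding S_def by (rule W_q_bound[OF u G])
    finally show ?thesis by simp
  qed
  have gG: "gagliardo_pow s p (g n) \<le> ennreal G" for n
    using gagliardo_pow_cong_AE[OF ae[of n]] gagliardo_pow_eq_E[OF u[of n]] G[of n]
    by (metis ennreal_leI)
  obtain \<rho> :: "nat \<Rightarrow> nat" where \<rho>: "strict_mono \<rho>"
    and conv: "AE x in lborel. x \<in> cball 0 rad \<longrightarrow> convergent (\<lambda>n. g (\<rho> n) x)"
    by (rule gagliardo_bounded_AE_convergent_subsequence[OF gm gi gC s(1) p gG G0])
  define v where "v = (\<lambda>x. lim (\<lambda>n. indicator \<Omega> x * u (\<rho> n) x))"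
  have [measurable]: "\<Omega> \<in> sets lebesgue" using \<Omega>_open by simp
  have [measurable]: "u n \<in> borel_measurable lebesgue" for n using W_meas[OF u] .
  have vm: "v \<in> borel_measurable lebesgue" unfolding v_def by measurable
  have "AE x in lebesgue. \<forall>n. u n x = g n x" using ae by (simp add: AE_all_countable)
  moreover have "AE x in lebesgue. x \<in> cball 0 rad \<longrightarrow> convergent (\<lambda>n. g (\<rho> n) x)"
    using conv by (simp add: AE_completion_iff)
  moreover have "AE x in lebesgue. \<forall>n. x \<notin> \<Omega> \<longrightarrow> u n x = 0"
    unfolding AE_all_countable using W_off[OF u] by blast
  ultimately have lim: "AE x in lebesgue. (\<lambda>n. u (\<rho> n) x) \<longlonglongrightarrow> v x"
  proof eventually_elim
    case (elim x)
    show ?case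
    proof (cases "x \<in> \<Omega>")
      case True
      then have "x \<in> cball 0 rad" using \<Omega>_rad by blast
      then have "convergent (\<lambda>n. u (\<rho> n) x)" using elim by simp
      then show ?thesis using True by (simp add: v_def convergent_LIMSEQ_iff)
    next
      case False
      then have "(\<lambda>n. u (\<rho> n) x) = (\<lambda>n. 0)" using elim by simp
      moreover have "v x = 0" using False by (simp add: v_def lim_const)
      ultimately show ?thesis by simp
    qed
  qed
  have voff: "AE x in lebesgue. x \<notin> \<Omega> \<longrightarrow> v x = 0" by (rule AE_I2) (simp add: v_def lim_const)
  have "gagliardo_pow s p v \<le> ennreal G"
    unfolding gagliardo_pow_eq[OF vm]
  proof (rule nn_integral_le_of_AE_limit[where f = "\<lambda>n z. \<bar>incr (u (\<rho> n)) z\<bar> powr p"])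
    show "(\<lambda>z. \<bar>incr (u (\<rho> n)) z\<bar> powr p) \<in> borel_measurable gmeas" for n
      using incr_measurable_gag[OF W_meas[OF u[of "\<rho> n"]]] by measurable
    show "AE z in gmeas. (\<lambda>n. \<bar>incr (u (\<rho> n)) z\<bar> powr p) \<longlonglongrightarrow> \<bar>incr v z\<bar> powr p"
    proof (rule powr_conv_AE[OF p0(1)], rule AE_gag_measureI)
      show "AE z in lebesgue. (\<lambda>n. incr (u (\<rho> n)) z) \<longlonglongrightarrow> incr v z"
        using AE_lebesgue_fst_snd[OF lim] by eventually_elim (auto simp: incr_def intro!: tendsto_diff)
    qed
    show "(\<integral>\<^sup>+z. ennreal (\<bar>incr (u (\<rho> n)) z\<bar> powr p) \<partial>gmeas) \<le> ennreal G" for n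
      using gagliardo_pow_eq[OF W_meas[OF u[of "\<rho> n"]]] gagliardo_pow_eq_E[OF u[of "\<rho> n"]] G[of "\<rho> n"]
      by (metis ennreal_leI)
  qed
  from le_less_trans[OF this ennreal_less_top] have "gagliardo_pow s p v < \<infinity>" by simp
  then have "v \<in> W" using vm voff unfolding W_iff by blast
  with \<rho> show ?thesis using lim by (rule that)
qed

end

section \<open>Lower semicontinuity and the Nehari set\<close>

text \<open>
  The function \<open>t\<^sup>p / p - t\<^sup>r / r\<close> has its maximum at \<open>t = 1\<close>; this is Young's inequality for \<open>t\<^sup>r\<close> and \<open>1\<close>.
\<close>
lemma powr_fibre_le:
  fixes t p r :: real
  assumes "0 \<le> t" "0 < p" "p < r"
  shows "t powr p / p - t powr r / r \<le> 1 / p - 1 / r"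
proof (cases "t = 0")
  case False
  have "(t powr r) powr (p / r) * 1 powr (1 - p / r) \<le> p / r * t powr r + (1 - p / r) * 1"
    using assms False by (intro Youngs_inequality_0) auto
  then have "t powr p \<le> p / r * t powr r + (1 - p / r)" using assms by (simp add: powr_powr)
  then have "t powr p / p \<le> (p / r * t powr r + (1 - p / r)) / p"
    using assms by (intro divide_right_mono) auto
  also have "\<dots> = t powr r / r + (1 / p - 1 / r)" using assms by (simp add: field_simps)
  finally show ?thesis by simp
qed (use assms in \<open>simp add: field_simps\<close>)

context hardy_problem
begin

text \<open>
  The differences tend to zero in \<open>L\<^sup>r\<close> since they are bounded in \<open>L\<^sup>q\<close> for \<open>q > r\<close>; the Brezis-Lieb
  lemma turns this into convergence of the integrals.
\<close>
lemma R_tendsto: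
  assumes u: "\<And>n. u n \<in> W" and G: "\<And>n. E (u n) \<le> G" and v: "v \<in> W"
    and lim: "AE x in lebesgue. (\<lambda>n. u n x) \<longlonglongrightarrow> v x"
  shows "(\<lambda>n. R (u n)) \<longlonglongrightarrow> R v"
proof -
  have d: "(\<lambda>x. u n x - v x) \<in> W" for n by (rule W_diff[OF u v])
  define S where "S = (G / sobolev_const DIM('a) s p) powr (q / p)"
  have B: "Lp_pow lebesgue q (\<lambda>x. u n x - v x) \<le> 2 powr q * (S + Lp_pow lebesgue q v)" for n
  proof -
    have "Lp_pow lebesgue q (\<lambda>x. u n x - v x) \<le> 2 powr q * (Lp_pow lebesgue q (u n) + Lp_pow lebesgue q v)"
      using q by (intro Lp_diff(2) W_q u v) auto
    also have "\<dots> \<le> 2 powr q * (S + Lp_pow lebesgue q v)"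
      unfolding S_def by (intro mult_left_mono add_right_mono W_q_bound[OF u G]) auto
    finally show ?thesis .
  qed
  have "AE x in lebesgue. (\<lambda>n. u n x - v x) \<longlonglongrightarrow> 0"
    using lim by eventually_elim (simp add: LIM_zero_iff)
  then have 1: "(\<lambda>n. R (\<lambda>x. u n x - v x)) \<longlonglongrightarrow> 0"
    unfolding R_def by (intro Lp_pow_tendsto_0[OF W_q[OF d] B r(2) q(1) W_off_rad[OF d]])
  obtain CR where CR: "0 < CR" "\<forall>u\<in>W. R u \<le> CR * E u powr (r / p)" using R_le by blast
  have RB: "Lp_pow lebesgue r (u n) \<le> CR * G powr (r / p)" for n
  proof -
    have "CR * E (u n) powr (r / p) \<le> CR * G powr (r / p)"
      using G[of n] CR(1) r p0 by (intro mult_left_mono powr_mono2) auto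
    then show ?thesis using bspec[OF CR(2) u[of n]] unfolding R_def by linarith
  qed
  have "(\<lambda>n. R (u n) - R (\<lambda>x. u n x - v x)) \<longlonglongrightarrow> R v"
    unfolding R_def by (rule brezis_lieb(2)[OF W_r[OF u] r(1) RB W_meas[OF v] lim])
  from tendsto_add[OF this 1] show ?thesis by simp
qed

text \<open>
  The Hardy term is not continuous along the sequence, but by the Brezis-Lieb lemma the defect
  of \<open>A\<close> in the limit is \<open>A (u\<^sub>n - v)\<close>, which the Hardy inequality makes nonnegative.
\<close>
lemma J_lower_semicontinuous:
  assumes u: "\<And>n. u n \<in> W" and G: "\<And>n. E (u n) \<le> G" and v: "v \<in> W"
    and lim: "AE x in lebesgue. (\<lambda>n. u n x) \<longlonglongrightarrow> v x"
    and c: "\<And>n. J (u n) \<le> c n" "c \<longlonglongrightarrow> c0"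
  shows "J v \<le> c0"
proof -
  have d: "(\<lambda>x. u n x - v x) \<in> W" for n by (rule W_diff[OF u v])
  have incd: "incr (\<lambda>x. u n x - v x) = (\<lambda>z. incr (u n) z - incr v z)" for n
    by (auto simp: incr_def)
  have lim_incr: "AE z in gmeas. (\<lambda>n. incr (u n) z) \<longlonglongrightarrow> incr v z"
    by (rule AE_gag_measureI)
       (use AE_lebesgue_fst_snd[OF lim] in eventually_elim, auto simp: incr_def intro!: tendsto_diff)
  have 1: "(\<lambda>n. E (u n) - E (\<lambda>x. u n x - v x)) \<longlonglongrightarrow> E v"
    unfolding E_def incd
    by (rule brezis_lieb(2)[OF W_incr_Lp[OF u] p _ incr_measurable_gag[OF W_meas[OF v]] lim_incr])
       (use G in \<open>simp add: E_def\<close>)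
  obtain CH where CH: "0 < CH" "\<forall>u\<in>W. H u \<le> CH * E u" using H_le by blast
  have HB: "Lp_pow hmeas p (u n) \<le> CH * G" for n
    using bspec[OF CH(2) u[of n]] mult_left_mono[OF G[of n], of CH] CH(1) unfolding H_def by linarith
  have 2: "(\<lambda>n. H (u n) - H (\<lambda>x. u n x - v x)) \<longlonglongrightarrow> H v"
    unfolding H_def
    by (rule brezis_lieb(2)[OF W_hmeas_Lp[OF u] p HB hmeas_measurable[OF W_meas[OF v]] AE_hmeasI[OF lim]])
  have "(\<lambda>n. (E (u n) - E (\<lambda>x. u n x - v x)) - \<mu> * (H (u n) - H (\<lambda>x. u n x - v x))) \<longlonglongrightarrow> E v - \<mu> * H v"
    by (intro tendsto_intros 1 2)
  then have 3: "(\<lambda>n. A (u n) - A (\<lambda>x. u n x - v x)) \<longlonglongrightarrow> A v"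
    by (simp add: A_def algebra_simps)
  have "(\<lambda>n. (A (u n) - A (\<lambda>x. u n x - v x)) / p - \<Lambda> / r * R (u n)) \<longlonglongrightarrow> A v / p - \<Lambda> / r * R v"
    by (intro tendsto_intros 3 R_tendsto[OF u G v lim] p0)
  then have 4: "(\<lambda>n. (A (u n) - A (\<lambda>x. u n x - v x)) / p - \<Lambda> / r * R (u n)) \<longlonglongrightarrow> J v"
    by (simp add: J_def)
  have "(A (u n) - A (\<lambda>x. u n x - v x)) / p - \<Lambda> / r * R (u n) \<le> c n" for n
  proof -
    have "(A (u n) - A (\<lambda>x. u n x - v x)) / p \<le> A (u n) / p"
      using A_nonneg[OF d[of n]] p0 by (intro divide_right_mono) auto
    then show ?thesis using c(1)[of n] by (simp add: J_def)
  qed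
  then show ?thesis using LIMSEQ_le[OF 4 c(2)] by blast
qed

lemma R_pos_E_pos: "u \<in> W \<Longrightarrow> 0 < R u \<Longrightarrow> 0 < E u"
  using E_eq_0[of u] R_eq_0_iff[of u] E_nonneg[of u] by (metis less_eq_real_def less_irrefl)

lemma R_pos_A_pos:
  assumes "u \<in> W" "0 < R u" shows "0 < A u"
proof -
  obtain \<kappa> where \<kappa>: "0 < \<kappa>" "\<forall>u\<in>W. \<kappa> * E u \<le> A u" using A_coercive by blast
  have "0 < \<kappa> * E u" using \<kappa>(1) R_pos_E_pos[OF assms] by simp
  then show ?thesis using bspec[OF \<kappa>(2) assms(1)] by linarith
qed

text \<open>
  Since \<open>r > p\<close>, the inequality \<open>\<kappa> E \<le> A \<le> \<Lambda> R \<le> \<Lambda> C E\<^sup>r\<^sup>/\<^sup>p\<close> keeps \<open>E\<close>, and with it \<open>R\<close>, away from zero. This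
  prevents minimizing sequences, or their signed parts, from vanishing in the limit.
\<close>
lemma R_lower_bound: "\<exists>c>0. \<forall>u\<in>W. 0 < R u \<longrightarrow> A u \<le> \<Lambda> * R u \<longrightarrow> c \<le> R u"
proof -
  obtain \<kappa> where \<kappa>: "0 < \<kappa>" "\<forall>u\<in>W. \<kappa> * E u \<le> A u" using A_coercive by blast
  obtain C where C: "0 < C" "\<forall>u\<in>W. R u \<le> C * E u powr (r / p)" using R_le by blast
  \<comment> \<open>The value of \<open>E\<close> at which \<open>\<kappa> E = \<Lambda> C E\<^sup>r\<^sup>/\<^sup>p\<close>.\<close>
  define e where "e = (\<kappa> / (\<Lambda> * C)) powr (p / (r - p))"
  have e: "0 < e" using \<kappa> \<Lambda> C by (simp add: e_def)
  show ?thesis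
  proof (intro exI[of _ "\<kappa> * e / \<Lambda>"] conjI ballI impI)
    show "0 < \<kappa> * e / \<Lambda>" using e \<kappa> \<Lambda> by simp
    fix u assume u: "u \<in> W" and R: "0 < R u" and A: "A u \<le> \<Lambda> * R u"
    have E: "0 < E u" by (rule R_pos_E_pos[OF u R])
    have "\<Lambda> * R u \<le> \<Lambda> * (C * E u powr (r / p))"
      using \<Lambda> bspec[OF C(2) u] by (intro mult_left_mono) auto
    then have "\<kappa> * E u \<le> \<Lambda> * C * E u powr (r / p)"
      using bspec[OF \<kappa>(2) u] A by (simp add: mult.assoc)
    also have "E u powr (r / p) = E u powr ((r - p) / p) * E u"
    proof -
      have "r / p = (r - p) / p + 1" using p0 by (simp add: field_simps)
      then have "E u powr (r / p) = E u powr ((r - p) / p + 1)" by simp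
      also have "\<dots> = E u powr ((r - p) / p) * E u" using E by (simp add: powr_add)
      finally show ?thesis .
    qed
    finally have "\<kappa> \<le> \<Lambda> * C * E u powr ((r - p) / p)" using E by (simp add: mult.assoc[symmetric])
    then have "\<kappa> / (\<Lambda> * C) \<le> E u powr ((r - p) / p)" using \<Lambda> C by (simp add: field_simps)
    then have "e \<le> (E u powr ((r - p) / p)) powr (p / (r - p))"
      unfolding e_def using \<kappa> \<Lambda> C p0 pr by (intro powr_mono2) auto
    also have "\<dots> = E u" using E p0 pr by (simp add: powr_powr)
    finally have "\<kappa> * e \<le> \<kappa> * E u" using \<kappa> by simp
    then show "\<kappa> * e / \<Lambda> \<le> R u" using bspec[OF \<kappa>(2) u] A \<Lambda> by (simp add: field_simps)
  qed
qed

lemma J_on_nehari: "A u = \<Lambda> * R u \<Longrightarrow> J u = (1 / p - 1 / r) * (\<Lambda> * R u)"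
  by (simp add: J_def left_diff_distrib)

lemma pr_pos: "0 < 1 / p - 1 / r"
  using p0 r pr by (simp add: field_simps)

lemma nehari_scaling:
  assumes u: "u \<in> W" and R: "0 < R u"
  obtains t where "0 < t" "A (\<lambda>x. t * u x) = \<Lambda> * R (\<lambda>x. t * u x)"
proof
  define t where "t = (A u / (\<Lambda> * R u)) powr (1 / (r - p))"
  have A: "0 < A u" by (rule R_pos_A_pos[OF u R])
  show t: "0 < t" using A \<Lambda> R by (simp add: t_def)
  have "t powr (r - p) = A u / (\<Lambda> * R u)" using A \<Lambda> R pr by (simp add: t_def powr_powr)
  then have "t powr r = t powr p * (A u / (\<Lambda> * R u))" using t by (simp add: powr_diff field_simps)
  then show "A (\<lambda>x. t * u x) = \<Lambda> * R (\<lambda>x. t * u x)"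
    using t \<Lambda> R by (simp add: A_scale[OF u] R_scale[OF u])
qed

lemma nehari_fibre_le:
  assumes u: "u \<in> W" and N: "A u = \<Lambda> * R u" and t: "0 \<le> t"
  shows "J (\<lambda>x. t * u x) \<le> J u"
proof -
  have "J (\<lambda>x. t * u x) = \<Lambda> * R u * (t powr p / p - t powr r / r)"
    using t N by (simp add: J_def A_scale[OF u] R_scale[OF u] algebra_simps)
  also have "\<dots> \<le> \<Lambda> * R u * (1 / p - 1 / r)"
    using \<Lambda> t p0 pr by (intro mult_left_mono powr_fibre_le) auto
  also have "\<dots> = J u" using J_on_nehari[OF N] by simp
  finally show ?thesis .
qed

definition nehari :: "('a \<Rightarrow> real) set" where
  "nehari = {u \<in> W. 0 < R u \<and> A u = \<Lambda> * R u}"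

lemma complement_nonempty:
  assumes "U \<subseteq> \<Omega>"
  shows "- U \<noteq> {}"
proof
  assume "- U = {}"
  then have "U = UNIV" by blast
  then have "bounded (UNIV :: 'a set)" using bounded_subset[OF \<Omega>_bounded assms] by simp
  then show False by simp
qed

text \<open>
  The bumps used here: Lipschitz, positive exactly on \<open>U\<close>.
\<close>
lemma infdist_complement_in_W:
  assumes U: "open U" "U \<subseteq> \<Omega>"
  shows "(\<lambda>x. infdist x (- U)) \<in> W"
proof -
  have ne: "- U \<noteq> {}" by (rule complement_nonempty[OF U(2)])
  then obtain a where a: "a \<in> - U" by blast
  define M where "M = rad + norm a"
  have off: "infdist x (- U) = 0" if "x \<notin> U" for x using that by simp
  have bd: "\<bar>infdist x (- U)\<bar> \<le> \<bar>M\<bar>" for x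
  proof (cases "x \<in> U")
    case True
    then have "x \<in> cball 0 rad" using U \<Omega>_rad by blast
    then have "dist x a \<le> M" using norm_triangle_ineq4[of x a] by (simp add: M_def dist_norm)
    then have "infdist x (- U) \<le> M" using infdist_le[OF a, of x] by linarith
    then show ?thesis using infdist_nonneg[of x "- U"] by linarith
  qed simp
  have "gagliardo_pow s p (\<lambda>x. infdist x (- U)) < \<infinity>"
  proof (rule lipschitz_gagliardo_finite[OF s p bounded_subset[OF \<Omega>_bounded U(2)] off _ bd])
    show "\<bar>infdist x (- U) - infdist y (- U)\<bar> \<le> 1 * norm (x - y)" for x y
      using infdist_triangle_abs[of x "- U" y] by (simp add: dist_norm)
  qed
  moreover have "(\<lambda>x. infdist x (- U)) \<in> borel_measurable lebesgue"
  proof -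
    have "(\<lambda>x. infdist x (- U)) \<in> borel_measurable borel"
      by (intro borel_measurable_continuous_onI continuous_intros)
    then show ?thesis by (simp add: measurable_completion)
  qed
  moreover have "AE x in lebesgue. x \<notin> \<Omega> \<longrightarrow> infdist x (- U) = 0"
    using U by (intro AE_I2) (auto intro: off)
  ultimately show ?thesis unfolding W_iff by blast
qed

lemma infdist_complement_pos: "open U \<Longrightarrow> U \<subseteq> \<Omega> \<Longrightarrow> x \<in> U \<Longrightarrow> 0 < infdist x (- U)"
  using complement_nonempty[of U] by (intro infdist_pos_not_in_closed) auto

lemma AE_zero_on_open_imp_empty:
  fixes U :: "'a set"
  assumes "open U" "AE x in lebesgue. x \<notin> U"
  shows "U = {}"
proof -
  have "U \<in> null_sets lebesgue" using assms by (auto simp: AE_iff_null_sets)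
  then have "negligible U" by (simp add: negligible_iff_null_sets)
  then show ?thesis using assms(1) open_not_negligible by blast
qed

lemma infdist_complement_R_pos:
  assumes U: "open U" "U \<subseteq> \<Omega>" "U \<noteq> {}"
  shows "0 < R (\<lambda>x. infdist x (- U))"
proof (rule ccontr)
  assume "\<not> ?thesis"
  then have "R (\<lambda>x. infdist x (- U)) = 0" using R_nonneg[of "\<lambda>x. infdist x (- U)"] by linarith
  then have "AE x in lebesgue. infdist x (- U) = 0"
    using R_eq_0_iff[OF infdist_complement_in_W[OF U(1,2)]] by simp
  then have "AE x in lebesgue. x \<notin> U"
    by eventually_elim (use infdist_complement_pos[OF U(1,2)] in force)
  then show False using AE_zero_on_open_imp_empty U by blast
qed

lemma minimizing_sequence:
  assumes "X \<noteq> {}" "\<And>x. x \<in> X \<Longrightarrow> 0 \<le> f x"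
  obtains u c where "\<And>n::nat. u n \<in> X" "(\<lambda>n. f (u n)) \<longlonglongrightarrow> (c::real)" "\<And>x. x \<in> X \<Longrightarrow> c \<le> f x"
proof -
  define c where "c = Inf (f ` X)"
  have bd: "bdd_below (f ` X)" using assms(2) by (intro bdd_belowI[of _ 0]) auto
  have le: "c \<le> f x" if "x \<in> X" for x unfolding c_def using that bd by (simp add: cInf_lower)
  have "\<exists>x\<in>X. f x < c + 1 / real (Suc n)" for n
    using cInf_lessD[of "f ` X" "c + 1 / real (Suc n)"] assms(1) by (auto simp: c_def)
  then obtain u where u: "\<And>n. u n \<in> X" "\<And>n. f (u n) < c + 1 / real (Suc n)" by metis
  have "(\<lambda>n. f (u n)) \<longlonglongrightarrow> c"
  proof (rule tendsto_sandwich[where f = "\<lambda>_. c" and h = "\<lambda>n. c + 1 / real (Suc n)"])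
    show "(\<lambda>n. c + 1 / real (Suc n)) \<longlonglongrightarrow> c"
      using tendsto_add[OF tendsto_const LIMSEQ_inverse_real_of_nat, of c] by (simp add: inverse_eq_divide)
    show "eventually (\<lambda>n. f (u n) \<le> c + 1 / real (Suc n)) sequentially"
      using u(2) less_imp_le by (intro always_eventually allI) blast
    show "eventually (\<lambda>n. c \<le> f (u n)) sequentially" using le u(1) by auto
  qed simp
  then show ?thesis using u(1) le by (intro that) auto
qed

text \<open>
  A minimizing sequence of solutions of the Nehari equation is bounded in \<open>W\<close> because there
  \<open>J = (1/p - 1/r) A\<close>.
\<close>
lemma nehari_sequence_bounded:
  assumes u: "\<And>n::nat. u n \<in> W" "\<And>n. A (u n) = \<Lambda> * R (u n)" and c: "(\<lambda>n. J (u n)) \<longlonglongrightarrow> c"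
  obtains G where "\<And>n. E (u n) \<le> G"
proof -
  obtain \<kappa> where \<kappa>: "0 < \<kappa>" "\<forall>u\<in>W. \<kappa> * E u \<le> A u" using A_coercive by blast
  obtain B where B: "\<And>n. norm (J (u n)) \<le> B"
    using convergent_imp_Bseq[OF convergentI[OF c]] unfolding Bseq_def by blast
  show ?thesis
  proof (rule that)
    fix n
    have "(1 / p - 1 / r) * (\<kappa> * E (u n)) \<le> (1 / p - 1 / r) * A (u n)"
      using pr_pos bspec[OF \<kappa>(2) u(1)[of n]] by (intro mult_left_mono) auto
    also have "\<dots> = J (u n)" using J_on_nehari[OF u(2)[of n]] u(2)[of n] by simp
    also have "\<dots> \<le> B" using B[of n] by simp
    finally show "E (u n) \<le> B / ((1 / p - 1 / r) * \<kappa>)"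
      using mult_pos_pos[OF pr_pos \<kappa>(1)] by (simp add: field_simps)
  qed
qed

text \<open>
  The limit of a minimizing sequence is nonzero by the lower bound on \<open>R\<close>. Its absolute value is
  scaled back to the Nehari set, and since each \<open>u\<^sub>n\<close> is maximal on its own ray, the same scaling
  of the sequence does not increase the energy.
\<close>
lemma nehari_minimizer:
  obtains u where "u \<in> nehari" "\<And>x. 0 \<le> u x" "\<And>v. v \<in> nehari \<Longrightarrow> J u \<le> J v"
proof -
  have Jnn: "0 \<le> J v" if "v \<in> nehari" for v
    using that pr_pos \<Lambda> by (auto simp: nehari_def J_on_nehari)
  have scaled: "\<exists>t>0. (\<lambda>x. t * v x) \<in> nehari" if v: "v \<in> W" "0 < R v" for v
  proof -
    obtain t where t: "0 < t" "A (\<lambda>x. t * v x) = \<Lambda> * R (\<lambda>x. t * v x)"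
      by (rule nehari_scaling[OF v])
    then show ?thesis using v R_scale[OF v(1), of t] W_scale[OF v(1), of t] by (auto simp: nehari_def)
  qed
  have "\<Omega> \<noteq> {}" using \<Omega>_0 by blast
  then have "nehari \<noteq> {}"
    using scaled[OF infdist_complement_in_W[OF \<Omega>_open order.refl] infdist_complement_R_pos[OF \<Omega>_open order.refl]]
    by blast
  then obtain u c where u: "\<And>n::nat. u n \<in> nehari" and c: "(\<lambda>n. J (u n)) \<longlonglongrightarrow> c"
    and cle: "\<And>v. v \<in> nehari \<Longrightarrow> c \<le> J v"
    using minimizing_sequence[of nehari J] Jnn by metis
  have uW: "u n \<in> W" and uN: "A (u n) = \<Lambda> * R (u n)" and uR: "0 < R (u n)" for n
    using u[of n] by (auto simp: nehari_def)
  obtain G where G: "\<And>n. E (u n) \<le> G" by (rule nehari_sequence_bounded[OF uW uN c]) blast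
  obtain \<rho> :: "nat \<Rightarrow> nat" and v where \<rho>: "strict_mono \<rho>" and v: "v \<in> W"
    and lim: "AE x in lebesgue. (\<lambda>n. u (\<rho> n) x) \<longlonglongrightarrow> v x"
    by (rule W_compact[OF uW G])
  obtain c0 where c0: "0 < c0" "\<forall>u\<in>W. 0 < R u \<longrightarrow> A u \<le> \<Lambda> * R u \<longrightarrow> c0 \<le> R u"
    using R_lower_bound by blast
  have "c0 \<le> R v"
    by (rule LIMSEQ_le_const[OF R_tendsto[OF uW G v lim]]) (use c0 uW uR uN in auto)
  then have Rv: "0 < R v" using c0(1) by linarith
  define w where "w = (\<lambda>x. \<bar>v x\<bar>)"
  have w: "w \<in> W" unfolding w_def by (rule W_abs(1)[OF v])
  have Rw: "R w = R v" and Hw: "H w = H v" by (simp_all add: w_def R_def H_def Lp_pow_def)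
  obtain t where t: "0 < t" "(\<lambda>x. t * w x) \<in> nehari" using scaled[OF w] Rw Rv by auto
  have Jt: "J (\<lambda>x. t * w x) \<le> J (\<lambda>x. t * v x)"
  proof -
    have "A w \<le> A v" unfolding A_def Hw using W_abs(2)[OF v] by (simp add: w_def)
    then have "t powr p * A w / p \<le> t powr p * A v / p"
      using p0 by (intro divide_right_mono mult_left_mono) auto
    then show ?thesis using t by (simp add: J_def A_scale[OF w] A_scale[OF v] R_scale[OF w] R_scale[OF v] Rw)
  qed
  have "J (\<lambda>x. t * v x) \<le> c"
  proof (rule J_lower_semicontinuous)
    show "(\<lambda>x. t * u (\<rho> n) x) \<in> W" for n by (rule W_scale[OF uW])
    show "E (\<lambda>x. t * u (\<rho> n) x) \<le> t powr p * G" for n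
      using t G[of "\<rho> n"] by (simp add: E_scale[OF uW] mult_left_mono)
    show "(\<lambda>x. t * v x) \<in> W" by (rule W_scale[OF v])
    show "AE x in lebesgue. (\<lambda>n. t * u (\<rho> n) x) \<longlonglongrightarrow> t * v x"
      using lim by eventually_elim (intro tendsto_intros)
    show "J (\<lambda>x. t * u (\<rho> n) x) \<le> J (u (\<rho> n))" for n
      using t by (intro nehari_fibre_le uW uN) auto
    show "(\<lambda>n. J (u (\<rho> n))) \<longlonglongrightarrow> c" using LIMSEQ_subseq_LIMSEQ[OF c \<rho>] by (simp add: o_def)
  qed
  then show ?thesis using t Jt cle by (intro that[of "\<lambda>x. t * w x"]) (force simp: w_def)+
qed

text \<open>
  On the Nehari set \<open>J\<close> is a multiple of \<open>R\<close>, so a minimizer also minimizes the scale invariant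
  quotient \<open>A\<^sup>r / R\<^sup>p\<close> over all of \<open>W\<close>; the vanishing of its derivative is the equation, with no
  multiplier left over because \<open>A u = \<Lambda> R u\<close>.
\<close>
lemma nehari_minimizer_critical:
  assumes u: "u \<in> nehari" and min: "\<And>v. v \<in> nehari \<Longrightarrow> J u \<le> J v" and v: "v \<in> W"
  shows "dJ u v = 0"
proof -
  have uW: "u \<in> W" and uN: "A u = \<Lambda> * R u" and uR: "0 < R u"
    using u by (auto simp: nehari_def)
  have uA: "0 < A u" using uN uR \<Lambda> by simp
  have quot: "A u powr r * R w powr p \<le> A w powr r * R u powr p" if w: "w \<in> W" for w
  proof (cases "R w = 0")
    case False
    then have Rw: "0 < R w" using R_nonneg[of w] by linarith
    obtain t where t: "0 < t" "A (\<lambda>x. t * w x) = \<Lambda> * R (\<lambda>x. t * w x)"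
      by (rule nehari_scaling[OF w Rw])
    define R' where "R' = R (\<lambda>x. t * w x)"
    have R': "R' = t powr r * R w" using t R_scale[OF w, of t] by (simp add: R'_def)
    have A': "\<Lambda> * R' = t powr p * A w" using t A_scale[OF w, of t] by (simp add: R'_def)
    have R'0: "0 < R'" using R' t Rw by simp
    have "(\<lambda>x. t * w x) \<in> nehari" using t W_scale[OF w] R'0 by (auto simp: nehari_def R'_def)
    from min[OF this] have "R u \<le> R'"
      using pr_pos \<Lambda> unfolding J_on_nehari[OF uN] J_on_nehari[OF t(2)] R'_def by simp
    then have "R u powr (r - p) \<le> R' powr (r - p)" using uR pr by (intro powr_mono2) auto
    then have "R u powr (r - p) * (R u powr p * R' powr p) \<le> R' powr (r - p) * (R u powr p * R' powr p)"
      by (intro mult_right_mono) auto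
    moreover have "x powr (r - p) * x powr p = x powr r" if "0 < x" for x
      using that by (simp add: powr_add[symmetric])
    ultimately have "R u powr r * R' powr p \<le> R' powr r * R u powr p"
      using uR R'0 by (metis (no_types, opaque_lifting) mult.assoc mult.commute)
    then have "\<Lambda> powr r * (R u powr r * R' powr p) \<le> \<Lambda> powr r * (R' powr r * R u powr p)"
      by (intro mult_left_mono) auto
    then have "(\<Lambda> * R u) powr r * R' powr p \<le> (\<Lambda> * R') powr r * R u powr p"
      using \<Lambda> uR R'0 by (simp add: powr_mult mult.assoc)
    then have "A u powr r * (t powr r * R w) powr p \<le> (t powr p * A w) powr r * R u powr p"
      unfolding uN[symmetric] A' unfolding R' .
    moreover have "(t powr r * R w) powr p = t powr (p * r) * R w powr p"
      "(t powr p * A w) powr r = t powr (p * r) * A w powr r"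
      using Rw A_nonneg[OF w] by (simp_all add: powr_mult powr_powr mult.commute)
    ultimately have "t powr (p * r) * (A u powr r * R w powr p) \<le> t powr (p * r) * (A w powr r * R u powr p)"
      by (simp add: mult_ac)
    then show ?thesis using t by simp
  qed simp
  \<comment> \<open>The quotient inequality without denominators, so that \<open>R\<close> may vanish away from \<open>t = 0\<close>.\<close>
  define Q where "Q = (\<lambda>t. A (\<lambda>x. u x + t * v x) powr r * R u powr p - A u powr r * R (\<lambda>x. u x + t * v x) powr p)"
  have a': "((\<lambda>t. A (\<lambda>x. u x + t * v x)) has_real_derivative p * dA u v) (at 0)"
    using A_has_derivative[OF uW v, of 0] by simp
  have r': "((\<lambda>t. R (\<lambda>x. u x + t * v x)) has_real_derivative r * dR u v) (at 0)"
    using R_has_derivative[OF uW v, of 0] by simp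
  have "(Q has_real_derivative (r * A u powr (r - 1) * (p * dA u v)) * R u powr p
       - A u powr r * (p * R u powr (p - 1) * (r * dR u v))) (at 0)"
    unfolding Q_def
    by (intro DERIV_diff DERIV_cmult DERIV_cmult_right)
       (use DERIV_chain2[OF has_real_derivative_powr a', of r] DERIV_chain2[OF has_real_derivative_powr r', of p] uA uR
        in auto)
  moreover have "\<forall>t. \<bar>0 - t\<bar> < 1 \<longrightarrow> Q 0 \<le> Q t"
    using quot[OF W_add_scale[OF uW v]] by (simp add: Q_def)
  ultimately have "(r * A u powr (r - 1) * (p * dA u v)) * R u powr p
       - A u powr r * (p * R u powr (p - 1) * (r * dR u v)) = 0"
    by (rule DERIV_local_min[OF _ zero_less_one])
  moreover have "A u powr r = A u powr (r - 1) * A u" "R u powr p = R u powr (p - 1) * R u"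
    using uA uR by (simp_all add: powr_diff)
  ultimately have "(p * r * A u powr (r - 1) * R u powr (p - 1)) * (R u * dA u v - A u * dR u v) = 0"
    by (simp add: algebra_simps)
  then have "R u * dA u v - A u * dR u v = 0" using p0 r uA uR by simp
  then have "R u * dJ u v = 0" unfolding uN dJ_def by (simp add: algebra_simps)
  then show ?thesis using uR by simp
qed

end

section \<open>The strong maximum principle and the positive solution\<close>

text \<open>
  \<open>\<phi> = (w)\<^sup>+\<close> with \<open>w = \<epsilon>\<eta> - u\<close>. The increments of \<open>u\<close> and \<open>w\<close> add up to the increment \<open>b\<close> of
  \<open>\<epsilon>\<eta>\<close>, and whatever the signs of \<open>w\<close> at the two points, the product is at most \<open>\<bar>b\<bar>\<^sup>p\<close>.
\<close>
lemma dpow_times_pos_part_le: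
  fixes ux uy hx hy :: real
  assumes p: "1 < p"
  shows "dpow p (ux - uy) * (max (hx - ux) 0 - max (hy - uy) 0) \<le> \<bar>hx - hy\<bar> powr p"
proof -
  define a where "a = ux - uy"
  define b where "b = hx - hy"
  have key: "dpow p a * b - \<bar>a\<bar> powr p \<le> \<bar>b\<bar> powr p"
  proof (cases "\<bar>a\<bar> \<le> \<bar>b\<bar>")
    case True
    have "dpow p a * b \<le> \<bar>dpow p a * b\<bar>" by simp
    also have "\<dots> = \<bar>a\<bar> powr (p - 1) * \<bar>b\<bar>" by (simp add: abs_mult)
    also have "\<dots> \<le> \<bar>b\<bar> powr (p - 1) * \<bar>b\<bar>"
      using True p by (intro mult_right_mono powr_mono2) auto
    also have "\<dots> = \<bar>b\<bar> powr p" by (rule abs_powr_mult_base)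
    finally show ?thesis using powr_ge_zero[of "\<bar>a\<bar>" p] by linarith
  next
    case False
    have "dpow p a * b \<le> \<bar>dpow p a * b\<bar>" by simp
    also have "\<dots> = \<bar>a\<bar> powr (p - 1) * \<bar>b\<bar>" by (simp add: abs_mult)
    also have "\<dots> \<le> \<bar>a\<bar> powr (p - 1) * \<bar>a\<bar>" using False by (intro mult_left_mono) auto
    also have "\<dots> = \<bar>a\<bar> powr p" by (rule abs_powr_mult_base)
    finally show ?thesis using powr_ge_zero[of "\<bar>b\<bar>" p] by linarith
  qed
  have one_sided: "dpow p c * d \<le> \<bar>e\<bar> powr p" if "0 \<le> d" "0 < c \<Longrightarrow> c \<le> e \<and> d \<le> e" for c d e :: real
  proof (cases "0 < c")
    case True
    then have ce: "c \<le> e" "d \<le> e" using that by auto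
    have "dpow p c * d \<le> c powr (p - 1) * e" using True ce by (simp add: dpow_pos mult_left_mono)
    also have "\<dots> \<le> e powr (p - 1) * e" using True ce p by (intro mult_right_mono powr_mono2) auto
    also have "\<dots> = \<bar>e\<bar> powr p" using True ce abs_powr_mult_base[of e p] by simp
    finally show ?thesis .
  next
    case False
    then have "dpow p c * d \<le> 0" using that dpow_nonpos[of c p] by (simp add: mult_nonpos_nonneg)
    then show ?thesis using powr_ge_zero[of "\<bar>e\<bar>" p] by linarith
  qed
  consider "ux < hx" "uy < hy" | "ux < hx" "hy \<le> uy" | "hx \<le> ux" "uy < hy" | "hx \<le> ux" "hy \<le> uy"
    by linarith
  then show ?thesis
  proof cases
    case 1
    then have m: "max (hx - ux) 0 - max (hy - uy) 0 = b - a" by (simp add: a_def b_def)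
    have "dpow p a * (b - a) = dpow p a * b - \<bar>a\<bar> powr p" by (simp add: right_diff_distrib)
    then show ?thesis using key unfolding m by (simp add: a_def[symmetric] b_def[symmetric])
  next
    case 2
    then have "max (hx - ux) 0 - max (hy - uy) 0 = hx - ux" by simp
    then show ?thesis using one_sided[of "hx - ux" "ux - uy" "hx - hy"] 2 by simp
  next
    case 3
    then have m: "max (hx - ux) 0 - max (hy - uy) 0 = - (hy - uy)" by simp
    have "dpow p (ux - uy) * (- (hy - uy)) = dpow p (uy - ux) * (hy - uy)"
      using dpow_minus[of p "uy - ux"] by (simp add: algebra_simps)
    also have "\<dots> \<le> \<bar>hy - hx\<bar> powr p" using one_sided[of "hy - uy" "uy - ux" "hy - hx"] 3 by simp
    finally show ?thesis unfolding m by (simp add: abs_minus_commute)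
  next
    case 4
    then show ?thesis by simp
  qed
qed

context hardy_problem
begin

text \<open>
  The kernel is positive off the diagonal, so a product of two disjoint sets that is null for the
  Gagliardo measure is null for Lebesgue measure, and one of its factors is null.
\<close>
lemma AE_gag_rectangle:
  fixes P Q :: "'a \<Rightarrow> bool"
  assumes "AE z in gmeas. \<not> (P (fst z) \<and> Q (snd z))" and PQ: "\<And>x. \<not> (P x \<and> Q x)"
  shows "(AE x in lebesgue. \<not> P x) \<or> (AE y in lebesgue. \<not> Q y)"
proof -
  have "AE z in lebesgue. 0 < ennreal (gag_kernel s p z) \<longrightarrow> \<not> (P (fst z) \<and> Q (snd z))"
    using assms(1) unfolding gag_measure_def by (subst (asm) AE_density) auto
  then have "AE z in lebesgue. \<not> (P (fst z) \<and> Q (snd z))"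
  proof eventually_elim
    case (elim z)
    show ?case
    proof
      assume *: "P (fst z) \<and> Q (snd z)"
      then have "fst z \<noteq> snd z" using PQ by metis
      then have "0 < gag_kernel s p z" by (simp add: gag_kernel_def)
      then show False using elim * by simp
    qed
  qed
  then have "AE z in (lborel \<Otimes>\<^sub>M lborel :: ('a \<times> 'a) measure). \<not> (P (fst z) \<and> Q (snd z))"
    unfolding lborel_prod by (simp add: AE_completion_iff)
  from lborel_pair.AE_pair[OF this]
  have ae: "AE x in lborel. AE y in lborel. \<not> (P x \<and> Q y)" by simp
  show ?thesis
  proof (cases "AE y in lborel. \<not> Q y")
    case True
    then show ?thesis by (simp add: AE_completion_iff)
  next
    case False
    have "AE x in lborel. \<not> P x"
      using ae
    proof eventually_elim
      case (elim x)
      show ?case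
      proof
        assume "P x"
        then have "AE y in lborel. \<not> Q y" using elim by simp
        then show False using False by blast
      qed
    qed
    then show ?thesis by (simp add: AE_completion_iff)
  qed
qed

text \<open>
  Testing the equation with \<open>(\<epsilon>\<eta> - u)\<^sup>+\<close>, where \<open>\<eta>\<close> is the distance to the complement of \<open>\<Omega>\<close>, all
  pairs of points together contribute at most \<open>\<epsilon>\<^sup>p [\<eta>]\<^sup>p\<close>. If \<open>u\<close> vanished on a set of positive
  measure, the pairs joining it to \<open>{u \<ge> m}\<close> would contribute a negative multiple of \<open>\<epsilon>\<close>, which
  is impossible for small \<open>\<epsilon>\<close> since \<open>p > 1\<close>.
\<close>
theorem strong_maximum_principle:
  assumes u: "u \<in> W" and nn: "\<And>x. 0 \<le> u x" and R: "0 < R u"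
    and crit: "\<And>v. v \<in> W \<Longrightarrow> dJ u v = 0"
  shows "AE x in lebesgue. x \<in> \<Omega> \<longrightarrow> 0 < u x"
proof (rule ccontr)
  assume neg: "\<not> ?thesis"
  have um [measurable]: "u \<in> borel_measurable lebesgue" using u by (rule W_meas)
  define \<eta> where "\<eta> = (\<lambda>x. infdist x (- \<Omega>))"
  have \<eta>: "\<eta> \<in> W" unfolding \<eta>_def by (rule infdist_complement_in_W[OF \<Omega>_open order.refl])
  have \<eta>0: "0 \<le> \<eta> x" for x by (simp add: \<eta>_def infdist_nonneg)
  have \<eta>pos: "0 < \<eta> x" if "x \<in> \<Omega>" for x
    unfolding \<eta>_def by (rule infdist_complement_pos[OF \<Omega>_open order.refl that])
  have \<eta>m [measurable]: "\<eta> \<in> borel_measurable lebesgue" using \<eta> by (rule W_meas)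
  have "\<exists>M>0. \<forall>x. \<eta> x \<le> M"
  proof -
    obtain a where a: "a \<in> - \<Omega>" using complement_nonempty[of \<Omega>] by blast
    have "\<eta> x \<le> \<bar>rad\<bar> + norm a + 1" for x
    proof (cases "x \<in> \<Omega>")
      case True
      then have "x \<in> cball 0 rad" using \<Omega>_rad by blast
      then have "dist x a \<le> rad + norm a" using norm_triangle_ineq4[of x a] by (simp add: dist_norm)
      then show ?thesis using infdist_le[OF a, of x] unfolding \<eta>_def by linarith
    qed (simp add: \<eta>_def)
    moreover have "0 < \<bar>rad\<bar> + norm a + 1" using norm_ge_zero[of a] by linarith
    ultimately show ?thesis by blast
  qed
  then obtain M where M: "0 < M" "\<And>x. \<eta> x \<le> M" by blast
  have "\<exists>k::nat. \<not> (AE x in lebesgue. \<not> (1 / real (Suc k) \<le> u x))"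
  proof (rule ccontr)
    assume "\<not> ?thesis"
    then have "AE x in lebesgue. \<forall>k::nat. \<not> (1 / real (Suc k) \<le> u x)"
      unfolding AE_all_countable by blast
    then have "AE x in lebesgue. u x = 0"
    proof eventually_elim
      case (elim x)
      show ?case
      proof (rule ccontr)
        assume "u x \<noteq> 0"
        then have "0 < u x" using nn[of x] by simp
        then obtain k where "inverse (real (Suc k)) < u x" using reals_Archimedean by blast
        then show False using elim by (metis inverse_eq_divide less_imp_le)
      qed
    qed
    then show False using R R_eq_0_iff[OF u] by simp
  qed
  \<comment> \<open>A level that \<open>u\<close> reaches on a set of positive measure.\<close>
  then obtain m where m: "0 < m" "\<not> (AE x in lebesgue. \<not> (m \<le> u x))"
    by (metis of_nat_0_less_iff zero_less_Suc zero_less_divide_1_iff)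
  define P where "P = (\<lambda>x. x \<in> \<Omega> \<and> u x = 0)"
  have Om: "\<Omega> \<in> sets lebesgue" using \<Omega>_open by simp
  define f where "f = (\<lambda>x. if P x then \<eta> x else 0)"
  define g where "g = (\<lambda>x. if m \<le> u x then 1 else 0 :: real)"
  have "{x. P x} \<in> sets lebesgue"
  proof -
    have "{x. P x} = \<Omega> \<inter> {x \<in> space lebesgue. u x = 0}" by (auto simp: P_def)
    also have "\<dots> \<in> sets lebesgue" using Om by measurable
    finally show ?thesis .
  qed
  then have "Measurable.pred lebesgue P" by (simp add: pred_def)
  then have fm: "f \<in> borel_measurable lebesgue" unfolding f_def by measurable
  have gm: "g \<in> borel_measurable lebesgue" unfolding g_def by measurable
  define F where "F = (\<lambda>z::'a \<times> 'a. f (fst z) * g (snd z))"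
  have F0: "0 \<le> F z" for z using \<eta>0 by (simp add: F_def f_def g_def)
  have lift: "(\<lambda>z::'a \<times> 'a. h (fst z)) \<in> borel_measurable lebesgue
      \<and> (\<lambda>z::'a \<times> 'a. h (snd z)) \<in> borel_measurable lebesgue"
    if h: "h \<in> borel_measurable lebesgue" for h :: "'a \<Rightarrow> real"
  proof -
    obtain k where k: "k \<in> borel_measurable lborel" "AE x in lborel. h x = k x"
      using completion_ex_borel_measurable_real[OF h] by auto
    have "(\<lambda>z. k (fst z)) \<in> borel_measurable (borel \<Otimes>\<^sub>M borel :: ('a \<times> 'a) measure)"
      "(\<lambda>z. k (snd z)) \<in> borel_measurable (borel \<Otimes>\<^sub>M borel :: ('a \<times> 'a) measure)"
      using k(1) by measurable
    then have kk: "(\<lambda>z::'a \<times> 'a. k (fst z)) \<in> borel_measurable lebesgue"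
      "(\<lambda>z::'a \<times> 'a. k (snd z)) \<in> borel_measurable lebesgue"
      by (simp_all add: borel_prod measurable_completion)
    have "AE x in lebesgue. k x = h x" using k(2) by (simp add: AE_completion_iff eq_commute)
    from AE_lebesgue_fst_snd[OF this]
    have hk: "AE z in (lebesgue :: ('a \<times> 'a) measure). k (fst z) = h (fst z)"
      "AE z in (lebesgue :: ('a \<times> 'a) measure). k (snd z) = h (snd z)" by auto
    show ?thesis using borel_measurable_AE[OF kk(1) hk(1)] borel_measurable_AE[OF kk(2) hk(2)] by blast
  qed
  have Fm: "F \<in> borel_measurable gmeas"
    unfolding F_def gag_measure_def
    using borel_measurable_times[OF conjunct1[OF lift[OF fm]] conjunct2[OF lift[OF gm]]] by simp
  \<comment> \<open>On the support of \<open>F\<close> the increment of \<open>u\<close> is at least \<open>m\<close>, which makes \<open>F\<close> integrable.\<close>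
  have Fle: "F z \<le> M / m powr p * \<bar>incr u z\<bar> powr p" for z
  proof (cases "P (fst z) \<and> m \<le> u (snd z)")
    case True
    then have "m \<le> \<bar>incr u z\<bar>" using m(1) by (simp add: incr_def P_def)
    then have "m powr p \<le> \<bar>incr u z\<bar> powr p" using m(1) p0 by (intro powr_mono2) auto
    then have "M * m powr p \<le> M * \<bar>incr u z\<bar> powr p" using M(1) by simp
    then have "M \<le> M / m powr p * \<bar>incr u z\<bar> powr p" using m(1) by (simp add: field_simps)
    then show ?thesis using True M(2)[of "fst z"] by (simp add: F_def f_def g_def)
  next
    case False
    then have "F z = 0" by (auto simp: F_def f_def g_def)
    then show ?thesis using M(1) m(1) by simp
  qed
  have Fi: "integrable gmeas F"
  proof (rule Bochner_Integration.integrable_bound[OF _ Fm])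
    show "integrable gmeas (\<lambda>z. M / m powr p * \<bar>incr u z\<bar> powr p)"
      using Lp_integrable[OF W_incr_Lp[OF u]] by (rule integrable_mult_right)
    show "AE z in gmeas. norm (F z) \<le> norm (M / m powr p * \<bar>incr u z\<bar> powr p)"
      using Fle F0 by (intro AE_I2) (metis abs_ge_self abs_of_nonneg order.trans real_norm_def)
  qed
  define I where "I = (LINT z|gmeas. F z)"
  have Ipos: "0 < I"
  proof (rule ccontr)
    assume "\<not> 0 < I"
    moreover have "0 \<le> I" unfolding I_def using F0 by (intro integral_nonneg_AE AE_I2)
    ultimately have "I = 0" by simp
    then have "AE z in gmeas. F z = 0"
      unfolding I_def using integral_nonneg_eq_0_iff_AE[OF Fi] F0 by simp
    then have "AE z in gmeas. \<not> (P (fst z) \<and> m \<le> u (snd z))"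
    proof eventually_elim
      case (elim z)
      then show ?case using \<eta>pos[of "fst z"] by (auto simp: F_def f_def g_def P_def)
    qed
    then have "(AE x in lebesgue. \<not> P x) \<or> (AE y in lebesgue. \<not> m \<le> u y)"
      by (rule AE_gag_rectangle) (use m(1) in \<open>auto simp: P_def\<close>)
    then have "AE x in lebesgue. \<not> P x" using m(2) by blast
    then have "AE x in lebesgue. x \<in> \<Omega> \<longrightarrow> 0 < u x"
      by eventually_elim (use nn in \<open>auto simp: P_def less_le\<close>)
    then show False using neg by blast
  qed
  \<comment> \<open>For \<open>\<epsilon> M \<le> m\<close> the test function vanishes where \<open>u \<ge> m\<close>.\<close>
  have small: "m powr (p - 1) * I \<le> \<epsilon> powr (p - 1) * E \<eta>" if \<epsilon>: "0 < \<epsilon>" "\<epsilon> * M \<le> m" for \<epsilon>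
  proof -
    define \<phi> where "\<phi> = (\<lambda>x. max (\<epsilon> * \<eta> x - u x) 0)"
    have w: "(\<lambda>x. \<epsilon> * \<eta> x - u x) \<in> W" using W_lin[OF \<eta> u, of \<epsilon> "-1"] by simp
    have \<phi>: "\<phi> \<in> W" unfolding \<phi>_def by (rule W_pos(1)[OF w])
    have "0 \<le> (LINT x|hmeas. dpow p (u x) * \<phi> x)" "0 \<le> dR u \<phi>"
      unfolding dR_def by (intro integral_nonneg_AE AE_I2; simp add: \<phi>_def dpow_nonneg nn)+
    then have nonneg: "0 \<le> (LINT z|gmeas. dpow p (incr u z) * incr \<phi> z)"
      using crit[OF \<phi>] \<mu> \<Lambda> mult_nonneg_nonneg[of \<mu>] mult_nonneg_nonneg[of \<Lambda>]
      unfolding dJ_def dA_def by (smt (verit))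
    have pt: "dpow p (incr u z) * incr \<phi> z \<le> \<epsilon> powr p * \<bar>incr \<eta> z\<bar> powr p - \<epsilon> * m powr (p - 1) * F z" for z
    proof (cases "P (fst z) \<and> m \<le> u (snd z)")
      case True
      have x: "u (fst z) = 0" "0 \<le> \<epsilon> * \<eta> (fst z)" using True \<epsilon> \<eta>0 by (simp_all add: P_def)
      have "\<epsilon> * \<eta> (snd z) \<le> \<epsilon> * M" using \<epsilon> M(2) by simp
      then have "\<phi> (snd z) = 0" using True \<epsilon>(2) by (simp add: \<phi>_def)
      moreover have "\<phi> (fst z) = \<epsilon> * \<eta> (fst z)" using x by (simp add: \<phi>_def)
      ultimately have "dpow p (incr u z) * incr \<phi> z = - (u (snd z) powr (p - 1) * (\<epsilon> * \<eta> (fst z)))"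
        using x nn[of "snd z"] by (simp add: incr_def dpow_pos)
      also have "\<dots> \<le> - (m powr (p - 1) * (\<epsilon> * \<eta> (fst z)))"
        using True m(1) p x by (intro le_imp_neg_le mult_right_mono powr_mono2) auto
      also have "\<dots> = - (\<epsilon> * m powr (p - 1) * F z)" using True by (simp add: F_def f_def g_def)
      also have "\<dots> \<le> \<epsilon> powr p * \<bar>incr \<eta> z\<bar> powr p - \<epsilon> * m powr (p - 1) * F z" by simp
      finally show ?thesis .
    next
      case False
      then have "F z = 0" by (auto simp: F_def f_def g_def)
      have "dpow p (incr u z) * incr \<phi> z \<le> \<bar>\<epsilon> * \<eta> (fst z) - \<epsilon> * \<eta> (snd z)\<bar> powr p"
        unfolding incr_def \<phi>_def by (rule dpow_times_pos_part_le[OF p])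
      also have "\<epsilon> * \<eta> (fst z) - \<epsilon> * \<eta> (snd z) = \<epsilon> * incr \<eta> z" by (simp add: incr_def right_diff_distrib)
      also have "\<bar>\<epsilon> * incr \<eta> z\<bar> powr p = \<epsilon> powr p * \<bar>incr \<eta> z\<bar> powr p"
        using \<epsilon> by (simp add: abs_mult powr_mult)
      finally show ?thesis using \<open>F z = 0\<close> by simp
    qed
    have "(LINT z|gmeas. dpow p (incr u z) * incr \<phi> z)
        \<le> (LINT z|gmeas. \<epsilon> powr p * \<bar>incr \<eta> z\<bar> powr p - \<epsilon> * m powr (p - 1) * F z)"
      using Lp_integrable[OF W_incr_Lp[OF \<eta>]] Fi by (intro integral_mono int_gag u \<phi> pt) auto
    also have "\<dots> = \<epsilon> powr p * E \<eta> - \<epsilon> * m powr (p - 1) * I"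
      using Lp_integrable[OF W_incr_Lp[OF \<eta>]] Fi by (simp add: E_def Lp_pow_def I_def)
    finally have "\<epsilon> * m powr (p - 1) * I \<le> \<epsilon> powr p * E \<eta>" using nonneg by linarith
    moreover have "\<epsilon> powr p = \<epsilon> * \<epsilon> powr (p - 1)"
      using abs_powr_mult_base[of \<epsilon> p] \<epsilon> by (simp add: mult.commute)
    ultimately have "\<epsilon> * (m powr (p - 1) * I) \<le> \<epsilon> * (\<epsilon> powr (p - 1) * E \<eta>)"
      by (simp only: mult.assoc)
    then show ?thesis using \<epsilon> by simp
  qed
  have "((\<lambda>\<epsilon>. \<epsilon> powr (p - 1) * E \<eta>) \<longlongrightarrow> 0 powr (p - 1) * E \<eta>) (at_right 0)"
    using p by (intro tendsto_intros tendsto_powr') (auto simp: eventually_at_filter)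
  then have lim: "((\<lambda>\<epsilon>. \<epsilon> powr (p - 1) * E \<eta>) \<longlongrightarrow> 0) (at_right 0)" by simp
  have ev: "eventually (\<lambda>\<epsilon>. m powr (p - 1) * I \<le> \<epsilon> powr (p - 1) * E \<eta>) (at_right 0)"
    unfolding eventually_at_right_field
  proof (intro exI[of _ "m / M"] conjI allI impI)
    show "0 < m / M" using m M by simp
    fix \<epsilon> :: real assume "0 < \<epsilon>" "\<epsilon> < m / M"
    then show "m powr (p - 1) * I \<le> \<epsilon> powr (p - 1) * E \<eta>"
      using M by (intro small) (auto simp: field_simps)
  qed
  have "m powr (p - 1) * I \<le> 0"
    by (rule tendsto_lowerbound[OF lim ev]) simp
  then show False using Ipos m(1) by (simp add: mult_le_0_iff)
qed

text \<open>
  Every positive solution lies on the Nehari set, as testing the equation with the solution shows.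
\<close>
theorem exists_positive_solution_of_minimal_energy:
  "\<exists>u. minimizes_on (energy s p r \<Lambda> \<mu> \<Omega>)
     (\<lambda>w. weak_solution s p r \<Lambda> \<mu> \<Omega> w \<and> positive_on \<Omega> w) u"
proof -
  obtain u where u: "u \<in> nehari" and nn: "\<And>x. 0 \<le> u x" and min: "\<And>v. v \<in> nehari \<Longrightarrow> J u \<le> J v"
    by (rule nehari_minimizer) blast
  have uW: "u \<in> W" and uR: "0 < R u" using u by (auto simp: nehari_def)
  have crit: "dJ u v = 0" if "v \<in> W" for v by (rule nehari_minimizer_critical[OF u min that])
  have pos: "positive_on \<Omega> u"
    unfolding positive_on_def by (rule strong_maximum_principle[OF uW nn uR crit])
  have ws: "weak_solution s p r \<Lambda> \<mu> \<Omega> u" unfolding weak_solution_iff using uW crit by blast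
  show ?thesis
    unfolding minimizes_on_def
  proof (intro exI[of _ u] conjI allI impI ws pos)
    fix w assume w: "weak_solution s p r \<Lambda> \<mu> \<Omega> w \<and> positive_on \<Omega> w"
    then have wW: "w \<in> W" and wc: "\<And>v. v \<in> W \<Longrightarrow> dJ w v = 0" by (auto simp: weak_solution_iff)
    have "R w \<noteq> 0"
    proof
      assume "R w = 0"
      then have "AE x in lebesgue. w x = 0" using R_eq_0_iff[OF wW] by simp
      moreover have "AE x in lebesgue. x \<in> \<Omega> \<longrightarrow> 0 < w x" using w by (simp add: positive_on_def)
      ultimately have "AE x in lebesgue. x \<notin> \<Omega>" by eventually_elim auto
      then show False using AE_zero_on_open_imp_empty[OF \<Omega>_open] \<Omega>_0 by blast
    qed
    then have "0 < R w" using R_nonneg[of w] by linarith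
    moreover have "A w = \<Lambda> * R w" using wc[OF wW] by (simp add: dJ_self)
    ultimately have "w \<in> nehari" using wW by (simp add: nehari_def)
    then show "energy s p r \<Lambda> \<mu> \<Omega> u \<le> energy s p r \<Lambda> \<mu> \<Omega> w"
      using min by (simp add: energy_eq_J uW wW)
  qed
qed

end

section \<open>Inequalities for separately scaled signed parts\<close>

text \<open>
  Convexity of the power at the average of \<open>a\<close> and \<open>b\<close> with weights \<open>x\<close> and \<open>y\<close>, in homogeneous form.
\<close>
lemma powr_jensen_sum:
  fixes a b x y p :: real
  assumes "1 < p" "0 \<le> a" "0 \<le> b" "0 \<le> x" "0 \<le> y"
  shows "(a * x + b * y) powr p \<le> (x + y) powr (p - 1) * (a powr p * x + b powr p * y)"
proof (cases "x + y = 0")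
  case False
  define S where "S = x + y"
  have S: "0 < S" using False assms by (simp add: S_def)
  define t where "t = y / S"
  have t: "0 \<le> t" "t \<le> 1" "1 - t = x / S"
    using S assms by (simp_all add: t_def S_def field_simps)
  have small: "k powr p \<le> k" if "0 \<le> k" "k \<le> 1" for k :: real
  proof (cases "k = 0")
    case False
    then show ?thesis using powr_mono'[of 1 p k] that assms by simp
  qed (use assms in simp)
  have "((1 - t) * a + t * b) powr p \<le> (1 - t) * a powr p + t * b powr p"
  proof (cases "0 < a \<and> 0 < b")
    case True
    then show ?thesis
      using convex_onD[OF powr_convex[of p] t(1,2), of a b] assms by simp
  next
    case False
    then have "a = 0 \<or> b = 0" using assms by auto
    then show ?thesis
    proof
      assume "a = 0"
      then show ?thesis using small[OF t(1,2)] assms t by (simp add: powr_mult mult_right_mono)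
    next
      assume "b = 0"
      moreover have "(1 - t) powr p * a powr p \<le> (1 - t) * a powr p"
        using t(1,2) by (intro mult_right_mono small) auto
      ultimately show ?thesis using assms t(1,2) by (simp add: powr_mult)
    qed
  qed
  then have "S powr p * ((1 - t) * a + t * b) powr p \<le> S powr p * ((1 - t) * a powr p + t * b powr p)"
    by (intro mult_left_mono) auto
  moreover have "S powr p * ((1 - t) * a + t * b) powr p = (a * x + b * y) powr p"
  proof -
    have "S * ((1 - t) * a + t * b) = a * x + b * y"
      unfolding t(3) using S by (simp add: t_def field_simps)
    moreover have "0 \<le> (1 - t) * a + t * b"
      using t(1,2) assms(2,3) by (intro add_nonneg_nonneg mult_nonneg_nonneg) auto
    ultimately show ?thesis using S by (simp add: powr_mult[symmetric])
  qed
  moreover have "S powr p * ((1 - t) * a powr p + t * b powr p) = S powr (p - 1) * (a powr p * x + b powr p * y)"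
  proof -
    have "S * ((1 - t) * a powr p + t * b powr p) = a powr p * x + b powr p * y"
      unfolding t(3) using S by (simp add: t_def field_simps)
    moreover have "S powr p = S powr (p - 1) * S" using S by (simp add: powr_diff)
    ultimately show ?thesis by (simp add: mult.assoc)
  qed
  ultimately show ?thesis by (simp add: S_def)
qed (use assms in \<open>simp add: add_nonneg_eq_0_iff\<close>)

lemma powr_superadditive:
  fixes x y p :: real
  assumes "1 < p" "0 \<le> x" "0 \<le> y"
  shows "x powr p + y powr p \<le> (x + y) powr p"
proof -
  have "x powr p = x powr (p - 1) * x" "y powr p = y powr (p - 1) * y"
    "(x + y) powr p = (x + y) powr (p - 1) * (x + y)"
    using abs_powr_mult_base[of x p] abs_powr_mult_base[of y p] abs_powr_mult_base[of "x + y" p] assms by simp_all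
  moreover have "x powr (p - 1) * x \<le> (x + y) powr (p - 1) * x" "y powr (p - 1) * y \<le> (x + y) powr (p - 1) * y"
    using assms by (intro mult_right_mono powr_mono2; simp)+
  ultimately show ?thesis by (simp add: distrib_left)
qed

text \<open>
  The value of \<open>a u\<^sup>+ + b u\<^sup>-\<close> at a point where \<open>u\<close> has the value \<open>X\<close>.
\<close>
definition scale_parts :: "real \<Rightarrow> real \<Rightarrow> real \<Rightarrow> real" where
  "scale_parts a b X = a * max X 0 + b * min X 0"

lemma scale_parts_pos: "0 \<le> a \<Longrightarrow> 0 \<le> b \<Longrightarrow> max (scale_parts a b X) 0 = a * max X 0"
  and scale_parts_neg: "0 \<le> a \<Longrightarrow> 0 \<le> b \<Longrightarrow> min (scale_parts a b X) 0 = b * min X 0"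
  by (cases "0 \<le> X"; simp add: scale_parts_def max_def min_def mult_nonneg_nonpos mult_nonneg_nonpos2;
      auto simp: mult_le_0_iff zero_le_mult_iff)+

lemma scale_parts_1 [simp]: "scale_parts 1 1 X = X"
  by (simp add: scale_parts_def max_def min_def)

lemma scale_parts_minus: "scale_parts a b (- X) = - scale_parts b a X"
  by (simp add: scale_parts_def max_def min_def)

text \<open>
  The reduction to \<open>X \<ge> Y\<close> uses that exchanging the two points changes nothing. If the signs agree
  the inequalities are equalities; the interaction of the parts appears only when \<open>X > 0 > Y\<close>.
\<close>
lemma scale_parts_incr_wlog:
  fixes Pr :: "real \<Rightarrow> real \<Rightarrow> bool"
  assumes "\<And>X Y. Pr Y X \<Longrightarrow> Pr X Y"
    and "\<And>X Y. 0 \<le> Y \<Longrightarrow> Y \<le> X \<Longrightarrow> Pr X Y" "\<And>X Y. X \<le> 0 \<Longrightarrow> Y \<le> X \<Longrightarrow> Pr X Y"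
    and "\<And>X Y. Y \<le> 0 \<Longrightarrow> 0 \<le> X \<Longrightarrow> Pr X Y"
  shows "Pr X Y"
  using assms by (metis linorder_linear)

text \<open>
  At a pair with \<open>X > 0 > Y\<close> this is the convexity inequality for the increment \<open>a X + b \<bar>Y\<bar>\<close>.
\<close>
lemma scale_parts_incr_upper:
  assumes p: "1 < p" and a: "0 \<le> a" "0 \<le> b"
  shows "\<bar>scale_parts a b X - scale_parts a b Y\<bar> powr p
     \<le> a powr p * (dpow p (X - Y) * (max X 0 - max Y 0)) + b powr p * (dpow p (X - Y) * (min X 0 - min Y 0))" (is "?P X Y")
proof (rule scale_parts_incr_wlog[where X = X and Y = Y])
  fix X Y :: real
  assume h: "?P Y X"
  have "dpow p (Y - X) * (max Y 0 - max X 0) = dpow p (X - Y) * (max X 0 - max Y 0)"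
    "dpow p (Y - X) * (min Y 0 - min X 0) = dpow p (X - Y) * (min X 0 - min Y 0)"
    using dpow_minus[of p "X - Y"] by (simp_all add: algebra_simps)
  with h show "?P X Y"
    by (simp add: abs_minus_commute)
next
  fix X Y :: real assume "0 \<le> Y" "Y \<le> X"
  then have e: "max X 0 = X" "max Y 0 = Y" "min X 0 = 0" "min Y 0 = 0" by auto
  have "\<bar>a * X - a * Y\<bar> powr p = a powr p * \<bar>X - Y\<bar> powr p"
    using a by (simp add: right_diff_distrib[symmetric] abs_mult powr_mult)
  then show "?P X Y"
    unfolding scale_parts_def e by simp
next
  fix X Y :: real assume "X \<le> 0" "Y \<le> X"
  then have e: "max X 0 = 0" "max Y 0 = 0" "min X 0 = X" "min Y 0 = Y" by auto
  have "\<bar>b * X - b * Y\<bar> powr p = b powr p * \<bar>X - Y\<bar> powr p"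
    using a by (simp add: right_diff_distrib[symmetric] abs_mult powr_mult)
  then show "?P X Y"
    unfolding scale_parts_def e by simp
next
  fix X Y :: real assume XY: "Y \<le> 0" "0 \<le> X"
  then have e: "max X 0 = X" "max Y 0 = 0" "min X 0 = 0" "min Y 0 = Y" by auto
  have "(a * X + b * (- Y)) powr p \<le> (X + (- Y)) powr (p - 1) * (a powr p * X + b powr p * (- Y))"
    using XY p a by (intro powr_jensen_sum) auto
  moreover have "0 \<le> a * X + b * (- Y)" using XY a by (intro add_nonneg_nonneg mult_nonneg_nonneg) auto
  ultimately show "?P X Y"
    unfolding scale_parts_def e using XY by (simp add: dpow_pos algebra_simps)
qed

lemma scale_parts_incr_lower:
  assumes p: "1 < p" and a: "0 \<le> a" "0 \<le> b"
  shows "a powr p * \<bar>max X 0 - max Y 0\<bar> powr p + b powr p * \<bar>min X 0 - min Y 0\<bar> powr p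
     \<le> \<bar>scale_parts a b X - scale_parts a b Y\<bar> powr p" (is "?P X Y")
proof (rule scale_parts_incr_wlog[where X = X and Y = Y])
  fix X Y :: real
  assume "?P Y X"
  then show "?P X Y"
    by (simp add: abs_minus_commute)
next
  fix X Y :: real assume "0 \<le> Y" "Y \<le> X"
  then have e: "max X 0 = X" "max Y 0 = Y" "min X 0 = 0" "min Y 0 = 0" by auto
  show "?P X Y"
    unfolding scale_parts_def e using a by (simp add: right_diff_distrib[symmetric] abs_mult powr_mult)
next
  fix X Y :: real assume "X \<le> 0" "Y \<le> X"
  then have e: "max X 0 = 0" "max Y 0 = 0" "min X 0 = X" "min Y 0 = Y" by auto
  show "?P X Y"
    unfolding scale_parts_def e using a by (simp add: right_diff_distrib[symmetric] abs_mult powr_mult)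
next
  fix X Y :: real assume XY: "Y \<le> 0" "0 \<le> X"
  then have e: "max X 0 = X" "max Y 0 = 0" "min X 0 = 0" "min Y 0 = Y" by auto
  have n: "0 \<le> a * X" "0 \<le> b * (- Y)" using XY a by (auto intro: mult_nonneg_nonneg mult_nonneg_nonpos)
  have "(a * X) powr p + (b * (- Y)) powr p \<le> (a * X + b * (- Y)) powr p"
    using n p by (intro powr_superadditive) auto
  moreover have "(a * X) powr p = a powr p * \<bar>X\<bar> powr p" "(b * (- Y)) powr p = b powr p * \<bar>Y\<bar> powr p"
    using XY a by (simp_all only: powr_mult abs_of_nonneg abs_of_nonpos)
  ultimately show "?P X Y"
    unfolding scale_parts_def e using n by simp
qed

text \<open>
  Monotonicity of the power: replacing \<open>b\<close> by the larger \<open>a\<close> enlarges the increment at pairs of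
  opposite signs and gives an expression homogeneous in \<open>a\<close>. It determines the sign of the Nehari
  equations on the sides of a square.
\<close>
lemma scale_parts_flux:
  assumes p: "1 < p" and a: "0 \<le> a" "0 \<le> b"
  shows "b \<le> a \<Longrightarrow> dpow p (scale_parts a b X - scale_parts a b Y) * (a * max X 0 - a * max Y 0)
      \<le> a powr p * (dpow p (X - Y) * (max X 0 - max Y 0))"
    and "a \<le> b \<Longrightarrow> a powr p * (dpow p (X - Y) * (max X 0 - max Y 0))
      \<le> dpow p (scale_parts a b X - scale_parts a b Y) * (a * max X 0 - a * max Y 0)"
proof -
  define L where "L = (\<lambda>X Y. dpow p (scale_parts a b X - scale_parts a b Y) * (a * max X 0 - a * max Y 0))"
  define S where "S = (\<lambda>X Y. a powr p * (dpow p (X - Y) * (max X 0 - max Y 0)))"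
  have ap: "a powr p = a powr (p - 1) * a" using abs_powr_mult_base[of a p] a by simp
  have Lsym: "L Y X = L X Y" for X Y
    unfolding L_def using dpow_minus[of p "scale_parts a b X - scale_parts a b Y"] by (simp add: algebra_simps)
  have Ssym: "S Y X = S X Y" for X Y
    unfolding S_def using dpow_minus[of p "X - Y"] by (simp add: algebra_simps)
  have same: "L X Y = S X Y" if "0 \<le> Y \<and> Y \<le> X \<or> X \<le> 0 \<and> Y \<le> X" for X Y
  proof (cases "0 \<le> Y")
    case True
    then have e: "max X 0 = X" "max Y 0 = Y" "min X 0 = 0" "min Y 0 = 0" using that by auto
    show ?thesis
      unfolding L_def S_def scale_parts_def e ap
      using dpow_scale[OF a(1), of p "X - Y"] by (simp add: right_diff_distrib algebra_simps)
  next
    case False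
    then have e: "max X 0 = 0" "max Y 0 = 0" using that by auto
    show ?thesis unfolding L_def S_def e by simp
  qed
  have opp: "L X Y = (a * X + b * (- Y)) powr (p - 1) * (a * X)" "S X Y = (a * X + a * (- Y)) powr (p - 1) * (a * X)"
    "0 \<le> a * X + b * (- Y)" "0 \<le> a * X + a * (- Y)" "0 \<le> a * X"
    if XY: "Y \<le> 0" "0 \<le> X" for X Y
  proof -
    have e: "max X 0 = X" "max Y 0 = 0" "min X 0 = 0" "min Y 0 = Y" using XY by auto
    show n: "0 \<le> a * X + b * (- Y)" "0 \<le> a * X + a * (- Y)" "0 \<le> a * X"
    proof -
      have "0 \<le> a * X" "0 \<le> b * (- Y)" "0 \<le> a * (- Y)"
        using XY a by (simp_all only: mult_nonneg_nonneg neg_0_le_iff_le)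
      then show "0 \<le> a * X + b * (- Y)" "0 \<le> a * X + a * (- Y)" "0 \<le> a * X"
        by (simp_all only: add_nonneg_nonneg)
    qed
    show "L X Y = (a * X + b * (- Y)) powr (p - 1) * (a * X)"
      unfolding L_def scale_parts_def e using n by (simp add: dpow_pos)
    have "(a * X + a * (- Y)) powr (p - 1) = a powr (p - 1) * (X - Y) powr (p - 1)"
      using XY a powr_mult[of a "X - Y" "p - 1"] by (simp add: right_diff_distrib)
    then show "S X Y = (a * X + a * (- Y)) powr (p - 1) * (a * X)"
      unfolding S_def e ap using XY by (simp add: dpow_pos)
  qed
  have up: "L X Y \<le> S X Y" if "b \<le> a" for X Y
  proof (rule scale_parts_incr_wlog[where X = X and Y = Y])
    fix X Y :: real assume XY: "Y \<le> 0" "0 \<le> X"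
    have "b * (- Y) \<le> a * (- Y)" using that XY by (intro mult_right_mono) auto
    then show "L X Y \<le> S X Y" unfolding opp(1)[OF XY] opp(2)[OF XY]
      using opp(3-)[OF XY] p by (intro mult_right_mono powr_mono2) auto
  next
    fix X Y assume "L Y X \<le> S Y X"
    then show "L X Y \<le> S X Y" unfolding Lsym[of X Y] Ssym[of X Y] .
  qed (use same in simp_all)
  have lo: "S X Y \<le> L X Y" if "a \<le> b" for X Y
  proof (rule scale_parts_incr_wlog[where X = X and Y = Y])
    fix X Y :: real assume XY: "Y \<le> 0" "0 \<le> X"
    have "a * (- Y) \<le> b * (- Y)" using that XY by (intro mult_right_mono) auto
    then show "S X Y \<le> L X Y" unfolding opp(1)[OF XY] opp(2)[OF XY]
      using opp(3-)[OF XY] p by (intro mult_right_mono powr_mono2) auto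
  next
    fix X Y assume "S Y X \<le> L Y X"
    then show "S X Y \<le> L X Y" unfolding Lsym[of X Y] Ssym[of X Y] .
  qed (use same in simp_all)
  show "b \<le> a \<Longrightarrow> dpow p (scale_parts a b X - scale_parts a b Y) * (a * max X 0 - a * max Y 0)
      \<le> a powr p * (dpow p (X - Y) * (max X 0 - max Y 0))"
    using up[of X Y] by (simp add: L_def S_def)
  show "a \<le> b \<Longrightarrow> a powr p * (dpow p (X - Y) * (max X 0 - max Y 0))
      \<le> dpow p (scale_parts a b X - scale_parts a b Y) * (a * max X 0 - a * max Y 0)"
    using lo[of X Y] by (simp add: L_def S_def)
qed

lemma scale_parts_pointwise:
  assumes a: "0 \<le> a" "0 \<le> b" and p: "0 < p"
  shows "\<bar>scale_parts a b X\<bar> powr p = a powr p * (dpow p X * max X 0) + b powr p * (dpow p X * min X 0)"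
    and "dpow p (scale_parts a b X) * (a * max X 0) = a powr p * (dpow p X * max X 0)"
    and "dpow p X * max X 0 = \<bar>max X 0\<bar> powr p" and "dpow p X * min X 0 = \<bar>min X 0\<bar> powr p"
proof -
  have ap: "a powr p = a powr (p - 1) * a" using abs_powr_mult_base[of a p] a by simp
  show 3: "dpow p X * max X 0 = \<bar>max X 0\<bar> powr p" and 4: "dpow p X * min X 0 = \<bar>min X 0\<bar> powr p"
    using dpow_times_self[of p X] p by (auto simp: max_def min_def)
  show "\<bar>scale_parts a b X\<bar> powr p = a powr p * (dpow p X * max X 0) + b powr p * (dpow p X * min X 0)"
  proof (cases "0 \<le> X")
    case True
    then show ?thesis unfolding 3 4 using a p by (simp add: scale_parts_def abs_mult powr_mult)
  next
    case False
    then have "min X 0 = X" "max X 0 = 0" by auto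
    then have "\<bar>scale_parts a b X\<bar> = b * \<bar>X\<bar>" using a by (simp add: scale_parts_def abs_mult)
    then have "\<bar>scale_parts a b X\<bar> powr p = b powr p * \<bar>X\<bar> powr p" by (simp only: powr_mult)
    then show ?thesis unfolding 3 4 using \<open>min X 0 = X\<close> \<open>max X 0 = 0\<close> by simp
  qed
  show "dpow p (scale_parts a b X) * (a * max X 0) = a powr p * (dpow p X * max X 0)"
  proof (cases "0 \<le> X")
    case True
    then show ?thesis using dpow_scale[OF a(1), of p X] by (simp add: scale_parts_def ap)
  qed simp
qed

section \<open>The energy of functions with separately scaled parts\<close>

text \<open>
  Along a bounded finite-dimensional family there is a single integrable majorant, so dominated
  convergence gives continuity, for the positive parts of the members as well.
\<close>
lemma continuous_on_dpow_pairing: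
  fixes \<alpha> \<beta> :: "'c::metric_space \<Rightarrow> 'b \<Rightarrow> real"
  assumes p: "1 < p" and N: "N \<in> Lp M p" and N0: "\<And>x. 0 \<le> N x"
    and m: "\<And>t. t \<in> T \<Longrightarrow> \<alpha> t \<in> borel_measurable M" "\<And>t. t \<in> T \<Longrightarrow> \<beta> t \<in> borel_measurable M"
    and c: "\<And>x. continuous_on T (\<lambda>t. \<alpha> t x)" "\<And>x. continuous_on T (\<lambda>t. \<beta> t x)"
    and b: "\<And>t x. t \<in> T \<Longrightarrow> \<bar>\<alpha> t x\<bar> \<le> N x" "\<And>t x. t \<in> T \<Longrightarrow> \<bar>\<beta> t x\<bar> \<le> N x"
  shows "continuous_on T (\<lambda>t. LINT x|M. dpow p (\<alpha> t x) * \<beta> t x)"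
proof (rule continuous_on_parametric_integral)
  show "(\<lambda>x. dpow p (\<alpha> t x) * \<beta> t x) \<in> borel_measurable M" if "t \<in> T" for t
    using m(1)[OF that] m(2)[OF that] by measurable
  have "continuous_on UNIV (dpow p)" using isCont_dpow[OF p] by (simp add: continuous_on_eq_continuous_at)
  then show "continuous_on T (\<lambda>t. dpow p (\<alpha> t x) * \<beta> t x)" for x
    by (intro continuous_on_mult c continuous_on_compose2[OF _ c(1)[of x]]) auto
  show "integrable M (\<lambda>x. \<bar>N x\<bar> powr p)" by (rule Lp_integrable[OF N])
  show "\<bar>dpow p (\<alpha> t x) * \<beta> t x\<bar> \<le> \<bar>N x\<bar> powr p" if "t \<in> T" for t x
  proof -
    have "\<bar>\<alpha> t x\<bar> powr (p - 1) * \<bar>\<beta> t x\<bar> \<le> N x powr (p - 1) * N x"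
      using b(1)[OF that, of x] b(2)[OF that, of x] p by (intro mult_mono powr_mono2) auto
    then show ?thesis using abs_powr_mult_base[of "N x" p] N0[of x] by (simp add: abs_mult)
  qed
qed

context hardy_problem
begin

abbreviation pos :: "('a \<Rightarrow> real) \<Rightarrow> 'a \<Rightarrow> real" where "pos u \<equiv> \<lambda>x. max (u x) 0"
abbreviation neg :: "('a \<Rightarrow> real) \<Rightarrow> 'a \<Rightarrow> real" where "neg u \<equiv> \<lambda>x. min (u x) 0"

text \<open>
  The family \<open>a u\<^sup>+ + b u\<^sup>- + e v\<close>, with parameters \<open>t = (a, b, e)\<close>.
\<close>
definition comb :: "('a \<Rightarrow> real) \<Rightarrow> ('a \<Rightarrow> real) \<Rightarrow> real \<times> real \<times> real \<Rightarrow> 'a \<Rightarrow> real" where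
  "comb u v t x = scale_parts (fst t) (fst (snd t)) (u x) + snd (snd t) * v x"

lemma comb_eq: "comb u v t = (\<lambda>x. fst t * pos u x + fst (snd t) * neg u x + snd (snd t) * v x)"
  by (auto simp: comb_def scale_parts_def)

lemma comb_in_W:
  assumes "u \<in> W" "v \<in> W" shows "comb u v t \<in> W"
  unfolding comb_eq using W_lin[OF W_lin[OF W_pos(1)[OF assms(1)] W_neg(1)[OF assms(1)]] assms(2), of 1 _ _ "snd (snd t)"]
  by simp

lemma scale_parts_in_W: "u \<in> W \<Longrightarrow> (\<lambda>x. scale_parts a b (u x)) \<in> W"
  unfolding scale_parts_def by (intro W_lin W_pos(1) W_neg(1))

definition box3 :: "real \<Rightarrow> (real \<times> real \<times> real) set" where
  "box3 C = {t. \<bar>fst t\<bar> \<le> C \<and> \<bar>fst (snd t)\<bar> \<le> C \<and> \<bar>snd (snd t)\<bar> \<le> C}"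

lemma comb_bound:
  assumes "t \<in> box3 C" "1 \<le> C"
  shows "\<bar>comb u v t x\<bar> + \<bar>v x\<bar> \<le> 2 * C * (\<bar>pos u x\<bar> + \<bar>neg u x\<bar> + \<bar>v x\<bar>)"
    and "\<bar>incr (comb u v t) z\<bar> + \<bar>incr v z\<bar> \<le> 2 * C * (\<bar>incr (pos u) z\<bar> + \<bar>incr (neg u) z\<bar> + \<bar>incr v z\<bar>)"
proof -
  have main: "\<bar>fst t * X + fst (snd t) * Y + snd (snd t) * Z\<bar> + \<bar>Z\<bar> \<le> 2 * C * (\<bar>X\<bar> + \<bar>Y\<bar> + \<bar>Z\<bar>)" for X Y Z :: real
  proof -
    have "\<bar>fst t * X\<bar> \<le> C * \<bar>X\<bar>" "\<bar>fst (snd t) * Y\<bar> \<le> C * \<bar>Y\<bar>" "\<bar>snd (snd t) * Z\<bar> \<le> C * \<bar>Z\<bar>"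
      using assms(1) by (auto simp: box3_def abs_mult intro!: mult_right_mono)
    moreover have "\<bar>Z\<bar> \<le> C * \<bar>Z\<bar>" "0 \<le> C * \<bar>X\<bar>" "0 \<le> C * \<bar>Y\<bar>"
      using mult_right_mono[OF assms(2), of "\<bar>Z\<bar>"] assms(2) by simp_all
    ultimately show ?thesis unfolding distrib_left by linarith
  qed
  show "\<bar>comb u v t x\<bar> + \<bar>v x\<bar> \<le> 2 * C * (\<bar>pos u x\<bar> + \<bar>neg u x\<bar> + \<bar>v x\<bar>)"
    using main[of "pos u x" "neg u x" "v x"] by (simp add: comb_eq)
  have "incr (comb u v t) z = fst t * incr (pos u) z + fst (snd t) * incr (neg u) z + snd (snd t) * incr v z"
    by (simp add: comb_eq incr_def algebra_simps)
  then show "\<bar>incr (comb u v t) z\<bar> + \<bar>incr v z\<bar> \<le> 2 * C * (\<bar>incr (pos u) z\<bar> + \<bar>incr (neg u) z\<bar> + \<bar>incr v z\<bar>)"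
    using main[of "incr (pos u) z" "incr (neg u) z" "incr v z"] by simp
qed

lemma Lp_abs: "U \<in> Lp M k \<Longrightarrow> (\<lambda>x. \<bar>U x\<bar>) \<in> Lp M k"
  by (auto simp: Lp_def)

lemma continuous_on_comb:
  assumes u: "u \<in> W" and v: "v \<in> W" and C: "1 \<le> C"
    and \<beta>W: "\<And>t. \<beta> t \<in> W" and \<beta>c: "\<And>x. continuous_on UNIV (\<lambda>t. \<beta> t x)"
    and \<beta>1: "\<And>t x. \<bar>\<beta> t x\<bar> \<le> \<bar>comb u v t x\<bar> + \<bar>v x\<bar>"
    and \<beta>2: "\<And>t z. \<bar>incr (\<beta> t) z\<bar> \<le> \<bar>incr (comb u v t) z\<bar> + \<bar>incr v z\<bar>"
  shows "continuous_on (box3 C) (\<lambda>t. dA (comb u v t) (\<beta> t))"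
    and "continuous_on (box3 C) (\<lambda>t. dR (comb u v t) (\<beta> t))"
    and "continuous_on (box3 C) (\<lambda>t. dJ (comb u v t) (\<beta> t))"
proof -
  define N where "N = (\<lambda>x. 2 * C * (\<bar>pos u x\<bar> + \<bar>neg u x\<bar> + \<bar>v x\<bar>))"
  define N' where "N' = (\<lambda>z. 2 * C * (\<bar>incr (pos u) z\<bar> + \<bar>incr (neg u) z\<bar> + \<bar>incr v z\<bar>))"
  have N0: "0 \<le> N x" "0 \<le> N' z" for x z using C by (simp_all add: N_def N'_def)
  have Nh: "N \<in> Lp hmeas p" and Nr: "N \<in> Lp lebesgue r" and N': "N' \<in> Lp gmeas p"
    unfolding N_def N'_def
    by (intro Lp_scale(1) Lp_add(1) Lp_abs W_hmeas_Lp W_r W_incr_Lp W_pos(1) W_neg(1) u v p0 less_imp_le[OF r(2)])+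
  have cc: "continuous_on S (\<lambda>t. comb u v t x)" for x S
    unfolding comb_eq by (intro continuous_intros)
  have bc: "continuous_on S (\<lambda>t. \<beta> t x)" for x S using continuous_on_subset[OF \<beta>c] by blast
  have cW: "comb u v t \<in> W" for t by (rule comb_in_W[OF u v])
  have b: "\<bar>comb u v t x\<bar> \<le> N x" "\<bar>\<beta> t x\<bar> \<le> N x"
    "\<bar>incr (comb u v t) z\<bar> \<le> N' z" "\<bar>incr (\<beta> t) z\<bar> \<le> N' z" if "t \<in> box3 C" for t x z
  proof -
    have 1: "\<bar>comb u v t x\<bar> + \<bar>v x\<bar> \<le> N x" unfolding N_def by (rule comb_bound(1)[OF that C])
    have 2: "\<bar>incr (comb u v t) z\<bar> + \<bar>incr v z\<bar> \<le> N' z" unfolding N'_def by (rule comb_bound(2)[OF that C])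
    show "\<bar>comb u v t x\<bar> \<le> N x" using 1 abs_ge_zero[of "v x"] by linarith
    show "\<bar>\<beta> t x\<bar> \<le> N x" using 1 \<beta>1 by (rule order.trans[rotated])
    show "\<bar>incr (comb u v t) z\<bar> \<le> N' z" using 2 abs_ge_zero[of "incr v z"] by linarith
    show "\<bar>incr (\<beta> t) z\<bar> \<le> N' z" using 2 \<beta>2 by (rule order.trans[rotated])
  qed
  have g: "continuous_on (box3 C) (\<lambda>t. LINT z|gmeas. dpow p (incr (comb u v t) z) * incr (\<beta> t) z)"
    by (rule continuous_on_dpow_pairing[OF p N' N0(2)])
       (auto simp: incr_def[abs_def] intro!: continuous_on_diff cc bc b[unfolded incr_def]
         measurable_compose[OF _ incr_measurable_gag] incr_measurable_gag[unfolded incr_def[abs_def]] W_meas cW \<beta>W)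
  have h: "continuous_on (box3 C) (\<lambda>t. LINT x|hmeas. dpow p (comb u v t x) * \<beta> t x)"
    by (rule continuous_on_dpow_pairing[OF p Nh N0(1)]) (intro cc bc b hmeas_measurable W_meas cW \<beta>W; assumption)+
  show A: "continuous_on (box3 C) (\<lambda>t. dA (comb u v t) (\<beta> t))"
    unfolding dA_def by (intro continuous_intros g h)
  show R: "continuous_on (box3 C) (\<lambda>t. dR (comb u v t) (\<beta> t))"
    unfolding dR_def
    by (rule continuous_on_dpow_pairing[OF r(1) Nr N0(1)]) (intro cc bc b W_meas cW \<beta>W; assumption)+
  show "continuous_on (box3 C) (\<lambda>t. dJ (comb u v t) (\<beta> t))"
    unfolding dJ_def by (intro continuous_intros A R)
qed

lemma comb_continuous: "continuous_on S (\<lambda>t. comb u v t x)"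
  unfolding comb_eq by (intro continuous_intros)

lemma continuous_on_comb_instances:
  assumes u: "u \<in> W" and v: "v \<in> W" and C: "1 \<le> C"
  shows "continuous_on (box3 C) (\<lambda>t. dJ (comb u v t) v)"
    and "continuous_on (box3 C) (\<lambda>t. dJ (comb u v t) (pos (comb u v t)))"
    and "continuous_on (box3 C) (\<lambda>t. dJ (comb u v t) (neg (comb u v t)))"
    and "continuous_on (box3 C) (\<lambda>t. dR (comb u v t) (pos (comb u v t)))"
    and "continuous_on (box3 C) (\<lambda>t. dR (comb u v t) (neg (comb u v t)))"
    and "continuous_on (box3 C) (\<lambda>t. J (comb u v t))"
proof -
  note cW = comb_in_W[OF u v]
  show "continuous_on (box3 C) (\<lambda>t. dJ (comb u v t) v)"
    by (rule continuous_on_comb(3)[OF u v C]) (use v in auto)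
  have pc: "continuous_on UNIV (\<lambda>t. pos (comb u v t) x)" "continuous_on UNIV (\<lambda>t. neg (comb u v t) x)" for x
    by (intro continuous_on_max continuous_on_min comb_continuous continuous_intros)+
  have pb: "\<bar>pos (comb u v t) x\<bar> \<le> \<bar>comb u v t x\<bar> + \<bar>v x\<bar>" "\<bar>neg (comb u v t) x\<bar> \<le> \<bar>comb u v t x\<bar> + \<bar>v x\<bar>"
    "\<bar>incr (pos (comb u v t)) z\<bar> \<le> \<bar>incr (comb u v t) z\<bar> + \<bar>incr v z\<bar>"
    "\<bar>incr (neg (comb u v t)) z\<bar> \<le> \<bar>incr (comb u v t) z\<bar> + \<bar>incr v z\<bar>" for t x z
    unfolding incr_def by linarith+
  note P = continuous_on_comb[OF u v C W_pos(1)[OF cW] pc(1) pb(1,3)]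
  note N = continuous_on_comb[OF u v C W_neg(1)[OF cW] pc(2) pb(2,4)]
  show "continuous_on (box3 C) (\<lambda>t. dJ (comb u v t) (pos (comb u v t)))"
    "continuous_on (box3 C) (\<lambda>t. dR (comb u v t) (pos (comb u v t)))" by (fact P)+
  show "continuous_on (box3 C) (\<lambda>t. dJ (comb u v t) (neg (comb u v t)))"
    "continuous_on (box3 C) (\<lambda>t. dR (comb u v t) (neg (comb u v t)))" by (fact N)+
  have "continuous_on (box3 C) (\<lambda>t. dA (comb u v t) (comb u v t) / p - \<Lambda> / r * dR (comb u v t) (comb u v t))"
    using p0 r by (intro continuous_intros continuous_on_comb[OF u v C cW comb_continuous]) auto
  then show "continuous_on (box3 C) (\<lambda>t. J (comb u v t))" by (simp add: J_def dA_self dR_self)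
qed

lemma dR_pos: "dR u (pos u) = R (pos u)" and dR_neg: "dR u (neg u) = R (neg u)"
  unfolding dR_def R_def Lp_pow_def using scale_parts_pointwise(3,4)[of 0 0 r] r by simp_all

lemma dA_parts: "u \<in> W \<Longrightarrow> dA u (pos u) + dA u (neg u) = A u"
  and R_parts: "u \<in> W \<Longrightarrow> R (pos u) + R (neg u) = R u"
proof -
  assume u: "u \<in> W"
  have e: "(\<lambda>x. 1 * pos u x + 1 * neg u x) = u" by (auto simp: max_def min_def)
  show "dA u (pos u) + dA u (neg u) = A u"
    using dA_lin[OF u W_pos(1)[OF u] W_neg(1)[OF u], of 1 1] unfolding e by (simp add: dA_self)
  show "R (pos u) + R (neg u) = R u"
    using dR_lin[OF u W_pos(1)[OF u] W_neg(1)[OF u], of 1 1] unfolding e by (simp add: dR_self dR_pos dR_neg)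
qed

lemma A_scale_parts_le:
  assumes u: "u \<in> W" and a: "0 \<le> a" "0 \<le> b"
  shows "A (\<lambda>x. scale_parts a b (u x)) \<le> a powr p * dA u (pos u) + b powr p * dA u (neg u)"
proof -
  have w: "(\<lambda>x. scale_parts a b (u x)) \<in> W" by (rule scale_parts_in_W[OF u])
  note ig = int_gag[OF u W_pos(1)[OF u]] int_gag[OF u W_neg(1)[OF u]]
  note ih = int_h[OF u W_pos(1)[OF u]] int_h[OF u W_neg(1)[OF u]]
  have "E (\<lambda>x. scale_parts a b (u x)) \<le> (LINT z|gmeas. a powr p * (dpow p (incr u z) * incr (pos u) z)
      + b powr p * (dpow p (incr u z) * incr (neg u) z))"
    unfolding E_def Lp_pow_def
  proof (rule integral_mono)
    show "\<bar>incr (\<lambda>x. scale_parts a b (u x)) z\<bar> powr p \<le> a powr p * (dpow p (incr u z) * incr (pos u) z)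
      + b powr p * (dpow p (incr u z) * incr (neg u) z)" for z
      unfolding incr_def by (rule scale_parts_incr_upper[OF p a])
  qed (use Lp_integrable[OF W_incr_Lp[OF w]] ig in auto)
  also have "\<dots> = a powr p * (LINT z|gmeas. dpow p (incr u z) * incr (pos u) z)
      + b powr p * (LINT z|gmeas. dpow p (incr u z) * incr (neg u) z)"
    using ig by simp
  finally have 1: "E (\<lambda>x. scale_parts a b (u x)) \<le> \<dots>" .
  have "H (\<lambda>x. scale_parts a b (u x)) = a powr p * (LINT x|hmeas. dpow p (u x) * pos u x)
      + b powr p * (LINT x|hmeas. dpow p (u x) * neg u x)"
    unfolding H_def Lp_pow_def scale_parts_pointwise(1)[OF a p0(1)] using ih by simp
  then show ?thesis using 1 unfolding A_def dA_def by (simp add: algebra_simps)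
qed

text \<open>
  The interaction of the parts only adds to \<open>A\<close>: at pairs of opposite signs the power is superadditive.
\<close>
lemma A_scale_parts_ge:
  assumes u: "u \<in> W" and a: "0 \<le> a" "0 \<le> b"
  shows "a powr p * A (pos u) + b powr p * A (neg u) \<le> A (\<lambda>x. scale_parts a b (u x))"
proof -
  have w: "(\<lambda>x. scale_parts a b (u x)) \<in> W" by (rule scale_parts_in_W[OF u])
  note ig = Lp_integrable[OF W_incr_Lp[OF W_pos(1)[OF u]]] Lp_integrable[OF W_incr_Lp[OF W_neg(1)[OF u]]]
  note ih = Lp_integrable[OF W_hmeas_Lp[OF W_pos(1)[OF u]]] Lp_integrable[OF W_hmeas_Lp[OF W_neg(1)[OF u]]]
  have "a powr p * E (pos u) + b powr p * E (neg u)
     = (LINT z|gmeas. a powr p * \<bar>incr (pos u) z\<bar> powr p + b powr p * \<bar>incr (neg u) z\<bar> powr p)"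
    unfolding E_def Lp_pow_def using ig by simp
  also have "\<dots> \<le> E (\<lambda>x. scale_parts a b (u x))"
    unfolding E_def Lp_pow_def
  proof (rule integral_mono)
    show "a powr p * \<bar>incr (pos u) z\<bar> powr p + b powr p * \<bar>incr (neg u) z\<bar> powr p
       \<le> \<bar>incr (\<lambda>x. scale_parts a b (u x)) z\<bar> powr p" for z
      unfolding incr_def by (rule scale_parts_incr_lower[OF p a])
  qed (use Lp_integrable[OF W_incr_Lp[OF w]] ig in auto)
  finally have 1: "a powr p * E (pos u) + b powr p * E (neg u) \<le> E (\<lambda>x. scale_parts a b (u x))" .
  have "H (\<lambda>x. scale_parts a b (u x)) = a powr p * H (pos u) + b powr p * H (neg u)"
    unfolding H_def Lp_pow_def scale_parts_pointwise(1)[OF a p0(1)] scale_parts_pointwise(3,4)[OF a p0(1)]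
    using ih by simp
  then show ?thesis using 1 unfolding A_def by (simp add: algebra_simps)
qed

lemma R_scale_parts:
  assumes u: "u \<in> W" and a: "0 \<le> a" "0 \<le> b"
  shows "R (\<lambda>x. scale_parts a b (u x)) = a powr r * R (pos u) + b powr r * R (neg u)"
  using Lp_integrable[OF W_r[OF W_pos(1)[OF u]]] Lp_integrable[OF W_r[OF W_neg(1)[OF u]]]
  unfolding R_def Lp_pow_def scale_parts_pointwise(1)[OF a r(2)] scale_parts_pointwise(3,4)[OF a r(2)]
  by simp

lemma dJ_scale_parts_pos:
  assumes u: "u \<in> W" and a: "0 \<le> a" "0 \<le> b"
  defines "w \<equiv> \<lambda>x. scale_parts a b (u x)"
  shows "b \<le> a \<Longrightarrow> dJ w (pos w) \<le> a powr p * dA u (pos u) - \<Lambda> * (a powr r * R (pos u))"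
    and "a \<le> b \<Longrightarrow> a powr p * dA u (pos u) - \<Lambda> * (a powr r * R (pos u)) \<le> dJ w (pos w)"
proof -
  have w: "w \<in> W" unfolding w_def by (rule scale_parts_in_W[OF u])
  have pw: "pos w = (\<lambda>x. a * pos u x)" unfolding w_def by (simp add: scale_parts_pos[OF a])
  note iw = int_gag[OF w W_pos(1)[OF w]] and iu = int_gag[OF u W_pos(1)[OF u]]
  have inc: "incr w z = scale_parts a b (u (fst z)) - scale_parts a b (u (snd z))"
    "incr (pos w) z = a * pos u (fst z) - a * pos u (snd z)" for z
    unfolding pw by (simp_all add: incr_def w_def)
  have h: "(LINT x|hmeas. dpow p (w x) * pos w x) = a powr p * (LINT x|hmeas. dpow p (u x) * pos u x)"
    unfolding w_def scale_parts_pos[OF a] scale_parts_pointwise(2)[OF a p0(1)] by simp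
  have R: "dR w (pos w) = a powr r * R (pos u)"
    unfolding dR_pos unfolding pw using R_scale[OF W_pos(1)[OF u], of a] a by simp
  have gu: "(LINT z|gmeas. a powr p * (dpow p (incr u z) * incr (pos u) z))
     = a powr p * (LINT z|gmeas. dpow p (incr u z) * incr (pos u) z)" by simp
  show "dJ w (pos w) \<le> a powr p * dA u (pos u) - \<Lambda> * (a powr r * R (pos u))" if "b \<le> a"
  proof -
    have "(LINT z|gmeas. dpow p (incr w z) * incr (pos w) z)
       \<le> (LINT z|gmeas. a powr p * (dpow p (incr u z) * incr (pos u) z))"
    proof (rule integral_mono[OF iw])
      show "dpow p (incr w z) * incr (pos w) z \<le> a powr p * (dpow p (incr u z) * incr (pos u) z)" for z
        unfolding inc unfolding incr_def by (rule scale_parts_flux(1)[OF p a that])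
    qed (use iu in simp)
    then show ?thesis unfolding dJ_def dA_def R h gu by (simp add: algebra_simps)
  qed
  show "a powr p * dA u (pos u) - \<Lambda> * (a powr r * R (pos u)) \<le> dJ w (pos w)" if "a \<le> b"
  proof -
    have "(LINT z|gmeas. a powr p * (dpow p (incr u z) * incr (pos u) z))
       \<le> (LINT z|gmeas. dpow p (incr w z) * incr (pos w) z)"
    proof (rule integral_mono[OF _ iw])
      show "a powr p * (dpow p (incr u z) * incr (pos u) z) \<le> dpow p (incr w z) * incr (pos w) z" for z
        unfolding inc unfolding incr_def by (rule scale_parts_flux(2)[OF p a that])
    qed (use iu in simp)
    then show ?thesis unfolding dJ_def dA_def R h gu by (simp add: algebra_simps)
  qed
qed

lemma W_minus: "u \<in> W \<Longrightarrow> (\<lambda>x. - u x) \<in> W"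
  using W_scale[of u "-1"] by simp

lemma pos_minus: "pos (\<lambda>x. - u x) = (\<lambda>x. - neg u x)"
  by (auto simp: max_def min_def)

text \<open>
  Exchanging \<open>u\<close> with \<open>- u\<close> turns statements on the positive part into statements on the negative part.
\<close>
lemma dA_minus: "dA (\<lambda>x. - u x) (\<lambda>x. - v x) = dA u v"
  and dJ_minus: "dJ (\<lambda>x. - u x) (\<lambda>x. - v x) = dJ u v"
  and R_minus: "R (\<lambda>x. - u x) = R u"
proof -
  have i: "incr (\<lambda>x. - u x) = (\<lambda>z. - incr u z)" for u :: "'a \<Rightarrow> real" by (auto simp: incr_def)
  show "dA (\<lambda>x. - u x) (\<lambda>x. - v x) = dA u v" by (simp add: dA_def i)
  then show "dJ (\<lambda>x. - u x) (\<lambda>x. - v x) = dJ u v" by (simp add: dJ_def dR_def)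
  show "R (\<lambda>x. - u x) = R u" by (simp add: R_def Lp_pow_def)
qed

lemma dJ_scale_parts_neg:
  assumes u: "u \<in> W" and a: "0 \<le> a" "0 \<le> b"
  defines "w \<equiv> \<lambda>x. scale_parts a b (u x)"
  shows "a \<le> b \<Longrightarrow> dJ w (neg w) \<le> b powr p * dA u (neg u) - \<Lambda> * (b powr r * R (neg u))"
    and "b \<le> a \<Longrightarrow> b powr p * dA u (neg u) - \<Lambda> * (b powr r * R (neg u)) \<le> dJ w (neg w)"
  using dJ_scale_parts_pos[OF W_minus[OF u] a(2,1)]
  unfolding scale_parts_minus pos_minus dA_minus R_minus dJ_minus w_def by blast+

end

section \<open>The nodal Nehari set\<close>

lemma ex_small_powr_dominates:
  fixes x y T p r :: real
  assumes "0 < x" "0 < y" "0 < T" "p < r"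
  obtains a where "0 < a" "a < T" "a powr r * y < a powr p * x"
proof
  define a where "a = min (T / 2) ((x / (2 * y)) powr (1 / (r - p)))"
  show a: "0 < a" "a < T" using assms by (simp_all add: a_def)
  have "a powr (r - p) \<le> ((x / (2 * y)) powr (1 / (r - p))) powr (r - p)"
    using assms a by (intro powr_mono2) (auto simp: a_def)
  also have "\<dots> = x / (2 * y)" using assms by (simp add: powr_powr)
  finally have "a powr (r - p) * y \<le> x / 2" using assms by (simp add: field_simps)
  then have "a powr (r - p) * y < x" using assms by linarith
  then have "a powr p * (a powr (r - p) * y) < a powr p * x" using a by (intro mult_strict_left_mono) auto
  then show "a powr r * y < a powr p * x" using a by (simp add: mult.assoc[symmetric] powr_add[symmetric])
qed

lemma ex_large_powr_dominates:
  fixes x y p r :: real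
  assumes "0 < x" "0 < y" "p < r"
  obtains T where "1 \<le> T" "T powr p * x \<le> T powr r * y"
proof
  define T where "T = max 1 ((x / y) powr (1 / (r - p)))"
  show T: "1 \<le> T" by (simp add: T_def)
  have "((x / y) powr (1 / (r - p))) powr (r - p) \<le> T powr (r - p)"
    using assms by (intro powr_mono2) (auto simp: T_def)
  then have "x \<le> T powr (r - p) * y" using assms by (simp add: powr_powr field_simps)
  then have "T powr p * x \<le> T powr p * (T powr (r - p) * y)" by (intro mult_left_mono) auto
  then show "T powr p * x \<le> T powr r * y" using T by (simp add: mult.assoc[symmetric] powr_add[symmetric])
qed

text \<open>The two-dimensional intermediate value theorem of Miranda, from Brouwer's theorem.\<close>
lemma miranda:
  fixes f g :: "real \<times> real \<Rightarrow> real"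
  assumes lh: "l < h"
    and f: "continuous_on ({l..h} \<times> {l..h}) f" and g: "continuous_on ({l..h} \<times> {l..h}) g"
    and f_l: "\<And>b. b \<in> {l..h} \<Longrightarrow> 0 < f (l, b)" and f_h: "\<And>b. b \<in> {l..h} \<Longrightarrow> f (h, b) < 0"
    and g_l: "\<And>a. a \<in> {l..h} \<Longrightarrow> 0 < g (a, l)" and g_h: "\<And>a. a \<in> {l..h} \<Longrightarrow> g (a, h) < 0"
  obtains a b where "a \<in> {l..h}" "b \<in> {l..h}" "f (a, b) = 0" "g (a, b) = 0"
proof -
  define S where "S = {l..h} \<times> {l..h}"
  \<comment> \<open>At a fixed point the clamping can only be active on a side, and there the field points inwards.\<close>
  define F where "F = (\<lambda>t. (max l (min h (fst t + f t)), max l (min h (snd t + g t))))"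
  have "continuous_on S F"
    unfolding F_def S_def
    by (intro continuous_on_Pair continuous_on_max continuous_on_min continuous_intros f g)
  moreover have "compact S" "convex S" "S \<noteq> {}"
    using lh by (auto simp: S_def intro!: compact_Times convex_Times)
  moreover have "F \<in> S \<rightarrow> S" using lh by (auto simp: F_def S_def)
  ultimately obtain t where t: "t \<in> S" "F t = t" using brouwer[of S F] by metis
  obtain a b where ab: "t = (a, b)" by (cases t)
  have a: "a \<in> {l..h}" "max l (min h (a + f (a, b))) = a" and b: "b \<in> {l..h}" "max l (min h (b + g (a, b))) = b"
    using t by (auto simp: ab S_def F_def)
  have "f (a, b) = 0"
  proof (rule ccontr)
    assume "f (a, b) \<noteq> 0"
    then have "0 < f (a, b) \<and> a = h \<or> f (a, b) < 0 \<and> a = l" using a by (auto simp: max_def min_def split: if_splits)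
    then show False using f_l[OF b(1)] f_h[OF b(1)] by auto
  qed
  moreover have "g (a, b) = 0"
  proof (rule ccontr)
    assume "g (a, b) \<noteq> 0"
    then have "0 < g (a, b) \<and> b = h \<or> g (a, b) < 0 \<and> b = l" using b by (auto simp: max_def min_def split: if_splits)
    then show False using g_l[OF a(1)] g_h[OF a(1)] by auto
  qed
  ultimately show ?thesis using a(1) b(1) by (intro that)
qed

text \<open>
  Uniform continuity on the compact strip, with the margin given by the maximum over \<open>e = 0\<close>.
\<close>
lemma negative_persists:
  fixes f :: "real \<times> real \<Rightarrow> real"
  assumes cont: "continuous_on ({l..h} \<times> {0..\<delta>}) f" and \<delta>: "0 < \<delta>" and lh: "l \<le> h"
    and neg: "\<And>b. b \<in> {l..h} \<Longrightarrow> f (b, 0) < 0"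
  shows "\<exists>e0. 0 < e0 \<and> e0 \<le> \<delta> \<and> (\<forall>b\<in>{l..h}. \<forall>e\<in>{0..e0}. f (b, e) < 0)"
proof -
  have "continuous_on {l..h} (\<lambda>b. f (b, 0))"
    by (rule continuous_on_compose2[OF cont]) (use \<delta> in \<open>auto intro!: continuous_intros\<close>)
  then obtain c where c: "c \<in> {l..h}" "\<And>b. b \<in> {l..h} \<Longrightarrow> f (b, 0) \<le> f (c, 0)"
    using continuous_attains_sup[of "{l..h}" "\<lambda>b. f (b, 0)"] lh by auto
  have "uniformly_continuous_on ({l..h} \<times> {0..\<delta>}) f"
    by (intro compact_uniformly_continuous cont compact_Times) auto
  moreover have "0 < - f (c, 0)" using neg[OF c(1)] by simp
  ultimately obtain d where d: "0 < d" "\<And>t t'. t \<in> {l..h} \<times> {0..\<delta>} \<Longrightarrow> t' \<in> {l..h} \<times> {0..\<delta>} \<Longrightarrow>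
      dist t' t < d \<Longrightarrow> dist (f t') (f t) < - f (c, 0)"
    unfolding uniformly_continuous_on_def by metis
  show ?thesis
  proof (intro exI[of _ "min \<delta> (d / 2)"] conjI ballI)
    fix b e assume b: "b \<in> {l..h}" and e: "e \<in> {0..min \<delta> (d / 2)}"
    have "dist (b, e) (b, 0) < d" using e d(1) by (simp add: dist_Pair_Pair dist_real_def)
    then have "dist (f (b, e)) (f (b, 0)) < - f (c, 0)" using b e \<delta> by (intro d(2)) auto
    then show "f (b, e) < 0" using c(2)[OF b] by (simp add: dist_real_def)
  qed (use d \<delta> in auto)
qed

context hardy_problem
begin

text \<open>
  All sign-changing solutions belong to this set, since their differential vanishes in particular on the
  two signed parts.
\<close>
definition nodal :: "('a \<Rightarrow> real) set" where
  "nodal = {u \<in> W. 0 < R (pos u) \<and> 0 < R (neg u) \<and> dJ u (pos u) = 0 \<and> dJ u (neg u) = 0}"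

lemma nodal_dA:
  assumes "u \<in> nodal"
  shows "dA u (pos u) = \<Lambda> * R (pos u)" "dA u (neg u) = \<Lambda> * R (neg u)" "A u = \<Lambda> * R u"
proof -
  show 1: "dA u (pos u) = \<Lambda> * R (pos u)" and 2: "dA u (neg u) = \<Lambda> * R (neg u)"
    using assms by (simp_all add: nodal_def dJ_def dR_pos dR_neg)
  have "u \<in> W" using assms by (simp add: nodal_def)
  then show "A u = \<Lambda> * R u"
    using dA_parts[of u] R_parts[of u] 1 2 by (simp add: distrib_left[symmetric])
qed

text \<open>
  With \<open>dA u (pos u) = \<Lambda> R (pos u)\<close>, and the same for the negative part, the convexity bound splits
  into two one-variable functions, each maximal at \<open>1\<close>.
\<close>
lemma nodal_fibre_le:
  assumes u: "u \<in> nodal" and a: "0 \<le> a" "0 \<le> b"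
  shows "J (\<lambda>x. scale_parts a b (u x)) \<le> J u"
proof -
  have uW: "u \<in> W" using u by (simp add: nodal_def)
  have "J (\<lambda>x. scale_parts a b (u x)) \<le> (a powr p * (\<Lambda> * R (pos u)) + b powr p * (\<Lambda> * R (neg u))) / p
      - \<Lambda> / r * (a powr r * R (pos u) + b powr r * R (neg u))"
    unfolding J_def R_scale_parts[OF uW a]
    using A_scale_parts_le[OF uW a] p0 unfolding nodal_dA[OF u] by (intro diff_right_mono divide_right_mono) auto
  also have "\<dots> = \<Lambda> * R (pos u) * (a powr p / p - a powr r / r) + \<Lambda> * R (neg u) * (b powr p / p - b powr r / r)"
    using p0 r by (simp add: field_simps)
  also have "\<dots> \<le> \<Lambda> * R (pos u) * (1 / p - 1 / r) + \<Lambda> * R (neg u) * (1 / p - 1 / r)"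
    using \<Lambda> a p0 pr by (intro add_mono mult_left_mono powr_fibre_le) auto
  also have "\<dots> = (1 / p - 1 / r) * (\<Lambda> * (R (pos u) + R (neg u)))"
    by (simp only: distrib_left mult_ac)
  also have "\<dots> = J u" unfolding R_parts[OF uW] by (simp only: J_on_nehari[OF nodal_dA(3)[OF u]])
  finally show ?thesis .
qed

text \<open>
  The case \<open>(a, b) = (1, 0)\<close> and \<open>(0, 1)\<close> of the convexity bound.
\<close>
lemma A_pos_le: "u \<in> W \<Longrightarrow> A (pos u) \<le> dA u (pos u)" and A_neg_le: "u \<in> W \<Longrightarrow> A (neg u) \<le> dA u (neg u)"
  using A_scale_parts_le[of u 1 0] A_scale_parts_le[of u 0 1] p0 by (simp_all add: scale_parts_def)

text \<open>
  \<open>J\<close> is negative on the far sides of a large square, and near the axes it increases away from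
  them because the interaction of the two parts only adds energy. So the maximum over the square
  is attained at an interior point, and there both partial derivatives vanish.
\<close>
lemma nodal_scaling:
  assumes u: "u \<in> W" and Rp: "0 < R (pos u)" and Rn: "0 < R (neg u)"
  obtains a b where "0 < a" "0 < b" "(\<lambda>x. scale_parts a b (u x)) \<in> nodal"
proof -
  have pW: "pos u \<in> W" and nW: "neg u \<in> W" using u W_pos W_neg by auto
  have Ap: "0 < A (pos u)" and An: "0 < A (neg u)" using R_pos_A_pos pW nW Rp Rn by auto
  \<comment> \<open>\<open>J\<close> as a function of the two scaling parameters; \<open>T\<close> below is the side of the square.\<close>
  define \<Psi> where "\<Psi> = (\<lambda>a b. J (\<lambda>x. scale_parts a b (u x)))"
  have Rmin: "0 < \<Lambda> / r * min (R (pos u)) (R (neg u))" using \<Lambda> r Rp Rn by simp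
  have "0 < R u" using R_parts[OF u] Rp Rn by linarith
  then have Au: "0 < A u / p" using R_pos_A_pos[OF u] p0 by simp
  obtain T where T: "1 \<le> T" "T powr p * (A u / p) \<le> T powr r * (\<Lambda> / r * min (R (pos u)) (R (neg u)))"
    by (rule ex_large_powr_dominates[OF Au Rmin pr])
  have far: "\<Psi> a b \<le> 0" if ab: "a \<in> {0..T}" "b \<in> {0..T}" "a = T \<or> b = T" for a b
  proof -
    have a0: "0 \<le> a" "0 \<le> b" using ab by auto
    have dp: "0 \<le> dA u (pos u)" "0 \<le> dA u (neg u)" using A_pos_le[OF u] A_neg_le[OF u] Ap An by linarith+
    have "A (\<lambda>x. scale_parts a b (u x)) \<le> a powr p * dA u (pos u) + b powr p * dA u (neg u)"
      by (rule A_scale_parts_le[OF u a0])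
    also have "\<dots> \<le> T powr p * dA u (pos u) + T powr p * dA u (neg u)"
      using ab dp p0 by (intro add_mono mult_right_mono powr_mono2) auto
    also have "\<dots> = T powr p * A u" using dA_parts[OF u] by (simp add: distrib_left[symmetric])
    finally have 1: "A (\<lambda>x. scale_parts a b (u x)) / p \<le> T powr p * (A u / p)"
      using p0 by (simp add: divide_right_mono)
    have "T powr r * min (R (pos u)) (R (neg u)) \<le> a powr r * R (pos u) + b powr r * R (neg u)"
      using ab(3)
    proof
      assume "a = T"
      then show ?thesis using mult_left_mono[of "min (R (pos u)) (R (neg u))" "R (pos u)" "T powr r"]
        by (simp add: add_increasing2)
    next
      assume "b = T"
      then show ?thesis using mult_left_mono[of "min (R (pos u)) (R (neg u))" "R (neg u)" "T powr r"]
        by (simp add: add_increasing)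
    qed
    then have "\<Lambda> / r * (T powr r * min (R (pos u)) (R (neg u))) \<le> \<Lambda> / r * R (\<lambda>x. scale_parts a b (u x))"
      unfolding R_scale_parts[OF u a0] using \<Lambda> r by (intro mult_left_mono) auto
    then have "T powr r * (\<Lambda> / r * min (R (pos u)) (R (neg u))) \<le> \<Lambda> / r * R (\<lambda>x. scale_parts a b (u x))"
      by (simp only: mult.left_commute)
    then show ?thesis using 1 T(2) unfolding \<Psi>_def J_def by linarith
  qed
  have comb0: "comb u u (a, b, 0) = (\<lambda>x. scale_parts a b (u x))" for a b by (auto simp: comb_def)
  have "continuous_on ({0..T} \<times> {0..T}) (\<lambda>t. J (comb u u (fst t, snd t, 0)))"
    by (rule continuous_on_compose2[OF continuous_on_comb_instances(6)[OF u u T(1)]])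
       (use T(1) in \<open>auto simp: box3_def intro!: continuous_intros\<close>)
  then have "continuous_on ({0..T} \<times> {0..T}) (\<lambda>t. \<Psi> (fst t) (snd t))" unfolding comb0 \<Psi>_def .
  moreover have "compact ({0..T} \<times> {0..T})" "{0..T} \<times> {0..T} \<noteq> {}" using T(1) by (auto intro: compact_Times)
  ultimately obtain t where t: "t \<in> {0..T} \<times> {0..T}" "\<And>s. s \<in> {0..T} \<times> {0..T} \<Longrightarrow> \<Psi> (fst s) (snd s) \<le> \<Psi> (fst t) (snd t)"
    using continuous_attains_sup[of "{0..T} \<times> {0..T}" "\<lambda>t. \<Psi> (fst t) (snd t)"] by blast
  define a where "a = fst t"
  define b where "b = snd t"
  have ab: "a \<in> {0..T}" "b \<in> {0..T}" using t(1) by (auto simp: a_def b_def)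
  have max: "\<Psi> a' b' \<le> \<Psi> a b" if "a' \<in> {0..T}" "b' \<in> {0..T}" for a' b'
    using t(2)[of "(a', b')"] that by (simp add: a_def b_def)
  \<comment> \<open>Leaving an axis gains at least the energy of the added part.\<close>
  have low: "c powr p * A (pos u) / p - \<Lambda> / r * (c powr r * R (pos u)) + \<Psi> 0 d \<le> \<Psi> c d"
    "d powr p * A (neg u) / p - \<Lambda> / r * (d powr r * R (neg u)) + \<Psi> c 0 \<le> \<Psi> c d"
    if "0 \<le> c" "0 \<le> d" for c d
  proof -
    have z: "(\<lambda>x. scale_parts 0 d (u x)) = (\<lambda>x. d * neg u x)" "(\<lambda>x. scale_parts c 0 (u x)) = (\<lambda>x. c * pos u x)"
      by (auto simp: scale_parts_def)
    have "(c powr p * A (pos u) + d powr p * A (neg u)) / p \<le> A (\<lambda>x. scale_parts c d (u x)) / p"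
      using A_scale_parts_ge[OF u that] p0 by (intro divide_right_mono) auto
    then show "c powr p * A (pos u) / p - \<Lambda> / r * (c powr r * R (pos u)) + \<Psi> 0 d \<le> \<Psi> c d"
      "d powr p * A (neg u) / p - \<Lambda> / r * (d powr r * R (neg u)) + \<Psi> c 0 \<le> \<Psi> c d"
      using that unfolding \<Psi>_def z J_def R_scale_parts[OF u that] A_scale[OF pW] A_scale[OF nW] R_scale[OF pW] R_scale[OF nW]
      by (simp_all add: add_divide_distrib distrib_left)
  qed
  have T0: "0 < T" using T(1) by linarith
  have gain: "\<exists>c. 0 < c \<and> c < T \<and> 0 < c powr p * X / p - \<Lambda> / r * (c powr r * Y)" if "0 < X" "0 < Y" for X Y
  proof -
    have X: "0 < X / p" and Y: "0 < \<Lambda> / r * Y" using that p0 \<Lambda> r by auto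
    obtain c where c: "0 < c" "c < T" "c powr r * (\<Lambda> / r * Y) < c powr p * (X / p)"
      by (rule ex_small_powr_dominates[OF X Y T0 pr])
    then show ?thesis by (intro exI[of _ c]) (simp add: mult.left_commute)
  qed
  have a0: "0 < a"
  proof (rule ccontr)
    assume "\<not> 0 < a"
    then have "a = 0" using ab by simp
    obtain c where c: "0 < c" "c < T" "0 < c powr p * A (pos u) / p - \<Lambda> / r * (c powr r * R (pos u))"
      using gain[OF Ap Rp] by blast
    then have "\<Psi> 0 b < \<Psi> c b" using low(1)[of c b] ab by simp
    then show False using max[of c b] c ab \<open>a = 0\<close> by simp
  qed
  have b0: "0 < b"
  proof (rule ccontr)
    assume "\<not> 0 < b"
    then have "b = 0" using ab by simp
    obtain c where c: "0 < c" "c < T" "0 < c powr p * A (neg u) / p - \<Lambda> / r * (c powr r * R (neg u))"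
      using gain[OF An Rn] by blast
    then have "\<Psi> a 0 < \<Psi> a c" using low(2)[of a c] ab by simp
    then show False using max[of a c] c ab \<open>b = 0\<close> by simp
  qed
  have "0 < \<Psi> a b"
  proof -
    obtain c where c: "0 < c" "c < T" "0 < c powr p * A (pos u) / p - \<Lambda> / r * (c powr r * R (pos u))"
      using gain[OF Ap Rp] by blast
    have "\<Psi> 0 0 = 0" using A_scale[OF u, of 0] R_scale[OF u, of 0] p0 r by (simp add: \<Psi>_def scale_parts_def J_def)
    then have "0 < \<Psi> c 0" using low(1)[of c 0] c by simp
    then show ?thesis using max[of c 0] c T0 by simp
  qed
  then have aT: "a < T" and bT: "b < T" using far[of a b] ab by (auto simp: less_le)
  define w where "w = (\<lambda>x. scale_parts a b (u x))"
  have wW: "w \<in> W" unfolding w_def by (rule scale_parts_in_W[OF u])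
  have pw: "pos w = (\<lambda>x. a * pos u x)" and nw: "neg w = (\<lambda>x. b * neg u x)"
    using a0 b0 by (simp_all add: w_def scale_parts_pos scale_parts_neg)
  have dp: "dJ w (pos u) = 0"
  proof (rule DERIV_local_max)
    show "((\<lambda>t. J (\<lambda>x. w x + t * pos u x)) has_real_derivative dJ w (pos u)) (at 0)"
      using J_has_derivative[OF wW pW, of 0] by simp
    show "0 < min a (T - a)" using a0 aT by simp
    show "\<forall>y. \<bar>0 - y\<bar> < min a (T - a) \<longrightarrow> J (\<lambda>x. w x + y * pos u x) \<le> J (\<lambda>x. w x + 0 * pos u x)"
    proof (intro allI impI)
      fix y assume y: "\<bar>0 - y\<bar> < min a (T - a)"
      have "(\<lambda>x. w x + y * pos u x) = (\<lambda>x. scale_parts (a + y) b (u x))"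
        by (auto simp: w_def scale_parts_def algebra_simps)
      then have "J (\<lambda>x. w x + y * pos u x) = \<Psi> (a + y) b" by (simp add: \<Psi>_def)
      also have "\<dots> \<le> \<Psi> a b" using y ab by (intro max) auto
      finally show "J (\<lambda>x. w x + y * pos u x) \<le> J (\<lambda>x. w x + 0 * pos u x)" by (simp add: \<Psi>_def w_def)
    qed
  qed
  have dn: "dJ w (neg u) = 0"
  proof (rule DERIV_local_max)
    show "((\<lambda>t. J (\<lambda>x. w x + t * neg u x)) has_real_derivative dJ w (neg u)) (at 0)"
      using J_has_derivative[OF wW nW, of 0] by simp
    show "0 < min b (T - b)" using b0 bT by simp
    show "\<forall>y. \<bar>0 - y\<bar> < min b (T - b) \<longrightarrow> J (\<lambda>x. w x + y * neg u x) \<le> J (\<lambda>x. w x + 0 * neg u x)"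
    proof (intro allI impI)
      fix y assume y: "\<bar>0 - y\<bar> < min b (T - b)"
      have "(\<lambda>x. w x + y * neg u x) = (\<lambda>x. scale_parts a (b + y) (u x))"
        by (auto simp: w_def scale_parts_def algebra_simps)
      then have "J (\<lambda>x. w x + y * neg u x) = \<Psi> a (b + y)" by (simp add: \<Psi>_def)
      also have "\<dots> \<le> \<Psi> a b" using y ab by (intro max) auto
      finally show "J (\<lambda>x. w x + y * neg u x) \<le> J (\<lambda>x. w x + 0 * neg u x)" by (simp add: \<Psi>_def w_def)
    qed
  qed
  have "w \<in> nodal"
    unfolding nodal_def pw nw mem_Collect_eq
    using wW a0 b0 Rp Rn dJ_scale[OF wW pW, of a] dJ_scale[OF wW nW, of b] dp dn R_scale[OF pW, of a] R_scale[OF nW, of b]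
    by simp
  then show ?thesis using a0 b0 unfolding w_def by (intro that)
qed

text \<open>
  Bumps supported in the two halves of a ball around the origin provide a sign-changing function.
\<close>
lemma nodal_nonempty: "nodal \<noteq> {}"
proof -
  obtain \<rho> where \<rho>: "0 < \<rho>" "ball 0 \<rho> \<subseteq> \<Omega>" using \<Omega>_open \<Omega>_0 open_contains_ball by blast
  obtain d :: 'a where d: "d \<in> Basis" using nonempty_Basis by blast
  define U where "U = ball 0 \<rho> \<inter> {x. 0 < x \<bullet> d}"
  define V where "V = ball 0 \<rho> \<inter> {x. x \<bullet> d < 0}"
  have o: "open U" "open V"
    unfolding U_def V_def by (intro open_Int open_ball open_Collect_less continuous_intros)+
  have sub: "U \<subseteq> \<Omega>" "V \<subseteq> \<Omega>" using \<rho>(2) by (auto simp: U_def V_def)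
  have "(\<rho> / 2) *\<^sub>R d \<in> U" "(- (\<rho> / 2)) *\<^sub>R d \<in> V" using \<rho>(1) d by (auto simp: U_def V_def)
  then have ne: "U \<noteq> {}" "V \<noteq> {}" by blast+
  define f where "f = (\<lambda>x. infdist x (- U))"
  define g where "g = (\<lambda>x. infdist x (- V))"
  have fg: "f \<in> W" "g \<in> W" "0 < R f" "0 < R g"
    unfolding f_def g_def using o sub ne infdist_complement_in_W infdist_complement_R_pos by auto
  define u where "u = (\<lambda>x. f x - g x)"
  have disj: "f x = 0 \<or> g x = 0" for x
  proof (cases "x \<in> U")
    case True
    then have "x \<in> - V" by (auto simp: U_def V_def)
    then show ?thesis by (simp add: g_def)
  qed (simp add: f_def)
  have nn: "0 \<le> f x" "0 \<le> g x" for x by (simp_all add: f_def g_def infdist_nonneg)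
  have u: "u \<in> W" unfolding u_def by (rule W_diff[OF fg(1,2)])
  have "pos u = f" "neg u = (\<lambda>x. - g x)"
    using disj nn by (auto simp: u_def fun_eq_iff) (metis diff_0 diff_zero max.absorb1 max.absorb2 min.absorb1 min.absorb2 neg_le_0_iff_le)+
  then have "0 < R (pos u)" "0 < R (neg u)" using fg R_minus[of g] by simp_all
  then show ?thesis using nodal_scaling[OF u] by blast
qed

text \<open>
  The signed parts satisfy \<open>A (u\<^sub>n\<^sup>+) \<le> \<Lambda> R (u\<^sub>n\<^sup>+)\<close>, so they do not vanish in the limit. The limit is scaled
  back to the nodal set, and the same scaling of the \<open>u\<^sub>n\<close> does not increase their energy.
\<close>
lemma nodal_minimizer:
  obtains u where "u \<in> nodal" "\<And>v. v \<in> nodal \<Longrightarrow> J u \<le> J v"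
proof -
  have Jnn: "0 \<le> J v" if "v \<in> nodal" for v
    using J_on_nehari[OF nodal_dA(3)[OF that]] pr_pos \<Lambda> by simp
  obtain u c where u: "\<And>n::nat. u n \<in> nodal" and c: "(\<lambda>n. J (u n)) \<longlonglongrightarrow> c"
    and cle: "\<And>v. v \<in> nodal \<Longrightarrow> c \<le> J v"
    using minimizing_sequence[OF nodal_nonempty, of J] Jnn by metis
  have uW: "u n \<in> W" and uN: "A (u n) = \<Lambda> * R (u n)" for n
    using u[of n] nodal_dA(3)[OF u[of n]] by (auto simp: nodal_def)
  obtain G where G: "\<And>n. E (u n) \<le> G" by (rule nehari_sequence_bounded[OF uW uN c]) blast
  obtain \<rho> :: "nat \<Rightarrow> nat" and v where \<rho>: "strict_mono \<rho>" and v: "v \<in> W"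
    and lim: "AE x in lebesgue. (\<lambda>n. u (\<rho> n) x) \<longlonglongrightarrow> v x"
    by (rule W_compact[OF uW G])
  obtain c0 where c0: "0 < c0" "\<forall>u\<in>W. 0 < R u \<longrightarrow> A u \<le> \<Lambda> * R u \<longrightarrow> c0 \<le> R u"
    using R_lower_bound by blast
  have Rp: "c0 \<le> R (pos (u n))" "c0 \<le> R (neg (u n))" for n
    using c0(2) W_pos(1)[OF uW[of n]] W_neg(1)[OF uW[of n]] u[of n] A_pos_le[OF uW[of n]] A_neg_le[OF uW[of n]]
      nodal_dA(1,2)[OF u[of n]] by (auto simp: nodal_def)
  have "c0 \<le> R (pos v)"
  proof (rule LIMSEQ_le_const[OF R_tendsto[where u = "\<lambda>n. pos (u (\<rho> n))"]])
    show "pos (u (\<rho> n)) \<in> W" for n by (rule W_pos(1)[OF uW])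
    show "E (pos (u (\<rho> n))) \<le> G" for n using W_pos(2)[OF uW[of "\<rho> n"]] G[of "\<rho> n"] by linarith
    show "AE x in lebesgue. (\<lambda>n. pos (u (\<rho> n)) x) \<longlonglongrightarrow> pos v x"
      using lim by eventually_elim (intro tendsto_max tendsto_const)
  qed (use Rp W_pos(1)[OF v] in auto)
  moreover have "c0 \<le> R (neg v)"
  proof (rule LIMSEQ_le_const[OF R_tendsto[where u = "\<lambda>n. neg (u (\<rho> n))"]])
    show "neg (u (\<rho> n)) \<in> W" for n by (rule W_neg(1)[OF uW])
    show "E (neg (u (\<rho> n))) \<le> G" for n using W_neg(2)[OF uW[of "\<rho> n"]] G[of "\<rho> n"] by linarith
    show "AE x in lebesgue. (\<lambda>n. neg (u (\<rho> n)) x) \<longlonglongrightarrow> neg v x"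
      using lim by eventually_elim (intro tendsto_min tendsto_const)
  qed (use Rp W_neg(1)[OF v] in auto)
  ultimately have "0 < R (pos v)" "0 < R (neg v)" using c0(1) by linarith+
  then obtain a b where ab: "0 < a" "0 < b" "(\<lambda>x. scale_parts a b (v x)) \<in> nodal"
    using nodal_scaling[OF v] by blast
  have E2: "E (\<lambda>x. scale_parts a b (w x)) \<le> 2 powr p * (a powr p * E w + b powr p * E w)" if w: "w \<in> W" for w
  proof -
    have "E (\<lambda>x. scale_parts a b (w x)) \<le> 2 powr p * (E (\<lambda>x. a * pos w x) + E (\<lambda>x. b * neg w x))"
      using Lp_add(2)[OF W_incr_Lp[OF W_scale[OF W_pos(1)[OF w], of a]] W_incr_Lp[OF W_scale[OF W_neg(1)[OF w], of b]] p0(2)]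
      unfolding E_def scale_parts_def by (simp add: incr_def[abs_def] algebra_simps)
    also have "\<dots> \<le> 2 powr p * (a powr p * E w + b powr p * E w)"
      using ab W_pos(2)[OF w] W_neg(2)[OF w]
      by (simp add: E_scale[OF W_pos(1)[OF w]] E_scale[OF W_neg(1)[OF w]] add_mono mult_left_mono)
    finally show ?thesis .
  qed
  have "J (\<lambda>x. scale_parts a b (v x)) \<le> c"
  proof (rule J_lower_semicontinuous)
    show "(\<lambda>x. scale_parts a b (u (\<rho> n) x)) \<in> W" for n by (rule scale_parts_in_W[OF uW])
    show "E (\<lambda>x. scale_parts a b (u (\<rho> n) x)) \<le> 2 powr p * (a powr p * G + b powr p * G)" for n
      by (rule order.trans[OF E2[OF uW]]) (intro mult_left_mono add_mono G; simp)
    show "(\<lambda>x. scale_parts a b (v x)) \<in> W" by (rule scale_parts_in_W[OF v])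
    show "AE x in lebesgue. (\<lambda>n. scale_parts a b (u (\<rho> n) x)) \<longlonglongrightarrow> scale_parts a b (v x)"
      using lim unfolding scale_parts_def by eventually_elim (intro tendsto_intros tendsto_max tendsto_min)
    show "J (\<lambda>x. scale_parts a b (u (\<rho> n) x)) \<le> J (u (\<rho> n))" for n
      using ab by (intro nodal_fibre_le u) auto
    show "(\<lambda>n. J (u (\<rho> n))) \<longlonglongrightarrow> c" using LIMSEQ_subseq_LIMSEQ[OF c \<rho>] by (simp add: o_def)
  qed
  then show ?thesis using ab(3) cle by (intro that[of "\<lambda>x. scale_parts a b (v x)"]) (auto intro: order.trans)
qed

end

section \<open>Criticality of the nodal minimizer\<close>

context hardy_problem
begin

lemma box3_negative_near:
  assumes "continuous_on (box3 2) f" "f (1, 1, 0) < (0::real)"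
  obtains \<delta> where "0 < \<delta>" "\<And>a b e. \<bar>a - 1\<bar> \<le> \<delta> \<Longrightarrow> \<bar>b - 1\<bar> \<le> \<delta> \<Longrightarrow> \<bar>e\<bar> \<le> \<delta> \<Longrightarrow> f (a, b, e) < 0"
proof -
  have t0: "(1, 1, 0) \<in> box3 2" by (simp add: box3_def)
  then obtain d where d: "0 < d" "\<And>t. t \<in> box3 2 \<Longrightarrow> dist t (1, 1, 0) < d \<Longrightarrow> dist (f t) (f (1, 1, 0)) < - f (1, 1, 0)"
    using assms unfolding continuous_on_iff by (metis neg_0_less_iff_less)
  show ?thesis
  proof (rule that)
    \<comment> \<open>The distance to \<open>(1, 1, 0)\<close> is at most the sum of three coordinate distances; the bound \<open>1/2\<close> stays in the box.\<close>
    show "0 < min (1 / 2) (d / 4)" using d(1) by simp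
    fix a b e :: real
    assume *: "\<bar>a - 1\<bar> \<le> min (1 / 2) (d / 4)" "\<bar>b - 1\<bar> \<le> min (1 / 2) (d / 4)" "\<bar>e\<bar> \<le> min (1 / 2) (d / 4)"
    have "dist (a, b, e) (1, 1, 0) \<le> \<bar>a - 1\<bar> + (\<bar>b - 1\<bar> + \<bar>e\<bar>)"
      using norm_Pair_le[of "a - 1" "(b - 1, e)"] norm_Pair_le[of "b - 1" e] by (simp add: dist_norm)
    also have "\<dots> < d" using * d(1) by linarith
    finally have close: "dist (a, b, e) (1, 1, 0) < d" .
    have "\<bar>a\<bar> \<le> 2" "\<bar>b\<bar> \<le> 2" "\<bar>e\<bar> \<le> 2" using * by linarith+
    then have "dist (f (a, b, e)) (f (1, 1, 0)) < - f (1, 1, 0)"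
      by (intro d(2) close) (simp add: box3_def)
    then show "f (a, b, e) < 0" by (simp add: dist_real_def)
  qed
qed

text \<open>
  If \<open>dJ u v < 0\<close>, then \<open>J\<close> drops below its value at the minimizer on the whole perturbed square
  \<open>a u\<^sup>+ + b u\<^sup>- + e v\<close>, because on the unperturbed one it is at most \<open>J u\<close>. On the sides of the
  unperturbed square the two Nehari equations have the opposite signs that Miranda's theorem
  asks for, so for small \<open>e\<close> the perturbed square still contains a nodal point.
\<close>
lemma nodal_minimizer_descent_impossible:
  assumes u: "u \<in> nodal" and min: "\<And>v. v \<in> nodal \<Longrightarrow> J u \<le> J v" and v: "v \<in> W"
  shows "\<not> dJ u v < 0"
proof
  assume neg: "dJ u v < 0"
  have uW: "u \<in> W" and Rp: "0 < R (pos u)" and Rn: "0 < R (neg u)" using u by (auto simp: nodal_def)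
  note cont = continuous_on_comb_instances[OF uW v, of 2, simplified]
  have c0: "comb u v (1, 1, 0) = u" by (auto simp: comb_def)
  obtain \<delta>1 where \<delta>1: "0 < \<delta>1"
    "\<And>a b e. \<bar>a - 1\<bar> \<le> \<delta>1 \<Longrightarrow> \<bar>b - 1\<bar> \<le> \<delta>1 \<Longrightarrow> \<bar>e\<bar> \<le> \<delta>1 \<Longrightarrow> dJ (comb u v (a, b, e)) v < 0"
    by (rule box3_negative_near[OF cont(1)]) (use neg in \<open>auto simp: c0\<close>)
  obtain \<delta>2 where \<delta>2: "0 < \<delta>2"
    "\<And>a b e. \<bar>a - 1\<bar> \<le> \<delta>2 \<Longrightarrow> \<bar>b - 1\<bar> \<le> \<delta>2 \<Longrightarrow> \<bar>e\<bar> \<le> \<delta>2 \<Longrightarrow> - dR (comb u v (a, b, e)) (pos (comb u v (a, b, e))) < 0"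
    by (rule box3_negative_near[OF continuous_on_minus[OF cont(4)]]) (use Rp in \<open>auto simp: c0 dR_pos\<close>)
  obtain \<delta>3 where \<delta>3: "0 < \<delta>3"
    "\<And>a b e. \<bar>a - 1\<bar> \<le> \<delta>3 \<Longrightarrow> \<bar>b - 1\<bar> \<le> \<delta>3 \<Longrightarrow> \<bar>e\<bar> \<le> \<delta>3 \<Longrightarrow> - dR (comb u v (a, b, e)) (neg (comb u v (a, b, e))) < 0"
    by (rule box3_negative_near[OF continuous_on_minus[OF cont(5)]]) (use Rn in \<open>auto simp: c0 dR_neg\<close>)
  \<comment> \<open>On this neighbourhood \<open>J\<close> decreases in direction \<open>v\<close> and both parts stay nonzero.\<close>
  define \<delta> where "\<delta> = min (1 / 2) (min \<delta>1 (min \<delta>2 \<delta>3))"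
  have \<delta>: "0 < \<delta>" "\<delta> \<le> 1 / 2" "\<delta> \<le> \<delta>1" "\<delta> \<le> \<delta>2" "\<delta> \<le> \<delta>3" using \<delta>1 \<delta>2 \<delta>3 by (auto simp: \<delta>_def)
  define l where "l = 1 - \<delta>"
  define h where "h = 1 + \<delta>"
  have lh: "0 < l" "l < 1" "1 < h" "l < h" "l \<le> h" "h \<le> 2" using \<delta> by (auto simp: l_def h_def)
  have near: "\<bar>a - 1\<bar> \<le> \<delta>" if "a \<in> {l..h}" for a using that by (auto simp: l_def h_def)
  have box: "(a, b, e) \<in> box3 2" if "a \<in> {l..h}" "b \<in> {l..h}" "e \<in> {0..\<delta>}" for a b e
    using that lh \<delta> by (auto simp: box3_def)
  define f1 where "f1 = (\<lambda>t. dJ (comb u v t) (pos (comb u v t)))"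
  define f2 where "f2 = (\<lambda>t. dJ (comb u v t) (neg (comb u v t)))"
  have cf: "continuous_on (box3 2) f1" "continuous_on (box3 2) f2" using cont(2,3) by (simp_all add: f1_def f2_def)
  have z: "comb u v (a, b, 0) = (\<lambda>x. scale_parts a b (u x))" for a b by (auto simp: comb_def)
  \<comment> \<open>On the sides \<open>a = h > 1\<close> and \<open>a = l < 1\<close> the sign is that of \<open>a\<^sup>p - a\<^sup>r\<close>.\<close>
  have hp: "h powr p * (\<Lambda> * X) - \<Lambda> * (h powr r * X) < 0" if "0 < X" for X
  proof -
    have "h powr p < h powr r" using lh pr by (intro powr_less_mono) auto
    then have "h powr p * (\<Lambda> * X) < h powr r * (\<Lambda> * X)" using \<Lambda> that by (intro mult_strict_right_mono) auto
    then show ?thesis by (simp add: mult_ac)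
  qed
  have lp: "0 < l powr p * (\<Lambda> * X) - \<Lambda> * (l powr r * X)" if "0 < X" for X
  proof -
    have "l powr r < l powr p" using lh pr by (intro powr_less_mono') auto
    then have "l powr r * (\<Lambda> * X) < l powr p * (\<Lambda> * X)" using \<Lambda> that by (intro mult_strict_right_mono) auto
    then show ?thesis by (simp add: mult_ac)
  qed
  have s1: "f1 (h, b, 0) < 0" "- f1 (l, b, 0) < 0" if "b \<in> {l..h}" for b
    using dJ_scale_parts_pos(1)[OF uW, of h b] dJ_scale_parts_pos(2)[OF uW, of l b] hp[OF Rp] lp[OF Rp] that lh
    unfolding f1_def z nodal_dA(1)[OF u] by auto
  have s2: "f2 (a, h, 0) < 0" "- f2 (a, l, 0) < 0" if "a \<in> {l..h}" for a
    using dJ_scale_parts_neg(1)[OF uW, of a h] dJ_scale_parts_neg(2)[OF uW, of a l] hp[OF Rn] lp[OF Rn] that lh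
    unfolding f2_def z nodal_dA(2)[OF u] by auto
  have side: "continuous_on ({l..h} \<times> {0..\<delta>}) (\<lambda>t. f (k, fst t, snd t))"
    "continuous_on ({l..h} \<times> {0..\<delta>}) (\<lambda>t. f (fst t, k, snd t))"
    if "continuous_on (box3 2) f" "k \<in> {l..h}" for f :: "real \<times> real \<times> real \<Rightarrow> real" and k
  proof -
    show "continuous_on ({l..h} \<times> {0..\<delta>}) (\<lambda>t. f (k, fst t, snd t))"
      by (rule continuous_on_compose2[OF that(1)]) (use that(2) box in \<open>auto intro!: continuous_intros\<close>)
    show "continuous_on ({l..h} \<times> {0..\<delta>}) (\<lambda>t. f (fst t, k, snd t))"
      by (rule continuous_on_compose2[OF that(1)]) (use that(2) box in \<open>auto intro!: continuous_intros\<close>)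
  qed
  have k: "l \<in> {l..h}" "h \<in> {l..h}" using lh by auto
  obtain e1 where e1: "0 < e1" "e1 \<le> \<delta>" "\<forall>b\<in>{l..h}. \<forall>e\<in>{0..e1}. f1 (h, b, e) < 0"
    using negative_persists[OF side(1)[OF cf(1) k(2)] \<delta>(1) lh(5)] s1(1) by auto
  obtain e2 where e2: "0 < e2" "\<forall>b\<in>{l..h}. \<forall>e\<in>{0..e2}. - f1 (l, b, e) < 0"
    using negative_persists[OF side(1)[OF continuous_on_minus[OF cf(1)] k(1)] \<delta>(1) lh(5)] s1(2) by auto
  obtain e3 where e3: "0 < e3" "\<forall>a\<in>{l..h}. \<forall>e\<in>{0..e3}. f2 (a, h, e) < 0"
    using negative_persists[OF side(2)[OF cf(2) k(2)] \<delta>(1) lh(5)] s2(1) by auto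
  obtain e4 where e4: "0 < e4" "\<forall>a\<in>{l..h}. \<forall>e\<in>{0..e4}. - f2 (a, l, e) < 0"
    using negative_persists[OF side(2)[OF continuous_on_minus[OF cf(2)] k(1)] \<delta>(1) lh(5)] s2(2) by auto
  define e where "e = min (min e1 e2) (min e3 e4)"
  have e: "0 < e" "e \<le> e1" "e \<le> e2" "e \<le> e3" "e \<le> e4" "e \<le> \<delta>"
    using e1 e2 e3 e4 by (auto simp: e_def)
  have sq: "continuous_on ({l..h} \<times> {l..h}) (\<lambda>t. f (fst t, snd t, e))"
    if "continuous_on (box3 2) f" for f :: "real \<times> real \<times> real \<Rightarrow> real"
    by (rule continuous_on_compose2[OF that]) (use box e in \<open>auto intro!: continuous_intros\<close>)
  obtain a b where ab: "a \<in> {l..h}" "b \<in> {l..h}" "f1 (a, b, e) = 0" "f2 (a, b, e) = 0"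
  proof (rule miranda[OF lh(4) sq[OF cf(1)] sq[OF cf(2)]])
    show "0 < f1 (fst (l, b), snd (l, b), e)" if "b \<in> {l..h}" for b using bspec[OF e2(2) that] e by simp
    show "f1 (fst (h, b), snd (h, b), e) < 0" if "b \<in> {l..h}" for b using bspec[OF e1(3) that] e by simp
    show "0 < f2 (fst (a, l), snd (a, l), e)" if "a \<in> {l..h}" for a using bspec[OF e4(2) that] e by simp
    show "f2 (fst (a, h), snd (a, h), e) < 0" if "a \<in> {l..h}" for a using bspec[OF e3(2) that] e by simp
  qed simp
  define w where "w = comb u v (a, b, e)"
  have a1: "\<bar>a - 1\<bar> \<le> \<delta>" "\<bar>b - 1\<bar> \<le> \<delta>" using near ab by auto
  have "w \<in> nodal"
    unfolding nodal_def
    using comb_in_W[OF uW v, of "(a, b, e)"] ab(3,4) \<delta>2(2)[of a b e] \<delta>3(2)[of a b e] a1 e \<delta>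
    by (simp add: w_def f1_def f2_def dR_pos dR_neg)
  then have "J u \<le> J w" by (rule min)
  also have "J w < J (\<lambda>x. scale_parts a b (u x))"
  proof -
    define \<psi> where "\<psi> = (\<lambda>t. J (\<lambda>x. scale_parts a b (u x) + t * v x))"
    have "\<psi> e < \<psi> 0"
    proof (rule DERIV_neg_imp_decreasing[OF e(1)])
      fix t assume t: "0 \<le> t" "t \<le> e"
      have "(\<psi> has_real_derivative dJ (comb u v (a, b, t)) v) (at t)"
        unfolding \<psi>_def using J_has_derivative[OF scale_parts_in_W[OF uW] v, of a b t] by (simp add: comb_def[abs_def])
      moreover have "dJ (comb u v (a, b, t)) v < 0" using t a1 e \<delta> by (intro \<delta>1(2)) auto
      ultimately show "\<exists>y. (\<psi> has_real_derivative y) (at t) \<and> y < 0" by blast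
    qed
    then show ?thesis by (simp add: \<psi>_def w_def comb_def[abs_def])
  qed
  also have "\<dots> \<le> J u" using ab lh by (intro nodal_fibre_le u) auto
  finally show False by simp
qed

lemma nodal_minimizer_critical:
  assumes u: "u \<in> nodal" and min: "\<And>v. v \<in> nodal \<Longrightarrow> J u \<le> J v" and v: "v \<in> W"
  shows "dJ u v = 0"
proof -
  have uW: "u \<in> W" using u by (simp add: nodal_def)
  have "dJ u (\<lambda>x. - v x) = - dJ u v" using dJ_scale[OF uW v, of "-1"] by simp
  then show ?thesis
    using nodal_minimizer_descent_impossible[OF u min v] nodal_minimizer_descent_impossible[OF u min W_minus[OF v]]
    by simp
qed

lemma sign_changing_iff:
  assumes "u \<in> W"
  shows "sign_changing u \<longleftrightarrow> 0 < R (pos u) \<and> 0 < R (neg u)"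
  using R_eq_0_iff[OF W_pos(1)[OF assms]] R_eq_0_iff[OF W_neg(1)[OF assms]]
    R_nonneg[of "pos u"] R_nonneg[of "neg u"]
  unfolding sign_changing_def by (metis less_eq_real_def less_irrefl)

theorem exists_sign_changing_solution_of_minimal_energy:
  "\<exists>u. minimizes_on (energy s p r \<Lambda> \<mu> \<Omega>)
     (\<lambda>w. weak_solution s p r \<Lambda> \<mu> \<Omega> w \<and> sign_changing w) u"
proof -
  obtain u where u: "u \<in> nodal" and min: "\<And>v. v \<in> nodal \<Longrightarrow> J u \<le> J v"
    by (rule nodal_minimizer) blast
  have uW: "u \<in> W" using u by (simp add: nodal_def)
  have crit: "dJ u v = 0" if "v \<in> W" for v by (rule nodal_minimizer_critical[OF u min that])
  have ws: "weak_solution s p r \<Lambda> \<mu> \<Omega> u" unfolding weak_solution_iff using uW crit by blast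
  have sc: "sign_changing u" using u by (simp add: sign_changing_iff[OF uW] nodal_def)
  show ?thesis
    unfolding minimizes_on_def
  proof (intro exI[of _ u] conjI allI impI ws sc)
    fix w assume w: "weak_solution s p r \<Lambda> \<mu> \<Omega> w \<and> sign_changing w"
    then have wW: "w \<in> W" and wc: "\<And>v. v \<in> W \<Longrightarrow> dJ w v = 0" by (auto simp: weak_solution_iff)
    have "w \<in> nodal"
      using w wW wc[OF W_pos(1)[OF wW]] wc[OF W_neg(1)[OF wW]] by (simp add: nodal_def sign_changing_iff[OF wW])
    then show "energy s p r \<Lambda> \<mu> \<Omega> u \<le> energy s p r \<Lambda> \<mu> \<Omega> w"
      using min by (simp add: energy_eq_J uW wW)
  qed
qed

end

theorem theorem1p4:
  fixes \<Omega> :: "'a::euclidean_space set"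
    and s p r \<Lambda> \<mu> :: real
  assumes "0 < s" and "s < 1" and "1 < p"
    and "open \<Omega>" and "bounded \<Omega>" and "smooth_boundary \<Omega>" and "0 \<in> \<Omega>"
    and "p * s < real DIM('a)"
    and "p < r" and "r < crit_exp DIM('a) s p"
    and "0 < \<Lambda>" and "0 < \<mu>" and "ennreal \<mu> < hardy_const s p \<Omega>"
  shows "(\<exists>u. minimizes_on (energy s p r \<Lambda> \<mu> \<Omega>)
                (\<lambda>w. weak_solution s p r \<Lambda> \<mu> \<Omega> w \<and> positive_on \<Omega> w) u) \<and>
         (\<exists>u. minimizes_on (energy s p r \<Lambda> \<mu> \<Omega>)
                (\<lambda>w. weak_solution s p r \<Lambda> \<mu> \<Omega> w \<and> sign_changing w) u)"
proof -
  interpret hardy_problem \<Omega> s p r \<Lambda> \<mu> by unfold_locales (fact assms)+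
  show ?thesis
    using exists_positive_solution_of_minimal_energy exists_sign_changing_solution_of_minimal_energy by blast
qed

end
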